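(* Let $(Z_1,Z_2)$ satisfy the functional limit condition with parameters $(\mu,h,\ell,Y_1,Y_2)$, let $0<\nu<\frac1{1-h}$, and suppose the no-early-stopping condition holds for $Z_2$ with exponent $\nu$ (all defined in the context). For $c>0$, $\varepsilon>0$ let $$T_c(\varepsilon):=\inf\Big\{n\in\mathbb N:\ n>\varepsilon^{-\nu},\ c\sqrt{Z_2(n)/n^2}<\varepsilon\Big\},\qquad \Phi_c(u):=\inf\Big\{s>0:\ c\,\frac{\sqrt{Y_2(s)}}{s}<u\Big\},\quad u>0.$$ Suppose that $\Phi_1(1)>0$ almost surely. Fix $c>0$ and suppose that $\Phi_c(\cdot)$ is almost surely continuous at $1$. Then, as $\varepsilon\to0^+$, $$\frac{Z_1(T_c(\varepsilon))-T_c(\varepsilon)\mu}{\sqrt{Z_2(T_c(\varepsilon))}}\ \overset{d}{\to}\ \frac{Y_1(\Phi_c(1))}{\sqrt{Y_2(\Phi_c(1))}}=:W_c .$$ The distribution of $W_c$ does not depend on $c$. Further, fix $\delta\in(0,1)$, let $F$ denote the common distribution function of the $W_c$, and define $c_l=F^{\leftarrow}(\delta/2)$, $c_u=F^{\leftarrow}(1-\delta/2)$, $c^*=c_u-c_l$. Suppose that $c_l<c_u$, that $F$ is continuous at $c_l$ and $c_u$, and that $\Phi_{c^*}(\cdot)$ is almost surely continuous at $1$. Then, with $T^*=T_{c^*}(\varepsilon)$, the confidence interval $$\mathrm{CI}(\varepsilon):=\Big[\frac{Z_1(T^* )}{T^*}-c_u\sqrt{\frac{Z_2(T^* )}{(T^*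 )^2}},\ \frac{Z_1(T^* )}{T^*}-c_l\sqrt{\frac{Z_2(T^* )}{(T^* )^2}}\Big]$$ satisfies $\mathbb P(\mu\in\mathrm{CI}(\varepsilon))\to1-\delta$ as $\varepsilon\to0^+$.
   Context: Conventions. $\inf\varnothing=+\infty$; $F^{\leftarrow}(p)=\inf\{x:F(x)\ge p\}$. Whenever a terminal self-normalized statistic has a zero denominator, it is defined to be zero. Topologies. Write $\mathbb D=D([0,\infty),\mathbb R)$ and $\mathbb D_+=D([0,\infty),\mathbb R_+)$ for càdlàg paths. For a càdlàg $x$ on $[0,T]$, its completed graph is $\Gamma_x=\{(t,z): t\in[0,T],\ z$ between $x(t-)$ and $x(t)$ inclusive$\}$, with $x(0-):=x(0)$. The $M_2$ topology on $D([0,T],\mathbb R)$ is induced by the Hausdorff distance between completed graphs. Convergence on $[0,\infty)$ means convergence of the restrictions to $[0,T]$ for every continuity point $T$ of the limit. $\mathrm{WM}_2$ denotes the product of the univariate $M_2$ topologies over the two coordinates. Functional limit condition with parameters $(\mu,h,\ell,Y_1,Y_2)$. $Z_1,Z_2$ are processes with sample paths in $\mathbb D$ and $\mathbb D_+$, $Z_1(0)=0$ a.s.; $\mu,h\in\mathbb R$; $\ell$ is an eventually positive function slowly varying at infinity; $Y_1\in\mathbb D$, $Y_2\in\mathbb D_+$ are processes such that, as $\varepsilon\to0^+$, $$\Big(\varepsilon^h\ell(\varepsilon^{-1})\big(Z_1(\tfrac{\cdot}{\varepsilon})-\tfrac{\cdot}{\varepsilon}\mu\big),\ \varepsilon^h\ell(\varepsilon^{-1})\sqrt{Z_2(\tfrac{\cdot}{\varepsilon})}\Big)\Rightarrow\big(Y_1(\cdot),\sqrt{Y_2(\cdot)}\big)\quad\text{weakly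 in }\mathrm{WM}_2.$$ Let $\mathbb F^Y$ be the usual augmentation of the natural filtration of $(Y_1,Y_2)$. Moreover: (a) $0<h<1$; (b) as $t\to\infty$, $(Z_1(t)-\mu t)/t\to0$ and $Z_2(t)/t^2\to0$ a.s.; (c) for every $a>0$, $(Y_1(a\,\cdot),Y_2(a\,\cdot))\overset d=(a^hY_1(\cdot),a^{2h}Y_2(\cdot))$; (d) $Y_1$ is quasi-left-continuous with respect to $\mathbb F^Y$: for every finite $\mathbb F^Y$-predictable stopping time $\tau$, $\mathbb P(\Delta Y_1(\tau)=0)=1$; (e) almost surely $Y_2(t)>0$ for every $t>0$, and $Y_2$ has no negative jumps. Time scale. $A(x):=x^{1-h}\ell(x)$ and $a_\varepsilon:=A^{\leftarrow}(\varepsilon^{-1})$, where $A^{\leftarrow}$ is an asymptotic inverse of $A$ (so $A(A^\leftarrow(x))\sim x$ as $x\to\infty$). No-early-stopping condition for $Z_2$ with exponent $\nu$: for every $K>0$, $$\lim_{\eta\downarrow0}\limsup_{\varepsilon\downarrow0}\mathbb P\Big(\inf_{n\in\mathbb N:\ \varepsilon^{-\nu}\le n\le\eta a_\varepsilon}\frac{\sqrt{Z_2(n)}}{n}\le K\varepsilon\Big)=0.$$ *)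

theory Defs
  imports "HOL-Probability.Probability" "HOL-Library.Landau_Symbols"
begin

section \<open>Paths and the M2 topology\<close>

text \<open>A path on [0, \<infinity>) is a function real => real whose values at negative times are ignored.
  A process is a function X with X t \<omega> the value at time t.\<close>

definition cadlag :: "(real \<Rightarrow> real) \<Rightarrow> bool" where
  "cadlag x \<longleftrightarrow> (\<forall>t\<ge>0. continuous (at_right t) x) \<and> (\<forall>t>0. \<exists>l. (x \<longlongrightarrow> l) (at_left t))"

definition left_lim :: "(real \<Rightarrow> real) \<Rightarrow> real \<Rightarrow> real" where
  "left_lim x t = (if t \<le> 0 then x 0 else Lim (at_left t) x)"

definition completed_graph :: "real \<Rightarrow> (real \<Rightarrow> real) \<Rightarrow> (real \<times> real) set" where
  "completed_graph T x = {(t, z). 0 \<le> t \<and> t \<le> T \<and> z \<in> closed_segment (left_lim x t) (x t)}"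

text \<open>Meant for nonempty bounded sets only (the real suprema are unspecified otherwise).\<close>

definition hausdorff_distance :: "'a::metric_space set \<Rightarrow> 'a set \<Rightarrow> real" where
  "hausdorff_distance A B = max (SUP a\<in>A. infdist a B) (SUP b\<in>B. infdist b A)"

definition M2_dist :: "real \<Rightarrow> (real \<Rightarrow> real) \<Rightarrow> (real \<Rightarrow> real) \<Rightarrow> real" where
  "M2_dist T x y = hausdorff_distance (completed_graph T x) (completed_graph T y)"

definition M2_tendsto :: "(nat \<Rightarrow> real \<Rightarrow> real) \<Rightarrow> (real \<Rightarrow> real) \<Rightarrow> bool" where
  "M2_tendsto X x \<longleftrightarrow> (\<forall>T>0. isCont x T \<longrightarrow> (\<lambda>n. M2_dist T (X n) x) \<longlonglongrightarrow> 0)"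

text \<open>M2 convergence on [0, \<infinity>) is metrizable, so the continuous functionals on the product space are
  exactly the sequentially continuous ones.\<close>

definition WM2_continuous :: "((real \<Rightarrow> real) \<times> (real \<Rightarrow> real) \<Rightarrow> real) \<Rightarrow> bool" where
  "WM2_continuous f \<longleftrightarrow>
     (\<forall>X1 X2 x1 x2. (\<forall>n. cadlag (X1 n) \<and> cadlag (X2 n)) \<and> cadlag x1 \<and> cadlag x2 \<and>
        M2_tendsto X1 x1 \<and> M2_tendsto X2 x2 \<longrightarrow> (\<lambda>n. f (X1 n, X2 n)) \<longlonglongrightarrow> f (x1, x2))"

text \<open>Weak convergence as \<epsilon> decreases to 0. The Borel sigma-algebra of the WM2 topology is the one
  generated by the coordinate maps, so the integrands are measurable as soon as all coordinates of
  the random paths are.\<close>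

definition weak_conv_WM2 ::
  "'a measure \<Rightarrow> (real \<Rightarrow> 'a \<Rightarrow> (real \<Rightarrow> real) \<times> (real \<Rightarrow> real)) \<Rightarrow>
   'b measure \<Rightarrow> ('b \<Rightarrow> (real \<Rightarrow> real) \<times> (real \<Rightarrow> real)) \<Rightarrow> bool" where
  "weak_conv_WM2 M X N Y \<longleftrightarrow>
     (\<forall>f. WM2_continuous f \<and> bounded (f ` ({x. cadlag x} \<times> {x. cadlag x})) \<longrightarrow>
        ((\<lambda>\<epsilon>. \<integral>\<omega>. f (X \<epsilon> \<omega>) \<partial>M) \<longlongrightarrow> (\<integral>\<omega>. f (Y \<omega>) \<partial>N)) (at_right 0))"


section \<open>Filtrations and predictable times\<close>

definition natural_filtration ::
  "'b measure \<Rightarrow> (real \<Rightarrow> 'b \<Rightarrow> real) \<Rightarrow> (real \<Rightarrow> 'b \<Rightarrow> real) \<Rightarrow> real \<Rightarrow> 'b set set" where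
  "natural_filtration N Y1 Y2 t = sigma_sets (space N)
     (\<Union>s\<in>{0..t}. {Y1 s -` B \<inter> space N | B. B \<in> sets borel} \<union> {Y2 s -` B \<inter> space N | B. B \<in> sets borel})"

text \<open>The null sets of the completion are all subsets of N-null sets.\<close>

definition usual_augmentation :: "'b measure \<Rightarrow> (real \<Rightarrow> 'b set set) \<Rightarrow> real \<Rightarrow> 'b measure" where
  "usual_augmentation N G t =
     sigma (space N) (\<Inter>s\<in>{t<..}. sigma_sets (space N) (G s \<union> null_sets (completion N)))"

text \<open>Finite predictable stopping times, via announcing sequences. Under the usual conditions this is
  the same as measurability of the stochastic interval [\<tau>, \<infinity>) for the predictable sigma-algebra.\<close>

definition finite_predictable_time :: "'b measure \<Rightarrow> (real \<Rightarrow> 'b measure) \<Rightarrow> ('b \<Rightarrow> real) \<Rightarrow> bool" where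
  "finite_predictable_time N F \<tau> \<longleftrightarrow>
     stopping_time F \<tau> \<and> (\<forall>\<omega>\<in>space N. 0 \<le> \<tau> \<omega>) \<and>
     (\<exists>\<sigma>. (\<forall>n::nat. stopping_time F (\<sigma> n) \<and> (\<forall>\<omega>\<in>space N. 0 \<le> \<sigma> n \<omega>)) \<and>
          (AE \<omega> in N. incseq (\<lambda>n. \<sigma> n \<omega>) \<and> (\<lambda>n. \<sigma> n \<omega>) \<longlonglongrightarrow> \<tau> \<omega> \<and>
                      (\<tau> \<omega> > 0 \<longrightarrow> (\<forall>n. \<sigma> n \<omega> < \<tau> \<omega>))))"

definition quasi_left_continuous :: "'b measure \<Rightarrow> (real \<Rightarrow> 'b measure) \<Rightarrow> (real \<Rightarrow> 'b \<Rightarrow> real) \<Rightarrow> bool" where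
  "quasi_left_continuous N F Y \<longleftrightarrow>
     (\<forall>\<tau>. finite_predictable_time N F \<tau> \<longrightarrow>
        (AE \<omega> in N. Y (\<tau> \<omega>) \<omega> - left_lim (\<lambda>t. Y t \<omega>) (\<tau> \<omega>) = 0))"


section \<open>The functional limit condition\<close>

definition slowly_varying :: "(real \<Rightarrow> real) \<Rightarrow> bool" where
  "slowly_varying L \<longleftrightarrow>
     (\<exists>x0. L \<in> borel_measurable (restrict_space borel {x0..})) \<and>
     (\<forall>r>0. ((\<lambda>x. L (r * x) / L x) \<longlongrightarrow> 1) at_top)"

definition asymptotic_inverse :: "(real \<Rightarrow> real) \<Rightarrow> (real \<Rightarrow> real) \<Rightarrow> bool" where
  "asymptotic_inverse A B \<longleftrightarrow> filterlim B at_top at_top \<and> (\<lambda>x. A (B x)) \<sim>[at_top] (\<lambda>x. x)"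

definition process_law ::
  "'b measure \<Rightarrow> (real \<Rightarrow> 'b \<Rightarrow> real) \<Rightarrow> (real \<Rightarrow> 'b \<Rightarrow> real) \<Rightarrow> (real \<Rightarrow> real \<times> real) measure" where
  "process_law N X1 X2 = distr N (Pi\<^sub>M {0..} (\<lambda>_. borel)) (\<lambda>\<omega>. \<lambda>t\<in>{0..}. (X1 t \<omega>, X2 t \<omega>))"

locale functional_limit =
  Z: prob_space M + Y: prob_space N for M :: "'a measure" and N :: "'b measure" +
  fixes Z1 Z2 :: "real \<Rightarrow> 'a \<Rightarrow> real"
    and \<mu> h :: real
    and L :: "real \<Rightarrow> real"
    and Y1 Y2 :: "real \<Rightarrow> 'b \<Rightarrow> real"
  assumes Z_measurable: "\<And>t. t \<ge> 0 \<Longrightarrow> Z1 t \<in> borel_measurable M"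
      "\<And>t. t \<ge> 0 \<Longrightarrow> Z2 t \<in> borel_measurable M"
    and Z_cadlag: "\<And>\<omega>. \<omega> \<in> space M \<Longrightarrow> cadlag (\<lambda>t. Z1 t \<omega>)"
      "\<And>\<omega>. \<omega> \<in> space M \<Longrightarrow> cadlag (\<lambda>t. Z2 t \<omega>)"
    and Z2_nonneg: "\<And>t \<omega>. t \<ge> 0 \<Longrightarrow> \<omega> \<in> space M \<Longrightarrow> Z2 t \<omega> \<ge> 0"
    and Z1_zero: "AE \<omega> in M. Z1 0 \<omega> = 0"
    and Y_measurable: "\<And>t. t \<ge> 0 \<Longrightarrow> Y1 t \<in> borel_measurable N"
      "\<And>t. t \<ge> 0 \<Longrightarrow> Y2 t \<in> borel_measurable N"
    and Y_cadlag: "\<And>\<omega>. \<omega> \<in> space N \<Longrightarrow> cadlag (\<lambda>t. Y1 t \<omega>)"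
      "\<And>\<omega>. \<omega> \<in> space N \<Longrightarrow> cadlag (\<lambda>t. Y2 t \<omega>)"
    and Y2_nonneg: "\<And>t \<omega>. t \<ge> 0 \<Longrightarrow> \<omega> \<in> space N \<Longrightarrow> Y2 t \<omega> \<ge> 0"
    and L_pos: "\<forall>\<^sub>F x in at_top. L x > 0"
    and L_slowly_varying: "slowly_varying L"
    and weak_limit: "weak_conv_WM2
        M (\<lambda>\<epsilon> \<omega>. (\<lambda>t. \<epsilon> powr h * L (1 / \<epsilon>) * (Z1 (t / \<epsilon>) \<omega> - t / \<epsilon> * \<mu>),
                   \<lambda>t. \<epsilon> powr h * L (1 / \<epsilon>) * sqrt (Z2 (t / \<epsilon>) \<omega>)))
        N (\<lambda>\<omega>. (\<lambda>t. Y1 t \<omega>, \<lambda>t. sqrt (Y2 t \<omega>)))"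
    and h_bounds: "0 < h" "h < 1"
    and Z1_lln: "AE \<omega> in M. ((\<lambda>t. (Z1 t \<omega> - \<mu> * t) / t) \<longlongrightarrow> 0) at_top"
    and Z2_lln: "AE \<omega> in M. ((\<lambda>t. Z2 t \<omega> / t^2) \<longlongrightarrow> 0) at_top"
    and self_similar: "\<And>a. a > 0 \<Longrightarrow>
        process_law N (\<lambda>t. Y1 (a * t)) (\<lambda>t. Y2 (a * t)) =
        process_law N (\<lambda>t \<omega>. a powr h * Y1 t \<omega>) (\<lambda>t \<omega>. a powr (2 * h) * Y2 t \<omega>)"
    and Y1_qlc: "quasi_left_continuous N (usual_augmentation N (natural_filtration N Y1 Y2)) Y1"
    and Y2_pos: "AE \<omega> in N. \<forall>t>0. Y2 t \<omega> > 0"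
    and Y2_no_neg_jumps: "AE \<omega> in N. \<forall>t>0. left_lim (\<lambda>s. Y2 s \<omega>) t \<le> Y2 t \<omega>"

text \<open>The infimum is taken in the extended reals, so that it is \<infinity> over the empty set.\<close>

definition no_early_stopping ::
  "'a measure \<Rightarrow> (real \<Rightarrow> 'a \<Rightarrow> real) \<Rightarrow> (real \<Rightarrow> real) \<Rightarrow> real \<Rightarrow> bool" where
  "no_early_stopping M Z2 a \<nu> \<longleftrightarrow>
     (\<forall>K>0. ((\<lambda>\<eta>. Limsup (at_right 0) (\<lambda>\<epsilon>. ereal (measure M
        {\<omega> \<in> space M.
           (INF n\<in>{n::nat. \<epsilon> powr (- \<nu>) \<le> real n \<and> real n \<le> \<eta> * a \<epsilon>}. ereal (sqrt (Z2 (real n) \<omega>) / real n))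
             \<le> ereal (K * \<epsilon>)}))) \<longlongrightarrow> 0) (at_right 0))"


section \<open>Stopping rules, statistics and convergence in distribution\<close>

text \<open>Infima over empty sets are \<infinity>; z2 and y2 are single paths.\<close>

definition stop_time :: "real \<Rightarrow> real \<Rightarrow> (real \<Rightarrow> real) \<Rightarrow> real \<Rightarrow> enat" where
  "stop_time \<nu> c z2 \<epsilon> = Inf (enat ` {n. real n > \<epsilon> powr (- \<nu>) \<and> c * sqrt (z2 (real n) / (real n)^2) < \<epsilon>})"

definition Phi :: "real \<Rightarrow> (real \<Rightarrow> real) \<Rightarrow> real \<Rightarrow> ereal" where
  "Phi c y2 u = Inf (ereal ` {s. s > 0 \<and> c * (sqrt (y2 s) / s) < u})"

text \<open>The times inserted below are almost surely finite under the functional limit condition; on the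
  exceptional null events the_enat and real_of_ereal pick arbitrary values. The convention for zero
  denominators is that of division.\<close>

definition stop_nat :: "(real \<Rightarrow> 'a \<Rightarrow> real) \<Rightarrow> real \<Rightarrow> real \<Rightarrow> real \<Rightarrow> 'a \<Rightarrow> nat" where
  "stop_nat Z2 \<nu> c \<epsilon> \<omega> = the_enat (stop_time \<nu> c (\<lambda>t. Z2 t \<omega>) \<epsilon>)"

definition terminal_statistic ::
  "(real \<Rightarrow> 'a \<Rightarrow> real) \<Rightarrow> (real \<Rightarrow> 'a \<Rightarrow> real) \<Rightarrow> real \<Rightarrow> real \<Rightarrow> real \<Rightarrow> real \<Rightarrow> 'a \<Rightarrow> real" where
  "terminal_statistic Z1 Z2 \<mu> \<nu> c \<epsilon> \<omega> =
     (let T = real (stop_nat Z2 \<nu> c \<epsilon> \<omega>) in (Z1 T \<omega> - T * \<mu>) / sqrt (Z2 T \<omega>))"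

definition limit_variable ::
  "(real \<Rightarrow> 'b \<Rightarrow> real) \<Rightarrow> (real \<Rightarrow> 'b \<Rightarrow> real) \<Rightarrow> real \<Rightarrow> 'b \<Rightarrow> real" where
  "limit_variable Y1 Y2 c \<omega> =
     (let s = real_of_ereal (Phi c (\<lambda>t. Y2 t \<omega>) 1) in Y1 s \<omega> / sqrt (Y2 s \<omega>))"

definition confidence_interval ::
  "(real \<Rightarrow> 'a \<Rightarrow> real) \<Rightarrow> (real \<Rightarrow> 'a \<Rightarrow> real) \<Rightarrow> real \<Rightarrow> real \<Rightarrow> real \<Rightarrow> real \<Rightarrow> 'a \<Rightarrow> real set" where
  "confidence_interval Z1 Z2 \<nu> cl cu \<epsilon> \<omega> =
     (let T = real (stop_nat Z2 \<nu> (cu - cl) \<epsilon> \<omega>)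
      in {Z1 T \<omega> / T - cu * sqrt (Z2 T \<omega> / T^2) .. Z1 T \<omega> / T - cl * sqrt (Z2 T \<omega> / T^2)})"

definition quantile :: "(real \<Rightarrow> real) \<Rightarrow> real \<Rightarrow> real" where
  "quantile F p = Inf {x. F x \<ge> p}"

text \<open>Convergence in distribution of the random variables S \<epsilon> to W as \<epsilon> decreases to 0, phrased through
  the library notion for sequences. Measurability is included because distr is meaningless without it.\<close>

definition converges_in_distribution ::
  "'a measure \<Rightarrow> (real \<Rightarrow> 'a \<Rightarrow> real) \<Rightarrow> 'b measure \<Rightarrow> ('b \<Rightarrow> real) \<Rightarrow> bool" where
  "converges_in_distribution M S N W \<longleftrightarrow>
     (\<forall>\<epsilon>>0. S \<epsilon> \<in> borel_measurable M) \<and> W \<in> borel_measurable N \<and>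
     (\<forall>e. (\<forall>n. e n > 0) \<and> e \<longlonglongrightarrow> 0 \<longrightarrow>
        weak_conv_m (\<lambda>n. distr M borel (S (e n))) (distr N borel W))"

definition same_distribution :: "'b measure \<Rightarrow> ('b \<Rightarrow> real) \<Rightarrow> ('b \<Rightarrow> real) \<Rightarrow> bool" where
  "same_distribution N V W \<longleftrightarrow>
     V \<in> borel_measurable N \<and> W \<in> borel_measurable N \<and> distr N borel V = distr N borel W"

end

theory Submission
  imports Defs
begin

text \<open>On the time scale \<open>a = Ainv (1 / \<epsilon>)\<close> the stopping rule asks when \<open>c * x2 t < u * t\<close>, where \<open>x2\<close> is
  the second scaled path and \<open>u \<rightarrow> 1\<close>. The functionals \<open>sup t. max 0 (min (d - \<bar>t - r\<bar>) (x t - b))\<close> are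
  M2-continuous and countably many of them determine the local behaviour of converging paths, which
  reduces weak convergence to a mapping argument in a countable product of lines. The limit path
  meets the line \<open>t / c\<close> continuously because \<open>Y2\<close> has no negative jumps, the hitting times of slightly
  steeper lines announce the hitting time, and quasi-left-continuity then makes \<open>Y1\<close> continuous there;
  so the stopped scaled paths converge. Self-similarity removes the dependence on \<open>c\<close>.\<close>

section \<open>Cadlag paths and M2-continuous functionals\<close>

text \<open>Weak convergence is given only through expectations of bounded WM2-continuous
  functionals; no almost sure representation is constructed. What converging codes give back is
  \<open>graph_conv\<close>: near a time t > 0 the paths are squeezed towards the vertical segment
  of the limit graph. Values therefore converge only where the limit path is continuous, which is
  why continuity of both limit paths at the hitting time decides the matter. Path convergence is
  also blind near time 0, where the rule could fire at indices of smaller order than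
  \<open>a\<close>; there the no-early-stopping condition takes over. The starting index \<epsilon>
  powr (- \<nu>) must in turn be o(a), or it would delay the limiting rule, and this is where slow
  variation of \<open>L\<close> and the bound \<nu> < 1 / (1 - h) enter. Probabilities are estimated
  only from above, for events that persist under limits along samples; lower bounds come from
  complements, and the boundary points in which the two estimates overlap have no mass in the limit
  law.\<close>

lemma cadlag_tendsto_right: "cadlag x \<Longrightarrow> 0 \<le> t \<Longrightarrow> (x \<longlongrightarrow> x t) (at_right t)"
  unfolding cadlag_def by (simp add: continuous_within)

lemma cadlag_tendsto_left_lim:
  assumes "cadlag x" "0 < t"
  shows "(x \<longlongrightarrow> left_lim x t) (at_left t)"
proof -
  obtain l where l: "(x \<longlongrightarrow> l) (at_left t)"
    using assms unfolding cadlag_def by blast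
  then have "Lim (at_left t) x = l"
    by (intro tendsto_Lim) auto
  with l assms show ?thesis by (simp add: left_lim_def)
qed

lemma left_lim_eqI: "0 < t \<Longrightarrow> (x \<longlongrightarrow> l) (at_left t) \<Longrightarrow> left_lim x t = l"
  by (simp add: left_lim_def tendsto_Lim)

lemma cadlag_compose:
  assumes "cadlag x" "continuous_on UNIV f"
  shows "cadlag (\<lambda>t. f (x t))"
  unfolding cadlag_def
proof (intro conjI allI impI)
  have f: "isCont f z" for z
    using assms(2) by (simp add: continuous_on_eq_continuous_at)
  fix t :: real
  show "continuous (at_right t) (\<lambda>t. f (x t))" if "0 \<le> t"
    unfolding continuous_within
    using isCont_tendsto_compose[OF f cadlag_tendsto_right[OF assms(1) that]] .
  show "\<exists>l. ((\<lambda>t. f (x t)) \<longlongrightarrow> l) (at_left t)" if "0 < t"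
    using isCont_tendsto_compose[OF f cadlag_tendsto_left_lim[OF assms(1) that]] by blast
qed

lemma left_lim_compose:
  assumes "cadlag x" "continuous_on UNIV f"
  shows "left_lim (\<lambda>t. f (x t)) t = f (left_lim x t)"
proof (cases "t > 0")
  case True
  have "isCont f (left_lim x t)"
    using assms(2) by (simp add: continuous_on_eq_continuous_at)
  from isCont_tendsto_compose[OF this cadlag_tendsto_left_lim[OF assms(1) True]]
  show ?thesis by (rule left_lim_eqI[OF True])
qed (simp add: left_lim_def)

lemma cadlag_scale:
  assumes x: "cadlag x" and a: "a > 0"
  shows "cadlag (\<lambda>t. x (a * t))"
  unfolding cadlag_def
proof (intro conjI allI impI)
  fix t :: real
  have r: "filterlim (\<lambda>t. a * t) (at_right (a * t)) (at_right t)"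
    unfolding filterlim_at
    using a by (auto intro!: tendsto_intros simp: eventually_at_filter)
  have l: "filterlim (\<lambda>t. a * t) (at_left (a * t)) (at_left t)"
    unfolding filterlim_at
    using a by (auto intro!: tendsto_intros simp: eventually_at_filter)
  show "continuous (at_right t) (\<lambda>t. x (a * t))" if "0 \<le> t"
    unfolding continuous_within
    using filterlim_compose[OF cadlag_tendsto_right[OF x] r] a that by simp
  show "\<exists>l. ((\<lambda>t. x (a * t)) \<longlongrightarrow> l) (at_left t)" if "0 < t"
    using filterlim_compose[OF cadlag_tendsto_left_lim[OF x] l] a that by auto
qed

lemma cadlag_eventually_less:
  assumes x: "cadlag x" and t: "0 \<le> t" and m: "x t < m" "left_lim x t < m"
  shows "\<forall>\<^sub>F s in nhds t. 0 \<le> s \<longrightarrow> x s < m"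
proof -
  have "\<forall>\<^sub>F s in at_right t. x s < m"
    using order_tendstoD(2)[OF cadlag_tendsto_right[OF x t] m(1)] .
  then have r: "\<forall>\<^sub>F s in at_right t. 0 \<le> s \<longrightarrow> x s < m"
    by (rule eventually_mono) simp
  have l: "\<forall>\<^sub>F s in at_left t. 0 \<le> s \<longrightarrow> x s < m"
  proof (cases "t = 0")
    case True
    then show ?thesis by (auto simp: eventually_at_filter)
  next
    case False
    with t have "t > 0" by simp
    from order_tendstoD(2)[OF cadlag_tendsto_left_lim[OF x this] m(2)]
    show ?thesis by (rule eventually_mono) simp
  qed
  from l r m show ?thesis
    by (simp add: eventually_nhds_conv_at eventually_at_split)
qed

lemma cadlag_uminus: "cadlag x \<Longrightarrow> cadlag (\<lambda>t. - x t)"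
  by (rule cadlag_compose) (auto intro!: continuous_intros)

lemma left_lim_uminus: "cadlag x \<Longrightarrow> left_lim (\<lambda>t. - x t) t = - left_lim x t"
  by (rule left_lim_compose) (auto intro!: continuous_intros)

text \<open>Each time has a neighbourhood on which the value and the left limit, enlarged by 1,
  bound the path; finitely many such neighbourhoods cover the compact interval.\<close>

lemma cadlag_bounded:
  assumes x: "cadlag x"
  shows "\<exists>B. \<forall>t\<in>{0..T}. \<bar>x t\<bar> \<le> B"
proof -
  have "\<exists>U B. open U \<and> t \<in> U \<and> (\<forall>s\<in>U. 0 \<le> s \<longrightarrow> \<bar>x s\<bar> \<le> B)" if t: "0 \<le> t" for t
  proof -
    define m where "m = max \<bar>x t\<bar> \<bar>left_lim x t\<bar> + 1"
    have "\<forall>\<^sub>F s in nhds t. 0 \<le> s \<longrightarrow> x s < m"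
      using t by (intro cadlag_eventually_less x) (auto simp: m_def)
    moreover have "\<forall>\<^sub>F s in nhds t. 0 \<le> s \<longrightarrow> - x s < m"
      using t by (intro cadlag_eventually_less[OF cadlag_uminus[OF x]])
        (auto simp: m_def left_lim_uminus[OF x])
    ultimately have "\<forall>\<^sub>F s in nhds t. 0 \<le> s \<longrightarrow> \<bar>x s\<bar> \<le> m"
      by eventually_elim auto
    then show ?thesis unfolding eventually_nhds by blast
  qed
  then obtain U B where U: "\<And>t. 0 \<le> t \<Longrightarrow> open (U t) \<and> t \<in> U t \<and> (\<forall>s\<in>U t. 0 \<le> s \<longrightarrow> \<bar>x s\<bar> \<le> B t)"
    by metis
  have "compact {0..T}" by simp
  then obtain C where C: "C \<subseteq> {0..T}" "finite C" "{0..T} \<subseteq> (\<Union>c\<in>C. U c)"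
    by (rule compactE_image[of _ "{0..T}" U]) (use U in auto)
  have "\<bar>x t\<bar> \<le> Max (insert 0 (B ` C))" if "t \<in> {0..T}" for t
  proof -
    obtain c where "c \<in> C" "t \<in> U c" using C(3) \<open>t \<in> {0..T}\<close> by blast
    then have "\<bar>x t\<bar> \<le> B c" using U[of c] C(1) \<open>t \<in> {0..T}\<close> by auto
    also have "\<dots> \<le> Max (insert 0 (B ` C))" using C \<open>c \<in> C\<close> by (intro Max_ge) auto
    finally show ?thesis .
  qed
  then show ?thesis by blast
qed

text \<open>\<open>M2_tendsto\<close> is informative only at continuity points of the limit, so one
  is needed beyond any given time. Instead of counting jumps, the proof uses Baire: the points of
  oscillation below 1 / (k + 1) form an open set, dense because every point has a right
  neighbourhood on which the path is nearly constant, and a point common to all k is a continuity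
  point.\<close>

lemma cadlag_continuity_point:
  assumes x: "cadlag x" and T0: "0 \<le> T0"
  shows "\<exists>T>T0. isCont x T"
proof -
  \<comment> \<open>Values at negative times are arbitrary; freezing the path at \<open>x 0\<close>
    there gives right-continuity on the whole line, where Baire is applied.\<close>
  define y where "y t = x (max 0 t)" for t
  have y: "(y \<longlongrightarrow> y t) (at_right t)" for t
  proof (cases "t \<ge> 0")
    case True
    have "\<forall>\<^sub>F s in at_right t. x s = y s"
      using True by (auto simp: eventually_at_filter y_def)
    then show ?thesis
      using Lim_transform_eventually[OF cadlag_tendsto_right[OF x True]] True
      by (simp add: y_def)
  next
    case False
    have "\<forall>\<^sub>F s in at_right t. s < 0"
      using False by (intro order_tendstoD(2)[of "\<lambda>s. s" t]) (auto intro: tendsto_intros)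
    then have "\<forall>\<^sub>F s in at_right t. y t = y s"
      by eventually_elim (use False in \<open>simp add: y_def\<close>)
    then show ?thesis
      using Lim_transform_eventually tendsto_const by blast
  qed
  define O' where "O' k = {t. \<exists>d>0. \<forall>s s'. \<bar>s - t\<bar> < d \<longrightarrow> \<bar>s' - t\<bar> < d \<longrightarrow> \<bar>y s - y s'\<bar> < inverse (real (Suc k))}" for k
  have op: "open (O' k)" for k
    unfolding open_dist
  proof
    fix t assume "t \<in> O' k"
    then obtain d where d: "d > 0"
      "\<And>s s'. \<bar>s - t\<bar> < d \<Longrightarrow> \<bar>s' - t\<bar> < d \<Longrightarrow> \<bar>y s - y s'\<bar> < inverse (real (Suc k))"
      unfolding O'_def by blast
    have "r \<in> O' k" if "dist r t < d / 2" for r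
      unfolding O'_def mem_Collect_eq
    proof (intro exI[of _ "d/2"] conjI allI impI)
      fix s s' assume "\<bar>s - r\<bar> < d / 2" "\<bar>s' - r\<bar> < d / 2"
      then show "\<bar>y s - y s'\<bar> < inverse (real (Suc k))"
        using that by (intro d(2)) (unfold dist_real_def, linarith+)
    qed (use d in auto)
    then show "\<exists>e>0. \<forall>r. dist r t < e \<longrightarrow> r \<in> O' k"
      using d(1) by (intro exI[of _ "d/2"]) auto
  qed
  have dense: "UNIV \<subseteq> closure (O' k)" for k
  proof
    fix t :: real
    show "t \<in> closure (O' k)"
      unfolding closure_approachable
    proof (intro allI impI)
      fix e :: real assume e: "e > 0"
      have "\<forall>\<^sub>F s in at_right t. dist (y s) (y t) < inverse (real (Suc k)) / 2"
        by (rule tendstoD[OF y]) simp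
      then obtain b where b: "b > t" "\<And>s. t < s \<Longrightarrow> s < b \<Longrightarrow> \<bar>y s - y t\<bar> < inverse (real (Suc k)) / 2"
        unfolding eventually_at_right_field dist_real_def by blast
      define r where "r = min (b - t) e"
      have r: "r \<le> b - t" and "r > 0" using b e by (simp_all add: r_def)
      \<comment> \<open>Offset r/2 and radius r/4 keep both test points inside the right
        neighbourhood (t, t + r).\<close>
      have "t + r / 2 \<in> O' k"
        unfolding O'_def mem_Collect_eq
      proof (intro exI[of _ "r/4"] conjI allI impI)
        fix s s' assume "\<bar>s - (t + r/2)\<bar> < r / 4" "\<bar>s' - (t + r/2)\<bar> < r / 4"
        then have "\<bar>y s - y t\<bar> < inverse (real (Suc k)) / 2" "\<bar>y s' - y t\<bar> < inverse (real (Suc k)) / 2"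
          using \<open>r > 0\<close> r by (intro b(2); linarith)+
        then show "\<bar>y s - y s'\<bar> < inverse (real (Suc k))"
          by linarith
      qed (use \<open>r > 0\<close> in auto)
      moreover have "dist (t + r / 2) t < e"
        using \<open>r > 0\<close> e by (simp add: dist_real_def r_def min_def)
      ultimately show "\<exists>r\<in>O' k. dist r t < e" by blast
    qed
  qed
  have "UNIV \<subseteq> closure (\<Inter>(range O'))"
    by (rule Baire) (use op dense in auto)
  then obtain T where T: "T \<in> \<Inter>(range O')" "dist T (T0 + 1) < 1"
    using closure_approachable[of "T0 + 1" "\<Inter>(range O')"] zero_less_one by blast
  then have gt: "T > T0" by (simp add: dist_real_def abs_if split: if_splits)
  have "isCont y T"
    unfolding continuous_at
  proof (rule tendstoI)
    fix e :: real assume "e > 0"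
    then obtain k where k: "inverse (real (Suc k)) < e" using reals_Archimedean by blast
    from T(1) obtain d where d: "d > 0"
      "\<And>s s'. \<bar>s - T\<bar> < d \<Longrightarrow> \<bar>s' - T\<bar> < d \<Longrightarrow> \<bar>y s - y s'\<bar> < inverse (real (Suc k))"
      unfolding O'_def by blast
    have "\<bar>y s - y T\<bar> < e" if "\<bar>s - T\<bar> < d" for s
      using d(2)[of s T] that d(1) k by auto
    then show "\<forall>\<^sub>F s in at T. dist (y s) (y T) < e"
      unfolding eventually_at dist_real_def using d(1) by blast
  qed
  moreover have "\<forall>\<^sub>F s in nhds T. y s = x s"
  proof -
    have "\<forall>\<^sub>F s in nhds T. s \<in> {0<..}"
      using gt T0 by (intro eventually_nhds_in_open) auto
    then show ?thesis by eventually_elim (simp add: y_def)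
  qed
  ultimately have "isCont x T"
    using isCont_cong by blast
  with gt show ?thesis by blast
qed

section \<open>Completed graphs and the Hausdorff distance\<close>

lemma completed_graph_bounded:
  assumes x: "cadlag x"
  shows "bounded (completed_graph T x)"
proof -
  obtain B where B: "\<And>t. t \<in> {0..T} \<Longrightarrow> \<bar>x t\<bar> \<le> B"
    using cadlag_bounded[OF x] by blast
  have l: "\<bar>left_lim x t\<bar> \<le> B" if t: "t \<in> {0..T}" for t
  proof (cases "t = 0")
    case True then show ?thesis using B t by (simp add: left_lim_def)
  next
    case False
    with t have "t > 0" by simp
    have "\<forall>\<^sub>F s in at_left t. \<bar>x s\<bar> \<le> B"
      using eventually_at_left_real[OF \<open>t > 0\<close>] by (rule eventually_mono) (use t B in auto)
    then show ?thesis
      by (intro tendsto_upperbound[OF tendsto_rabs[OF cadlag_tendsto_left_lim[OF x \<open>t > 0\<close>]]]) auto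
  qed
  have "completed_graph T x \<subseteq> {0..T} \<times> {-B..B}"
  proof (clarsimp simp: completed_graph_def)
    fix t z assume t: "0 \<le> t" "t \<le> T" and z: "z \<in> closed_segment (left_lim x t) (x t)"
    then show "-B \<le> z \<and> z \<le> B"
      using B[of t] l[of t] by (auto simp: closed_segment_eq_real_ivl split: if_splits)
  qed
  then show ?thesis
    by (rule bounded_subset[rotated]) (intro bounded_Times bounded_closed_interval)
qed

text \<open>Boundedness of \<open>A\<close> makes the distances bounded above; without it the real
  supremum in \<open>hausdorff_distance\<close> would be unspecified.\<close>

lemma infdist_le_hausdorff_distance:
  assumes "bounded A" "B \<noteq> {}" "a \<in> A"
  shows "infdist a B \<le> hausdorff_distance A B"
proof -
  obtain b where b: "b \<in> B" using assms by blast
  obtain r where r: "\<And>a. a \<in> A \<Longrightarrow> dist b a \<le> r"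
    using assms(1) unfolding bounded_any_center[of _ b] by blast
  have "bdd_above ((\<lambda>a. infdist a B) ` A)"
  proof (rule bdd_aboveI2)
    fix a assume "a \<in> A"
    then show "infdist a B \<le> r"
      using r[of a] infdist_le[OF b, of a] by (simp add: dist_commute)
  qed
  then have "infdist a B \<le> (SUP a\<in>A. infdist a B)"
    using assms by (intro cSUP_upper)
  then show ?thesis by (simp add: hausdorff_distance_def)
qed

lemma hausdorff_distance_commute: "hausdorff_distance A B = hausdorff_distance B A"
  by (simp add: hausdorff_distance_def max.commute)

lemma infdist_lessE:
  assumes "infdist a B < r" "B \<noteq> {}"
  obtains b where "b \<in> B" "dist a b < r"
proof -
  have "Inf (dist a ` B) < r" using assms by (simp add: infdist_notempty)
  from cInf_lessD[OF _ this] show thesis using assms(2) that by blast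
qed

text \<open>Positive exactly when |t - r| < d and z > b, nondecreasing in z, and 1-Lipschitz in (t,
  z). A plain supremum over a window is not M2-continuous, because a spike can cross the edge of the
  window; here heights are cut down to 0 towards the edge.\<close>

definition tent :: "real \<Rightarrow> real \<Rightarrow> real \<Rightarrow> real \<Rightarrow> real \<Rightarrow> real" where
  "tent r d b t z = max 0 (min (d - \<bar>t - r\<bar>) (z - b))"

definition peak :: "real \<Rightarrow> real \<Rightarrow> real \<Rightarrow> (real \<Rightarrow> real) \<Rightarrow> real" where
  "peak r d b x = (SUP t\<in>{0..}. tent r d b t (x t))"

lemma tent_le: "tent r d b t z \<le> max 0 d"
  by (auto simp: tent_def)

lemma tent_mono: "z \<le> z' \<Longrightarrow> tent r d b t z \<le> tent r d b t z'"
  by (auto simp: tent_def)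

lemma tent_lipschitz: "tent r d b t z \<le> tent r d b t' z' + dist (t, z) (t', z')"
proof -
  have "\<bar>t - t'\<bar> \<le> dist (t, z) (t', z')" "\<bar>z - z'\<bar> \<le> dist (t, z) (t', z')"
    using dist_fst_le[of "(t, z)" "(t', z')"] dist_snd_le[of "(t, z)" "(t', z')"]
    by (auto simp: dist_real_def)
  then have "d - \<bar>t - r\<bar> \<le> d - \<bar>t' - r\<bar> + dist (t, z) (t', z')" "z - b \<le> z' - b + dist (t, z) (t', z')"
    by linarith+
  moreover have "0 \<le> dist (t, z) (t', z')" by simp
  ultimately show ?thesis unfolding tent_def max_def min_def by argo
qed

lemma tent_tendsto:
  "(f \<longlongrightarrow> t) F \<Longrightarrow> (g \<longlongrightarrow> z) F \<Longrightarrow> ((\<lambda>s. tent r d b (f s) (g s)) \<longlongrightarrow> tent r d b t z) F"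
  unfolding tent_def by (intro tendsto_intros)

lemma bdd_above_tent: "bdd_above ((\<lambda>t. tent r d b t (x t)) ` A)"
  by (rule bdd_aboveI2[OF tent_le])

lemma tent_le_peak: "0 \<le> t \<Longrightarrow> tent r d b t (x t) \<le> peak r d b x"
  unfolding peak_def by (intro cSUP_upper bdd_above_tent) simp

lemma peak_leI: "(\<And>t. 0 \<le> t \<Longrightarrow> tent r d b t (x t) \<le> a) \<Longrightarrow> peak r d b x \<le> a"
  unfolding peak_def by (intro cSUP_least) auto

lemma peak_nonneg: "0 \<le> peak r d b x"
  using tent_le_peak[of 0 r d b x] by (simp add: tent_def)

text \<open>A point of the completed graph lies below \<open>x t\<close> or below the left limit,
  and the latter is a limit of path values. So \<open>peak\<close> is in effect a functional of the
  completed graph, which is all that the Hausdorff distance sees.\<close>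

lemma tent_graph_le_peak:
  assumes x: "cadlag x" and g: "(t, z) \<in> completed_graph T x"
  shows "tent r d b t z \<le> peak r d b x"
proof -
  from g have t: "0 \<le> t" and "z \<in> closed_segment (left_lim x t) (x t)"
    by (auto simp: completed_graph_def)
  then consider "z \<le> x t" | "z \<le> left_lim x t"
    by (auto simp: closed_segment_eq_real_ivl split: if_splits)
  then show ?thesis
  proof cases
    case 1
    show ?thesis using tent_mono[OF 1] tent_le_peak[OF t] by (rule order_trans)
  next
    case 2
    have "tent r d b t (left_lim x t) \<le> peak r d b x"
    proof (cases "t = 0")
      case True
      then show ?thesis using tent_le_peak[of 0] by (simp add: left_lim_def)
    next
      case False
      with t have "t > 0" by simp
      have "\<forall>\<^sub>F s in at_left t. 0 < s"
        using order_tendstoD(1)[of "\<lambda>s. s" t "at_left t" 0] \<open>t > 0\<close> by (simp add: tendsto_ident_at)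
      then have "\<forall>\<^sub>F s in at_left t. tent r d b s (x s) \<le> peak r d b x"
        by eventually_elim (simp add: tent_le_peak)
      then show ?thesis
        by (intro tendsto_upperbound[OF tent_tendsto[OF tendsto_ident_at cadlag_tendsto_left_lim[OF x \<open>t > 0\<close>]]]) auto
    qed
    with tent_mono[OF 2] show ?thesis by (rule order_trans)
  qed
qed

lemma completed_graph_self: "0 \<le> t \<Longrightarrow> t \<le> T \<Longrightarrow> (t, x t) \<in> completed_graph T x"
  by (auto simp: completed_graph_def)

text \<open>Every graph point of one path has graph points of the other arbitrarily close to within
  the distance, and the tent is 1-Lipschitz. Times beyond T contribute nothing, since r + d <= T
  puts them outside the window.\<close>

lemma peak_le_M2_dist:
  assumes x: "cadlag x" and y: "cadlag y" and T: "0 < T" "r + d \<le> T"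
  shows "peak r d b x \<le> peak r d b y + M2_dist T x y"
proof (rule peak_leI)
  fix t :: real assume t: "0 \<le> t"
  have ne: "completed_graph T y \<noteq> {}" "completed_graph T x \<noteq> {}"
    using completed_graph_self[of 0 T] T by auto
  note hd = infdist_le_hausdorff_distance[OF completed_graph_bounded[OF x] ne(1), of _ T, folded M2_dist_def]
  show "tent r d b t (x t) \<le> peak r d b y + M2_dist T x y"
  proof (cases "t \<le> T")
    case True
    \<comment> \<open>The infimum in \<open>infdist\<close> need not be attained, hence the extra
      e.\<close>
    show ?thesis
    proof (rule field_le_epsilon)
      fix e :: real assume "e > 0"
      then have "infdist (t, x t) (completed_graph T y) < M2_dist T x y + e"
        using hd[OF completed_graph_self[OF t True]] by simp
      from infdist_lessE[OF this ne(1)] obtain t' z' where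
        tz: "(t', z') \<in> completed_graph T y" "dist (t, x t) (t', z') < M2_dist T x y + e"
        by (metis surj_pair)
      show "tent r d b t (x t) \<le> peak r d b y + M2_dist T x y + e"
        using tent_lipschitz[of r d b t "x t" t' z'] tent_graph_le_peak[OF y tz(1), of r d b] tz(2)
        by linarith
    qed
  next
    case False
    then have "tent r d b t (x t) = 0" using T by (auto simp: tent_def)
    moreover have "0 \<le> M2_dist T x y"
      by (rule order_trans[OF infdist_nonneg hd[OF completed_graph_self[of 0 T x]]]) (use T in auto)
    ultimately show ?thesis using peak_nonneg[of r d b y] by simp
  qed
qed

lemma peak_M2_continuous:
  assumes X: "\<And>n. cadlag (X n)" and x: "cadlag x" and conv: "M2_tendsto X x"
  shows "(\<lambda>n. peak r d b (X n)) \<longlonglongrightarrow> peak r d b x"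
proof -
  obtain T where T: "T > max 0 (r + d)" "isCont x T"
    using cadlag_continuity_point[OF x, of "max 0 (r + d)"] by auto
  then have lim: "(\<lambda>n. M2_dist T (X n) x) \<longlonglongrightarrow> 0"
    using conv by (simp add: M2_tendsto_def)
  have "\<bar>peak r d b (X n) - peak r d b x\<bar> \<le> M2_dist T (X n) x" for n
    using peak_le_M2_dist[OF X[of n] x, of T r d b] peak_le_M2_dist[OF x X[of n], of T r d b] T(1)
    by (auto simp: M2_dist_def hausdorff_distance_commute[of "completed_graph T x"])
  then have "(\<lambda>n. \<bar>peak r d b (X n) - peak r d b x\<bar>) \<longlonglongrightarrow> 0"
    by (intro tendsto_sandwich[OF _ _ tendsto_const lim]) auto
  then show ?thesis
    using tendsto_rabs_zero_iff LIM_zero_iff by blast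
qed

lemma eventually_at_right_rational:
  assumes "\<forall>\<^sub>F s in at_right t. P s"
  shows "\<exists>q\<in>\<rat>. t < q \<and> P (q::real)"
proof -
  from assms obtain b where "b > t" "\<And>s. t < s \<Longrightarrow> s < b \<Longrightarrow> P s"
    unfolding eventually_at_right_field by blast
  then show ?thesis using Rats_dense_in_real[of t b] by blast
qed

text \<open>By right-continuity a tent value above \<open>a\<close> persists just after t, so
  rational times decide the supremum.\<close>

lemma borel_measurable_peak:
  assumes m: "\<And>t. 0 \<le> t \<Longrightarrow> X t \<in> borel_measurable M"
    and x: "\<And>\<omega>. \<omega> \<in> space M \<Longrightarrow> cadlag (\<lambda>t. X t \<omega>)"
  shows "(\<lambda>\<omega>. peak r d b (\<lambda>t. X t \<omega>)) \<in> borel_measurable M"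
  unfolding borel_measurable_iff_le
proof
  fix a
  have "peak r d b (\<lambda>t. X t \<omega>) \<le> a \<longleftrightarrow> (\<forall>q\<in>\<rat> \<inter> {0..}. tent r d b q (X q \<omega>) \<le> a)"
    if \<omega>: "\<omega> \<in> space M" for \<omega>
  proof
    assume "peak r d b (\<lambda>t. X t \<omega>) \<le> a"
    then show "\<forall>q\<in>\<rat> \<inter> {0..}. tent r d b q (X q \<omega>) \<le> a"
      using order_trans[OF tent_le_peak[of _ r d b "\<lambda>t. X t \<omega>"]] by auto
  next
    assume q: "\<forall>q\<in>\<rat> \<inter> {0..}. tent r d b q (X q \<omega>) \<le> a"
    show "peak r d b (\<lambda>t. X t \<omega>) \<le> a"
    proof (rule peak_leI, rule ccontr)
      fix t :: real assume t: "0 \<le> t" and "\<not> tent r d b t (X t \<omega>) \<le> a"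
      then have "\<forall>\<^sub>F s in at_right t. a < tent r d b s (X s \<omega>)"
        by (intro order_tendstoD(1)[OF tent_tendsto[OF tendsto_ident_at cadlag_tendsto_right[OF x[OF \<omega>] t]]]) auto
      from eventually_at_right_rational[OF this] q t show False by force
    qed
  qed
  then have "{\<omega> \<in> space M. peak r d b (\<lambda>t. X t \<omega>) \<le> a} =
      {\<omega> \<in> space M. \<forall>q\<in>\<rat> \<inter> {0..}. tent r d b q (X q \<omega>) \<le> a}" by blast
  also have "\<dots> \<in> sets M"
  proof (rule sets.sets_Collect_countable_All')
    fix q :: real assume "q \<in> \<rat> \<inter> {0..}"
    then have [measurable]: "X q \<in> borel_measurable M" using m by simp
    show "{\<omega> \<in> space M. tent r d b q (X q \<omega>) \<le> a} \<in> sets M"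
      unfolding tent_def by measurable
  qed (rule countable_Int1[OF countable_rat])
  finally show "{\<omega> \<in> space M. peak r d b (\<lambda>t. X t \<omega>) \<le> a} \<in> sets M" .
qed

text \<open>On a small window around t the limit stays below some level b < m, so its peak there is
  0. A path that still reached m near t would have a peak bounded away from 0.\<close>

lemma peak_tendsto_eventually_less:
  assumes x: "cadlag x" and t: "0 < t" and m: "x t < m" "left_lim x t < m"
    and conv: "\<And>r d b :: rat. (\<lambda>k. peak (of_rat r) (of_rat d) (of_rat b) (X k)) \<longlonglongrightarrow>
                          peak (of_rat r) (of_rat d) (of_rat b) x"
  shows "\<forall>\<^sub>F (k, s) in sequentially \<times>\<^sub>F nhds t. X k s < m"
proof -
  obtain b where b: "max (x t) (left_lim x t) < real_of_rat b" "real_of_rat b < m"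
    using of_rat_dense[of "max (x t) (left_lim x t)" m] m by auto
  have "\<forall>\<^sub>F s in nhds t. 0 \<le> s \<longrightarrow> x s < of_rat b"
    using t b by (intro cadlag_eventually_less x) auto
  then obtain e where e: "e > 0" "\<And>s. \<bar>s - t\<bar> < e \<Longrightarrow> 0 \<le> s \<Longrightarrow> x s < of_rat b"
    unfolding eventually_nhds_metric dist_real_def by blast
  \<comment> \<open>With r within d/2 of t, the window |s - r| < d lies within 3d/2 < e of t; d < t
    keeps the nearby times nonnegative.\<close>
  obtain d where d: "0 < real_of_rat d" "real_of_rat d < min (e / 2) t"
    using of_rat_dense[of 0 "min (e / 2) t"] e t by auto
  obtain r where r: "t - of_rat d / 2 < real_of_rat r" "real_of_rat r < t + of_rat d / 2"
    using of_rat_dense[of "t - of_rat d / 2" "t + of_rat d / 2"] d by auto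
  define rr dd bb where "rr = real_of_rat r" "dd = real_of_rat d" "bb = real_of_rat b"
  note defs = this[symmetric]
  have "peak rr dd bb x \<le> 0"
  proof (rule peak_leI)
    fix s :: real assume s: "0 \<le> s"
    show "tent rr dd bb s (x s) \<le> 0"
    proof (cases "\<bar>s - rr\<bar> < dd")
      case True
      then have "x s < bb" using s r d unfolding defs by (intro e(2)[unfolded defs]) linarith+
      then show ?thesis by (simp add: tent_def)
    qed (simp add: tent_def)
  qed
  then have "peak rr dd bb x = 0" using peak_nonneg[of rr dd bb x] by simp
  then have "(\<lambda>k. peak rr dd bb (X k)) \<longlonglongrightarrow> 0"
    using conv[of r d b] unfolding defs by simp
  then have k: "\<forall>\<^sub>F k in sequentially. peak rr dd bb (X k) < min (dd / 4) (m - bb)"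
    using d b unfolding defs by (intro order_tendstoD(2)) auto
  have s: "\<forall>\<^sub>F s in nhds t. \<bar>s - t\<bar> < dd / 4 \<and> 0 \<le> s"
    unfolding eventually_nhds_metric dist_real_def
  proof (intro exI[of _ "dd/4"] conjI allI impI)
    fix s assume "\<bar>s - t\<bar> < dd / 4"
    then show "\<bar>s - t\<bar> < dd / 4" "0 \<le> s" using d unfolding defs by linarith+
  qed (use d in \<open>simp add: defs\<close>)
  have "X k s < m" if "peak rr dd bb (X k) < min (dd / 4) (m - bb)" "\<bar>s - t\<bar> < dd / 4 \<and> 0 \<le> s" for k s
  proof (rule ccontr)
    assume "\<not> X k s < m"
    \<comment> \<open>s is within d/4 of t and t within d/2 of r, so the tent still has height d/4
      available at s.\<close>
    then have "min (dd / 4) (m - bb) \<le> tent rr dd bb s (X k s)"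
    proof -
      have "\<bar>s - rr\<bar> < 3 * dd / 4"
        using that(2) r unfolding defs by linarith
      then have "dd / 4 \<le> dd - \<bar>s - rr\<bar>" by simp
      moreover have "m - bb \<le> X k s - bb" using \<open>\<not> X k s < m\<close> by simp
      ultimately show ?thesis unfolding tent_def by linarith
    qed
    also have "\<dots> \<le> peak rr dd bb (X k)" using that by (intro tent_le_peak) auto
    finally show False using that by simp
  qed
  then show ?thesis
    unfolding eventually_prod_filter using k s by auto
qed

section \<open>Limits of events along converging paths\<close>

lemma closed_indicator_approx:
  fixes C :: "'c::metric_space set"
  assumes "closed C" "C \<noteq> {}"
  shows "(\<lambda>k. max 0 (1 - real k * infdist v C)) \<longlonglongrightarrow> indicator C v"
proof (cases "v \<in> C")
  case True
  then show ?thesis by simp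
next
  case False
  then have "infdist v C \<noteq> 0"
    using in_closed_iff_infdist_zero[OF assms] by blast
  then have pos: "infdist v C > 0" using infdist_nonneg[of v C] by simp
  obtain K where K: "real K * infdist v C \<ge> 1"
    using reals_Archimedean3[OF pos] less_imp_le by blast
  have ev: "max 0 (1 - real k * infdist v C) = 0" if "k \<ge> K" for k
  proof -
    have "real K * infdist v C \<le> real k * infdist v C"
      using that pos by (intro mult_right_mono) auto
    then show ?thesis using K by linarith
  qed
  then have "\<forall>\<^sub>F k in sequentially. max 0 (1 - real k * infdist v C) = indicator C v"
    by (intro eventually_mono[OF eventually_ge_at_top[of K]]) (use ev False in simp)
  then show ?thesis by (rule tendsto_eventually)
qed

text \<open>An extended continuous mapping theorem: the closed-set half of the portmanteau theorem, applied to
  the closures of \<open>\<Union>n\<ge>m. V n ` E n\<close>.\<close>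

lemma eventually_prob_less_of_closed_limit:
  fixes V :: "nat \<Rightarrow> 'a \<Rightarrow> 'c::metric_space"
  assumes "prob_space M" "prob_space N"
    and V: "\<And>n. V n \<in> borel_measurable M" and V': "V' \<in> borel_measurable N"
    and conv: "\<And>f :: 'c \<Rightarrow> real. continuous_on UNIV f \<Longrightarrow> (\<And>v. \<bar>f v\<bar> \<le> 1) \<Longrightarrow>
          (\<lambda>n. \<integral>\<omega>. f (V n \<omega>) \<partial>M) \<longlonglongrightarrow> (\<integral>\<omega>. f (V' \<omega>) \<partial>N)"
    and E: "\<And>n. E n \<in> sets M" and E': "E' \<in> sets N"
    and closed: "AE \<omega>' in N. \<forall>nk \<omega>k. filterlim nk at_top sequentially \<longrightarrow> (\<forall>k. \<omega>k k \<in> E (nk k)) \<longrightarrow>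
          (\<lambda>k. V (nk k) (\<omega>k k)) \<longlonglongrightarrow> V' \<omega>' \<longrightarrow> \<omega>' \<in> E'"
    and e: "e > 0"
  shows "\<forall>\<^sub>F n in sequentially. measure M (E n) < measure N E' + e"
proof -
  interpret M: prob_space M by fact
  interpret N: prob_space N by fact
  \<comment> \<open>Closures are measurable however irregular the images are. A value lying in all
    of them is a limit of points \<open>V (nk k) (\<omega>k k)\<close> with
    \<open>\<omega>k k\<close> in \<open>E (nk k)\<close> and \<open>nk\<close> tending to infinity,
    which is the situation of \<open>closed\<close>.\<close>
  define C where "C m = closure (\<Union>n\<in>{m..}. V n ` E n)" for m
  define A where "A m = V' -` C m \<inter> space N" for m
  have [measurable]: "A m \<in> sets N" for m
    unfolding A_def by (rule measurable_sets[OF V']) (simp add: C_def)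
  have "decseq A"
    unfolding decseq_def A_def C_def
    by (intro allI impI Int_mono vimage_mono closure_mono UN_mono) auto
  then have "(\<lambda>m. measure N (A m)) \<longlonglongrightarrow> measure N (\<Inter>m. A m)"
    by (intro N.finite_Lim_measure_decseq) auto
  moreover have "measure N (\<Inter>m. A m) \<le> measure N E'"
  proof (rule N.finite_measure_mono_AE[OF _ E'])
    show "AE \<omega>' in N. \<omega>' \<in> (\<Inter>m. A m) \<longrightarrow> \<omega>' \<in> E'"
      using closed
    proof (eventually_elim, intro impI)
      fix \<omega>' assume H: "\<forall>nk \<omega>k. filterlim nk at_top sequentially \<longrightarrow> (\<forall>k. \<omega>k k \<in> E (nk k)) \<longrightarrow>
          (\<lambda>k. V (nk k) (\<omega>k k)) \<longlonglongrightarrow> V' \<omega>' \<longrightarrow> \<omega>' \<in> E'" and "\<omega>' \<in> (\<Inter>m. A m)"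
      then have "V' \<omega>' \<in> C k" for k by (auto simp: A_def)
      then have "\<exists>n \<omega>. k \<le> n \<and> \<omega> \<in> E n \<and> dist (V n \<omega>) (V' \<omega>') < inverse (real (Suc k))" for k
        unfolding C_def closure_approachable by (fastforce dest!: spec[of _ "inverse (real (Suc k))"])
      then obtain nk \<omega>k where n: "\<And>k. k \<le> nk k" "\<And>k. \<omega>k k \<in> E (nk k)"
        "\<And>k. dist (V (nk k) (\<omega>k k)) (V' \<omega>') < inverse (real (Suc k))"
        by metis
      have "filterlim nk at_top sequentially"
        by (rule filterlim_at_top_mono[OF filterlim_ident]) (simp add: n)
      moreover have "(\<lambda>k. V (nk k) (\<omega>k k)) \<longlonglongrightarrow> V' \<omega>'"
        unfolding tendsto_dist_iff[of _ "V' \<omega>'"]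
        by (rule tendsto_sandwich[OF _ _ tendsto_const LIMSEQ_inverse_real_of_nat])
           (auto intro!: always_eventually less_imp_le[OF n(3)[simplified]])
      ultimately show "\<omega>' \<in> E'" using H n(2) by blast
    qed
  qed
  ultimately have "\<forall>\<^sub>F m in sequentially. measure N (A m) < measure N E' + e"
    using e by (intro order_tendstoD(2)) auto
  then obtain m where m: "measure N (A m) < measure N E' + e"
    by (auto simp: eventually_sequentially)
  show ?thesis
  \<comment> \<open>\<open>infdist\<close> to the empty set is 0 by convention, so the approximating
    functions used below would then be constantly 1.\<close>
  proof (cases "C m = {}")
    case True
    then have "E n = {}" if "n \<ge> m" for n
      using that by (auto simp: C_def)
    then have "measure M (E n) < measure N E' + e" if "n \<ge> m" for n
      using that e by (simp add: add_nonneg_pos)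
    then show ?thesis by (auto simp: eventually_sequentially)
  next
    case False
    have cl: "closed (C m)" by (simp add: C_def)
    define f where "f k v = max 0 (1 - real k * infdist v (C m))" for k v
    have cont: "continuous_on UNIV (f k)" for k
      unfolding f_def by (intro continuous_intros)
    have bd: "0 \<le> f k v" "f k v \<le> 1" for k v
      by (auto simp: f_def infdist_nonneg)
    have fm: "f k \<in> borel_measurable borel" for k
      by (rule borel_measurable_continuous_onI[OF cont])
    have "(\<lambda>k. \<integral>\<omega>. f k (V' \<omega>) \<partial>N) \<longlonglongrightarrow> (\<integral>\<omega>. indicator (A m) \<omega> \<partial>N)"
    proof (rule integral_dominated_convergence[where w = "\<lambda>_. 1"])
      show "AE \<omega> in N. (\<lambda>k. f k (V' \<omega>)) \<longlonglongrightarrow> indicator (A m) \<omega>"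
      proof (rule AE_I2)
        fix \<omega> assume "\<omega> \<in> space N"
        then have "indicator (A m) \<omega> = (indicator (C m) (V' \<omega>) :: real)"
          by (simp add: A_def indicator_def)
        then show "(\<lambda>k. f k (V' \<omega>)) \<longlonglongrightarrow> indicator (A m) \<omega>"
          unfolding f_def using closed_indicator_approx[OF cl False, of "V' \<omega>"] by simp
      qed
    qed (use bd measurable_compose[OF V' fm] in auto)
    then have "\<forall>\<^sub>F k in sequentially. (\<integral>\<omega>. f k (V' \<omega>) \<partial>N) < measure N E' + e"
      using m by (intro order_tendstoD(2)) auto
    then obtain k where k: "(\<integral>\<omega>. f k (V' \<omega>) \<partial>N) < measure N E' + e"
      by (auto simp: eventually_sequentially)
    have "(\<lambda>n. \<integral>\<omega>. f k (V n \<omega>) \<partial>M) \<longlonglongrightarrow> (\<integral>\<omega>. f k (V' \<omega>) \<partial>N)"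
      by (rule conv[OF cont]) (use bd[of k] in \<open>auto simp: abs_le_iff\<close>)
    from order_tendstoD(2)[OF this k]
    show ?thesis
      using eventually_ge_at_top[of m]
    proof eventually_elim
      fix n assume lt: "(\<integral>\<omega>. f k (V n \<omega>) \<partial>M) < measure N E' + e" and n: "m \<le> n"
      have int: "integrable M (\<lambda>\<omega>. f k (V n \<omega>))"
        by (rule M.integrable_const_bound[where B = 1]) (use bd measurable_compose[OF V fm] in auto)
      have "measure M (E n) = (\<integral>\<omega>. indicator (E n) \<omega> \<partial>M)"
        using E by simp
      also have "\<dots> \<le> (\<integral>\<omega>. f k (V n \<omega>) \<partial>M)"
      proof (rule integral_mono[OF _ int])
        show "integrable M (indicator (E n) :: 'a \<Rightarrow> real)"
          using E by (simp add: M.emeasure_eq_measure)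
        fix \<omega> assume "\<omega> \<in> space M"
        show "indicator (E n) \<omega> \<le> f k (V n \<omega>)"
        proof (cases "\<omega> \<in> E n")
          case True
          then have "V n \<omega> \<in> C m"
            unfolding C_def using n closure_subset by fastforce
          then have "f k (V n \<omega>) = 1" by (simp add: f_def)
          then show ?thesis by (simp add: indicator_def)
        qed (simp add: bd)
      qed
      finally show "measure M (E n) < measure N E' + e" using lt by simp
    qed
  qed
qed

section \<open>Coding pairs of paths by countably many peak values\<close>

lemma tendsto_fun_iff:
  fixes f :: "'a \<Rightarrow> 'i \<Rightarrow> 'c::topological_space"
  shows "(f \<longlongrightarrow> l) F \<longleftrightarrow> (\<forall>i. ((\<lambda>x. f x i) \<longlongrightarrow> l i) F)"
  using limitin_componentwise[of "\<lambda>_. euclidean" UNIV f l F]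
  by (simp add: euclidean_product_topology)

text \<open>The flag \<open>i\<close> selects the coordinate and \<open>j\<close> the sign: peaks of
  the reflected path record local infima. Rational parameters make the index type countable, so the
  codes live in a metric space whose Borel measurability can be checked coordinatewise.\<close>

definition peak_code :: "(real \<Rightarrow> real) \<times> (real \<Rightarrow> real) \<Rightarrow> bool \<times> bool \<times> rat \<times> rat \<times> rat \<Rightarrow> real" where
  "peak_code X = (\<lambda>(i, j, r, d, b). peak (of_rat r) (of_rat d) (of_rat b)
     (\<lambda>t. (if j then 1 else - 1) * (if i then fst X else snd X) t))"

text \<open>The half of M2 convergence that is used: as k grows and s approaches t > 0, the values
  \<open>X k s\<close> accumulate only on the vertical segment between \<open>left_lim x t\<close>
  and \<open>x t\<close>. Nothing is said about time 0.\<close>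

definition graph_conv :: "(nat \<Rightarrow> real \<Rightarrow> real) \<Rightarrow> (real \<Rightarrow> real) \<Rightarrow> bool" where
  "graph_conv X x \<longleftrightarrow> (\<forall>t>0. \<forall>m.
     (x t < m \<longrightarrow> left_lim x t < m \<longrightarrow> (\<forall>\<^sub>F (k, s) in sequentially \<times>\<^sub>F nhds t. X k s < m)) \<and>
     (m < x t \<longrightarrow> m < left_lim x t \<longrightarrow> (\<forall>\<^sub>F (k, s) in sequentially \<times>\<^sub>F nhds t. m < X k s)))"

lemma graph_convD:
  assumes "graph_conv X x" "0 < t"
  shows "x t < m \<Longrightarrow> left_lim x t < m \<Longrightarrow> \<forall>\<^sub>F (k, s) in sequentially \<times>\<^sub>F nhds t. X k s < m"
    and "m < x t \<Longrightarrow> m < left_lim x t \<Longrightarrow> \<forall>\<^sub>F (k, s) in sequentially \<times>\<^sub>F nhds t. m < X k s"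
  using assms by (auto simp: graph_conv_def)

lemma peak_tendsto_imp_graph_conv:
  assumes x: "cadlag x"
    and p: "\<And>r d b :: rat. (\<lambda>k. peak (of_rat r) (of_rat d) (of_rat b) (X k)) \<longlonglongrightarrow>
              peak (of_rat r) (of_rat d) (of_rat b) x"
    and n: "\<And>r d b :: rat. (\<lambda>k. peak (of_rat r) (of_rat d) (of_rat b) (\<lambda>t. - X k t)) \<longlonglongrightarrow>
              peak (of_rat r) (of_rat d) (of_rat b) (\<lambda>t. - x t)"
  shows "graph_conv X x"
  unfolding graph_conv_def
proof (intro allI impI conjI)
  fix t m :: real assume t: "0 < t"
  show "\<forall>\<^sub>F (k, s) in sequentially \<times>\<^sub>F nhds t. X k s < m" if "x t < m" "left_lim x t < m"
    by (rule peak_tendsto_eventually_less[OF x t that p])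
  assume "m < x t" "m < left_lim x t"
  then have "\<forall>\<^sub>F (k, s) in sequentially \<times>\<^sub>F nhds t. - X k s < - m"
    by (intro peak_tendsto_eventually_less[OF cadlag_uminus[OF x] t _ _ n])
       (auto simp: left_lim_uminus[OF x])
  then show "\<forall>\<^sub>F (k, s) in sequentially \<times>\<^sub>F nhds t. m < X k s" by simp
qed

lemma peak_code_tendsto_imp_graph_conv:
  assumes "cadlag x1" "cadlag x2"
    and conv: "(\<lambda>k. peak_code (X1 k, X2 k)) \<longlonglongrightarrow> peak_code (x1, x2)"
  shows "graph_conv X1 x1" "graph_conv X2 x2"
proof -
  have c: "(\<lambda>k. peak_code (X1 k, X2 k) i) \<longlonglongrightarrow> peak_code (x1, x2) i" for i
    using conv unfolding tendsto_fun_iff by blast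
  show "graph_conv X1 x1"
    using c[of "(True, True, _)"] c[of "(True, False, _)"]
    by (intro peak_tendsto_imp_graph_conv assms) (auto simp: peak_code_def)
  show "graph_conv X2 x2"
    using c[of "(False, True, _)"] c[of "(False, False, _)"]
    by (intro peak_tendsto_imp_graph_conv assms) (auto simp: peak_code_def)
qed

lemma completed_graph_uminus:
  assumes "cadlag x"
  shows "completed_graph T (\<lambda>t. - x t) = (\<lambda>p. (fst p, - snd p)) ` completed_graph T x"
proof -
  have *: "z \<in> closed_segment (- a) (- b) \<longleftrightarrow> - z \<in> closed_segment a b" for z a b :: real
    by (auto simp: closed_segment_eq_real_ivl)
  show ?thesis
    by (force simp: completed_graph_def left_lim_uminus[OF assms] * image_iff)
qed

text \<open>Reflecting the space axis is an isometry of the plane that maps completed graphs onto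
  completed graphs.\<close>

lemma M2_dist_uminus:
  assumes "cadlag x" "cadlag y"
  shows "M2_dist T (\<lambda>t. - x t) (\<lambda>t. - y t) = M2_dist T x y"
proof -
  define \<phi> where "\<phi> p = (fst p, - snd p)" for p :: "real \<times> real"
  have "dist (\<phi> p) (\<phi> q) = dist p q" for p q
    by (simp add: \<phi>_def dist_prod_def dist_real_def abs_minus_commute)
  then have "infdist (\<phi> p) (\<phi> ` A) = infdist p A" for p A
    by (simp add: infdist_def image_image)
  then show ?thesis
    unfolding M2_dist_def completed_graph_uminus[OF assms(1)] completed_graph_uminus[OF assms(2)]
      \<phi>_def[symmetric] hausdorff_distance_def
    by (simp add: image_image)
qed

lemma M2_tendsto_uminus:
  assumes "\<And>n. cadlag (X n)" "cadlag x" "M2_tendsto X x"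
  shows "M2_tendsto (\<lambda>n t. - X n t) (\<lambda>t. - x t)"
  unfolding M2_tendsto_def
proof (intro allI impI)
  fix T :: real assume T: "T > 0" and "isCont (\<lambda>t. - x t) T"
  then have "isCont x T" using isCont_minus[of T "\<lambda>t. - x t"] by simp
  with assms T show "(\<lambda>n. M2_dist T (\<lambda>t. - X n t) (\<lambda>t. - x t)) \<longlonglongrightarrow> 0"
    by (simp add: M2_dist_uminus M2_tendsto_def)
qed

lemma peak_code_M2_continuous:
  assumes "\<And>n. cadlag (X1 n)" "cadlag x1" "M2_tendsto X1 x1"
    and "\<And>n. cadlag (X2 n)" "cadlag x2" "M2_tendsto X2 x2"
  shows "(\<lambda>n. peak_code (X1 n, X2 n)) \<longlonglongrightarrow> peak_code (x1, x2)"
  unfolding tendsto_fun_iff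
proof
  fix k :: "bool \<times> bool \<times> rat \<times> rat \<times> rat"
  obtain i j r d b where k: "k = (i, j, r, d, b)" by (metis surj_pair)
  show "(\<lambda>n. peak_code (X1 n, X2 n) k) \<longlonglongrightarrow> peak_code (x1, x2) k"
    using peak_M2_continuous[OF assms(1-3)] peak_M2_continuous[OF assms(4-6)]
      peak_M2_continuous[OF cadlag_uminus cadlag_uminus M2_tendsto_uminus, OF assms(1,2) assms(1-3)]
      peak_M2_continuous[OF cadlag_uminus cadlag_uminus M2_tendsto_uminus, OF assms(4,5) assms(4-6)]
    by (cases i; cases j) (simp_all add: peak_code_def k)
qed

lemma WM2_continuous_peak_code:
  fixes f :: "(bool \<times> bool \<times> rat \<times> rat \<times> rat \<Rightarrow> real) \<Rightarrow> real"
  assumes "continuous_on UNIV f"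
  shows "WM2_continuous (\<lambda>x. f (peak_code x))"
  unfolding WM2_continuous_def
proof (intro allI impI, elim conjE)
  fix X1 X2 x1 x2
  assume "\<forall>n. cadlag (X1 n) \<and> cadlag (X2 n)" "cadlag x1" "cadlag x2"
    "M2_tendsto X1 x1" "M2_tendsto X2 x2"
  then have "(\<lambda>n. peak_code (X1 n, X2 n)) \<longlonglongrightarrow> peak_code (x1, x2)"
    by (intro peak_code_M2_continuous) auto
  then show "(\<lambda>n. f (peak_code (X1 n, X2 n))) \<longlonglongrightarrow> f (peak_code (x1, x2))"
    using assms by (intro isCont_tendsto_compose[of _ f]) (auto simp: continuous_on_eq_continuous_at)
qed

lemma borel_measurable_peak_code:
  assumes "\<And>t. 0 \<le> t \<Longrightarrow> X1 t \<in> borel_measurable M" "\<And>t. 0 \<le> t \<Longrightarrow> X2 t \<in> borel_measurable M"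
    and "\<And>\<omega>. \<omega> \<in> space M \<Longrightarrow> cadlag (\<lambda>t. X1 t \<omega>)" "\<And>\<omega>. \<omega> \<in> space M \<Longrightarrow> cadlag (\<lambda>t. X2 t \<omega>)"
  shows "(\<lambda>\<omega>. peak_code ((\<lambda>t. X1 t \<omega>), (\<lambda>t. X2 t \<omega>))) \<in> borel_measurable M"
proof (rule measurable_coordinatewise_then_product)
  fix k :: "bool \<times> bool \<times> rat \<times> rat \<times> rat"
  obtain i j r d b where k: "k = (i, j, r, d, b)" by (metis surj_pair)
  have "(\<lambda>\<omega>. peak r d b (\<lambda>t. - X t \<omega>)) \<in> borel_measurable M"
    if "\<And>t. 0 \<le> t \<Longrightarrow> X t \<in> borel_measurable M" "\<And>\<omega>. \<omega> \<in> space M \<Longrightarrow> cadlag (\<lambda>t. X t \<omega>)"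
    for r d b X
    by (rule borel_measurable_peak) (use that cadlag_uminus in auto)
  from this[OF assms(1,3)] this[OF assms(2,4)]
    borel_measurable_peak[OF assms(1,3)] borel_measurable_peak[OF assms(2,4)]
  show "(\<lambda>\<omega>. peak_code ((\<lambda>t. X1 t \<omega>), (\<lambda>t. X2 t \<omega>)) k) \<in> borel_measurable M"
    by (cases i; cases j) (simp_all add: peak_code_def k)
qed

section \<open>Slow variation\<close>

text \<open>In additive notation \<open>l x = ln (L (exp x))\<close>. Two sets of measure close to 2 in intervals
  of length 2 that overlap in length at least 1 must intersect, which bounds \<open>l (x + u) - l x\<close> uniformly in \<open>u\<close>.\<close>

lemma slowly_varying_additive_bounded:
  fixes l :: "real \<Rightarrow> real"
  assumes meas: "l \<in> borel_measurable borel"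
    and conv: "\<And>u. ((\<lambda>x. l (x + u) - l x) \<longlongrightarrow> 0) at_top"
  shows "\<exists>X. \<forall>x\<ge>X. \<forall>u\<in>{0..1}. \<bar>l (x + u) - l x\<bar> \<le> 1"
proof -
  note [measurable] = meas
  define B where "B x = {v \<in> {0..2}. \<bar>l (x + v) - l x\<bar> > 1 / 2}" for x
  have Bm [measurable]: "B x \<in> sets lborel" for x
    unfolding B_def by measurable
  \<comment> \<open>For each single v the point is eventually not bad; dominated convergence on
    {0..2} turns this into small measure of the bad set.\<close>
  have "((\<lambda>x. \<integral>v. indicator (B x) v \<partial>lborel) \<longlongrightarrow> (\<integral>v. (0::real) \<partial>(lborel :: real measure))) at_top"
  proof (rule integral_dominated_convergence_at_top[where w = "indicator {0..2::real}"])
    show "AE v in lborel. ((\<lambda>x. indicator (B x) v) \<longlongrightarrow> (0::real)) at_top"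
    proof (rule AE_I2)
      fix v :: real
      have "\<forall>\<^sub>F x in at_top. \<bar>l (x + v) - l x\<bar> < 1 / 2"
        using tendstoD[OF conv[of v], of "1/2"] by simp
      then have "\<forall>\<^sub>F x in at_top. indicator (B x) v = (0::real)"
        by eventually_elim (auto simp: B_def)
      then show "((\<lambda>x. indicator (B x) v) \<longlongrightarrow> (0::real)) at_top"
        by (rule tendsto_eventually)
    qed
    show "\<forall>\<^sub>F x in at_top. AE v in lborel. norm (indicator (B x) v :: real) \<le> indicator {0..2} v"
      by (auto simp: B_def indicator_def)
  qed auto
  then have "\<forall>\<^sub>F x in at_top. measure lborel (B x) < 1 / 2"
    using Bm by (intro order_tendstoD(2)[of _ 0]) simp_all
  then obtain X where X: "\<And>x. x \<ge> X \<Longrightarrow> measure lborel (B x) < 1 / 2"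
    unfolding eventually_at_top_linorder by blast
  have fin: "emeasure lborel (B x) < \<infinity>" for x
    by (rule le_less_trans[OF emeasure_mono[of _ "{0..2}"]]) (auto simp: B_def)
  have "\<bar>l (x + u) - l x\<bar> \<le> 1" if x: "x \<ge> X" and u: "u \<in> {0..1}" for x u
  proof (rule ccontr)
    assume gt: "\<not> \<bar>l (x + u) - l x\<bar> \<le> 1"
    define B' where "B' = (\<lambda>v. u + v) ` B (x + u)"
    have B': "B' = (\<lambda>v. v + (- u)) -` B (x + u)"
      unfolding B'_def by (auto simp: image_iff) (metis add.commute add_diff_cancel_left' diff_add_cancel)
    have m' [measurable]: "B' \<in> sets lborel"
      unfolding B' using measurable_sets[of "\<lambda>v. v + (- u)" lborel borel "B (x + u)"] Bm[of "x + u"] by simp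
    have em: "emeasure lborel B' = emeasure lborel (B (x + u))"
    proof -
      have "emeasure lborel (B (x + u)) = emeasure (distr lborel borel (\<lambda>v. - u + v)) (B (x + u))"
        by (subst lborel_distr_plus) simp
      also have "\<dots> = emeasure lborel B'"
      proof -
        have "(+) (- u) -` B (x + u) = B'" by (auto simp: B')
        moreover have "B (x + u) \<in> sets borel" using Bm[of "x + u"] by simp
        ultimately show ?thesis by (subst emeasure_distr) simp_all
      qed
      finally show ?thesis ..
    qed
    \<comment> \<open>For v in {1..2} both v and v - u lie in {0..2}. If v avoided both bad sets,
      two estimates by 1/2 would add up to the bound 1 that \<open>gt\<close> denies. But two sets
      of measure below 1/2 cannot cover an interval of length 1.\<close>
    have "{1..2} \<subseteq> B x \<union> B'"
    proof
      fix v :: real assume v: "v \<in> {1..2}"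
      show "v \<in> B x \<union> B'"
      proof (rule ccontr)
        assume "v \<notin> B x \<union> B'"
        then have "\<bar>l (x + v) - l x\<bar> \<le> 1 / 2"
          using v by (auto simp: B_def)
        moreover have "\<bar>l (x + u + (v - u)) - l (x + u)\<bar> \<le> 1 / 2"
          using \<open>v \<notin> B x \<union> B'\<close> v u by (auto simp: B_def B')
        then have "\<bar>l (x + v) - l (x + u)\<bar> \<le> 1 / 2"
        proof -
          have "x + u + (v - u) = x + v" by simp
          with \<open>\<bar>l (x + u + (v - u)) - l (x + u)\<bar> \<le> 1 / 2\<close> show ?thesis by (simp only:)
        qed
        ultimately show False using gt by linarith
      qed
    qed
    then have "measure lborel {1..2::real} \<le> measure lborel (B x \<union> B')"
      using fin em Bm[of x] m' by (intro measure_mono_fmeasurable fmeasurable.Un) (auto intro!: fmeasurableI)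
    also have "\<dots> \<le> measure lborel (B x) + measure lborel B'"
      using fin em Bm[of x] m' by (intro measure_Un_le) auto
    also have "measure lborel B' = measure lborel (B (x + u))"
      using em by (simp add: measure_def)
    also have "measure lborel (B x) + measure lborel (B (x + u)) < 1"
      using X[of x] X[of "x + u"] x u by simp
    finally show False by simp
  qed
  then show ?thesis by blast
qed

text \<open>Eventually each unit step costs at most k/2, and the remaining fractional step at most 1
  by the uniform bound. This gives slope k/2 up to a constant, which the other half of k absorbs for
  large x.\<close>

lemma slowly_varying_additive_sublinear:
  fixes l :: "real \<Rightarrow> real"
  assumes meas: "l \<in> borel_measurable borel"
    and conv: "\<And>u. ((\<lambda>x. l (x + u) - l x) \<longlongrightarrow> 0) at_top"
    and k: "k > 0"
  shows "\<forall>\<^sub>F x in at_top. l x \<le> k * x"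
proof -
  obtain X where X: "\<And>x u. x \<ge> X \<Longrightarrow> u \<in> {0..1} \<Longrightarrow> \<bar>l (x + u) - l x\<bar> \<le> 1"
    using slowly_varying_additive_bounded[OF meas conv] by blast
  have "\<forall>\<^sub>F x in at_top. \<bar>l (x + 1) - l x\<bar> < k / 2"
    using tendstoD[OF conv[of 1], of "k / 2"] k by simp
  then obtain X2 where X2: "\<And>x. x \<ge> X2 \<Longrightarrow> \<bar>l (x + 1) - l x\<bar> < k / 2"
    unfolding eventually_at_top_linorder by blast
  define Y where "Y = max X X2"
  have step: "l (y + real n) \<le> l y + real n * (k / 2)" if "y \<ge> Y" for y n
  proof (induction n)
    case (Suc n)
    have "\<bar>l (y + real n + 1) - l (y + real n)\<bar> < k / 2"
      using that by (intro X2) (simp add: Y_def)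
    then have "l (y + real (Suc n)) \<le> l (y + real n) + k / 2" 
      unfolding of_nat_Suc add.assoc[symmetric] add.commute[of 1] by linarith
    also have "\<dots> \<le> l y + real n * (k / 2) + k / 2" using Suc by simp
    also have "\<dots> = l y + real (Suc n) * (k / 2)" by (simp add: algebra_simps add_divide_distrib)
    finally show ?case .
  qed simp
  have bound: "l x \<le> (l Y + 1 - Y * (k / 2)) + (k / 2) * x" if "x \<ge> Y" for x
  proof -
    define n where "n = nat \<lfloor>x - Y\<rfloor>"
    have n: "real n \<le> x - Y" "x - Y < real n + 1"
      using that unfolding n_def by linarith+
    have "l x = l ((x - real n) + real n)" by simp
    also have "\<dots> \<le> l (x - real n) + real n * (k / 2)"
      using n by (intro step) simp
    also have "l (x - real n) \<le> l Y + 1"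
    proof -
      have "\<bar>l (Y + (x - real n - Y)) - l Y\<bar> \<le> 1"
        using n by (intro X) (auto simp: Y_def)
      then show ?thesis by simp
    qed
    also have "real n * (k / 2) \<le> (x - Y) * (k / 2)"
      using n k by (intro mult_right_mono) auto
    finally show ?thesis by (simp add: left_diff_distrib right_diff_distrib diff_divide_distrib mult.commute)
  qed
  define c where "c = l Y + 1 - Y * (k / 2)"
  show ?thesis
    using eventually_ge_at_top[of Y] eventually_ge_at_top[of "2 * c / k"]
  proof eventually_elim
    case (elim x)
    then have "c \<le> (k / 2) * x" using k by (simp add: field_simps)
    then show ?case using bound[OF elim(1)] unfolding c_def by linarith
  qed
qed

text \<open>Passing to logarithms of argument and value turns slow variation into vanishing
  increments and the power bound into a linear one.\<close>

lemma slowly_varying_le_powr: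
  assumes L: "slowly_varying L" and pos: "\<forall>\<^sub>F x in at_top. L x > 0" and k: "k > 0"
  shows "\<forall>\<^sub>F x in at_top. L x \<le> x powr k"
proof -
  from L obtain x0 where m: "L \<in> borel_measurable (restrict_space borel {x0..})"
    and lim: "\<And>r. r > 0 \<Longrightarrow> ((\<lambda>x. L (r * x) / L x) \<longlongrightarrow> 1) at_top"
    unfolding slowly_varying_def by blast
  \<comment> \<open>The indicator confines \<open>L\<close> to the half-line on which it is assumed
    measurable; for large x this is ln (L (exp x)).\<close>
  define l where "l x = ln (indicator {x0..} (exp x) * L (exp x))" for x
  have "(\<lambda>x. indicator {x0..} x * L x) \<in> borel_measurable borel"
    using m by (subst (asm) borel_measurable_restrict_space_iff) simp_all
  then have lm: "l \<in> borel_measurable borel"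
    unfolding l_def by (intro borel_measurable_ln measurable_compose[OF borel_measurable_exp]) auto
  obtain x1 where x1: "\<And>x. x \<ge> x1 \<Longrightarrow> L x > 0"
    using pos unfolding eventually_at_top_linorder by blast
  have leq: "\<forall>\<^sub>F x in at_top. L (exp (x + u)) > 0 \<and> l (x + u) = ln (L (exp (x + u)))" for u
  proof -
    have "filterlim (\<lambda>x::real. exp (x + u)) at_top at_top"
      by (rule filterlim_compose[OF exp_at_top])
        (use filterlim_tendsto_add_at_top[OF tendsto_const filterlim_ident, of u] in \<open>simp add: add.commute\<close>)
    then have "\<forall>\<^sub>F x in at_top. max x0 x1 \<le> exp (x + u)"
      unfolding filterlim_at_top by blast
    then show ?thesis by eventually_elim (use x1 in \<open>auto simp: l_def\<close>)
  qed
  have conv: "((\<lambda>x. l (x + u) - l x) \<longlongrightarrow> 0) at_top" for u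
  proof -
    have "((\<lambda>x. L (exp u * exp x) / L (exp x)) \<longlongrightarrow> 1) at_top"
      by (rule filterlim_compose[OF lim exp_at_top]) simp
    then have "((\<lambda>x. ln (L (exp u * exp x) / L (exp x))) \<longlongrightarrow> ln 1) at_top"
      by (rule tendsto_ln) simp
    moreover have "\<forall>\<^sub>F x in at_top. ln (L (exp u * exp x) / L (exp x)) = l (x + u) - l x"
      using leq[of u] leq[of 0] by eventually_elim (simp add: ln_div exp_add mult.commute)
    ultimately show ?thesis using Lim_transform_eventually by fastforce
  qed
  have "\<forall>\<^sub>F x in at_top. l x \<le> k * x"
    by (rule slowly_varying_additive_sublinear[OF lm conv k])
  with leq[of 0] have "\<forall>\<^sub>F x in at_top. L (exp x) \<le> exp (k * x)"
  proof eventually_elim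
    case (elim x)
    then have "ln (L (exp x)) \<le> k * x" "L (exp x) > 0" by simp_all
    then show ?case using exp_le_cancel_iff[of "ln (L (exp x))" "k * x"] by simp
  qed
  moreover have "filterlim ln at_top (at_top :: real filter)"
    by (rule ln_at_top)
  ultimately have "\<forall>\<^sub>F x in at_top. L (exp (ln x)) \<le> exp (k * ln x)"
    unfolding filterlim_iff by blast
  with eventually_gt_at_top[of 0] show ?thesis
    by eventually_elim (simp add: powr_def)
qed

text \<open>With a powr (1 - h) * L a asymptotic to 1 / \<epsilon>, this says that the first
  admissible index \<epsilon> powr (- \<nu>) is negligible against the time scale.\<close>

lemma powr_scale_negligible:
  assumes L: "slowly_varying L" and pos: "\<forall>\<^sub>F x in at_top. L x > 0"
    and h: "h < 1" and nu: "0 < \<nu>" "\<nu> < 1 / (1 - h)"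
  shows "((\<lambda>a. (a powr (1 - h) * L a) powr \<nu> / a) \<longlongrightarrow> 0) at_top"
proof -
  \<comment> \<open>Half of the gap between 1 / \<nu> and 1 - h: bounding L a by a powr k leaves the
    total exponent (1 - h + k) * \<nu> = 1 - \<nu> * k, still below 1.\<close>
  define k where "k = (1 / \<nu> - (1 - h)) / 2"
  have "1 - h < 1 / \<nu>" using nu h by (simp add: field_simps)
  then have k: "k > 0" by (simp add: k_def)
  have ub: "\<forall>\<^sub>F a in at_top. (a powr (1 - h) * L a) powr \<nu> / a \<le> a powr (- (\<nu> * k))"
    using slowly_varying_le_powr[OF L pos k] pos eventually_gt_at_top[of 0]
  proof eventually_elim
    fix a :: real assume a: "L a \<le> a powr k" "L a > 0" "0 < a"
    have "(a powr (1 - h) * L a) powr \<nu> \<le> (a powr (1 - h) * a powr k) powr \<nu>"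
      using a nu by (intro powr_mono2 mult_left_mono) auto
    also have "\<dots> = a powr ((1 - h + k) * \<nu>)" by (simp add: powr_add[symmetric] powr_powr)
    also have "(1 - h + k) * \<nu> = 1 + - (\<nu> * k)"
      using nu by (simp add: k_def field_simps)
    also have "a powr (1 + - (\<nu> * k)) = a powr (- (\<nu> * k)) * a"
      using a unfolding powr_add by simp
    finally show "(a powr (1 - h) * L a) powr \<nu> / a \<le> a powr (- (\<nu> * k))"
      using a by (simp add: field_simps)
  qed
  have "((\<lambda>a::real. a powr (- (\<nu> * k))) \<longlongrightarrow> 0) at_top"
    using k nu by (intro tendsto_neg_powr filterlim_ident) simp
  moreover have "\<forall>\<^sub>F a in at_top. 0 \<le> (a powr (1 - h) * L a) powr \<nu> / a"
    using eventually_gt_at_top[of 0] by eventually_elim simp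
  ultimately show ?thesis
    using tendsto_sandwich[OF _ ub tendsto_const] by blast
qed

section \<open>Hitting times of the boundary\<close>

lemma Phi_less_iff: "Phi c y u < t \<longleftrightarrow> (\<exists>s>0. ereal s < t \<and> c * (sqrt (y s) / s) < u)"
  unfolding Phi_def Inf_less_iff by auto

lemma Phi_nonneg: "0 \<le> Phi c y u"
  unfolding Phi_def by (intro Inf_greatest) auto

lemma Phi_antimono: "u \<le> u' \<Longrightarrow> Phi c y u' \<le> Phi c y u"
  unfolding Phi_def by (intro Inf_superset_mono image_mono) auto

lemma le_of_less_Phi: "0 < s \<Longrightarrow> ereal s < Phi c y u \<Longrightarrow> u * s \<le> c * sqrt (y s)"
  using Phi_less_iff[of c y u "Phi c y u"] by (rule_tac ccontr) (auto simp: field_simps not_le)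

text \<open>Right-continuity spreads a strict crossing at s to rational times just after s. The
  countable infimum is what yields measurability later.\<close>

lemma Phi_rational:
  assumes y: "cadlag y"
  shows "Phi c y u = (INF q\<in>\<rat> \<inter> {0<..}. if c * (sqrt (y q) / q) < u then ereal q else \<infinity>)"
    (is "_ = ?R")
proof (rule antisym)
  show "Phi c y u \<le> ?R"
    unfolding Phi_def by (intro INF_greatest) (auto intro!: Inf_lower)
  show "?R \<le> Phi c y u"
    unfolding Phi_def
  proof (intro Inf_greatest, clarify)
    fix s :: real assume s: "0 < s" "c * (sqrt (y s) / s) < u"
    have "((\<lambda>r. c * (sqrt (y r) / r)) \<longlongrightarrow> c * (sqrt (y s) / s)) (at_right s)"
      using s cadlag_tendsto_right[OF y, of s] by (intro tendsto_intros) auto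
    then have ev: "\<forall>\<^sub>F r in at_right s. c * (sqrt (y r) / r) < u"
      by (rule order_tendstoD(2)) (rule s)
    show "?R \<le> ereal s"
    proof (rule dense_ge)
      fix z assume "ereal s < z"
      then obtain r where r: "ereal s < ereal r" "ereal r < z" using ereal_dense2 by blast
      have "\<forall>\<^sub>F t in at_right s. t \<in> {s<..<r}"
        using r by (intro eventually_at_right_real) simp
      with ev have "\<forall>\<^sub>F t in at_right s. c * (sqrt (y t) / t) < u \<and> t < r"
        by eventually_elim simp
      then obtain q where q: "q \<in> \<rat>" "s < q" "c * (sqrt (y q) / q) < u" "q < r"
        using eventually_at_right_rational by blast
      then have "?R \<le> (if c * (sqrt (y q) / q) < u then ereal q else \<infinity>)"
        using s by (intro INF_lower) auto
      also have "\<dots> \<le> ereal r" using q by simp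
      finally show "?R \<le> z" using r by simp
    qed
  qed
qed

text \<open>Before \<tau> the path is on or above the line, hence so is its left limit. Were the
  value at \<tau> strictly above, right-continuity would push the first crossing past \<tau>. With
  no downward jump, the left limit and the value are squeezed onto the line.\<close>

lemma Phi_attained:
  assumes y: "cadlag y" and nonneg: "\<And>t. 0 \<le> t \<Longrightarrow> 0 \<le> y t" and c: "0 < c"
    and \<tau>: "Phi c y u = ereal \<tau>" "0 < \<tau>" and jump: "left_lim y \<tau> \<le> y \<tau>"
  shows "c * sqrt (y \<tau>) = u * \<tau>" "left_lim y \<tau> = y \<tau>"
proof -
  have "\<forall>\<^sub>F s in at_left \<tau>. u * s \<le> c * sqrt (y s)"
    using eventually_at_left_real[OF \<tau>(2)]
    by (rule eventually_mono) (use \<tau> in \<open>auto intro!: le_of_less_Phi\<close>)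
  moreover have "((\<lambda>s. c * sqrt (y s)) \<longlongrightarrow> c * sqrt (left_lim y \<tau>)) (at_left \<tau>)"
    by (intro tendsto_intros cadlag_tendsto_left_lim y \<tau>)
  moreover have "((\<lambda>s. u * s) \<longlongrightarrow> u * \<tau>) (at_left \<tau>)"
    by (intro tendsto_intros)
  ultimately have left: "u * \<tau> \<le> c * sqrt (left_lim y \<tau>)"
    by (intro tendsto_le[of "at_left \<tau>"]) auto
  have right: "c * sqrt (y \<tau>) \<le> u * \<tau>"
  proof (rule ccontr)
    assume gt: "\<not> c * sqrt (y \<tau>) \<le> u * \<tau>"
    have "((\<lambda>s. c * sqrt (y s) - u * s) \<longlongrightarrow> c * sqrt (y \<tau>) - u * \<tau>) (at_right \<tau>)"
      using cadlag_tendsto_right[OF y, of \<tau>] \<tau> by (intro tendsto_intros) auto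
    then have "\<forall>\<^sub>F s in at_right \<tau>. 0 < c * sqrt (y s) - u * s"
      by (rule order_tendstoD(1)) (use gt in simp)
    then obtain b where b: "b > \<tau>" "\<And>s. \<tau> < s \<Longrightarrow> s < b \<Longrightarrow> 0 < c * sqrt (y s) - u * s"
      unfolding eventually_at_right_field by blast
    have "Phi c y u < ereal b" using \<tau> b by simp
    then obtain s where s: "0 < s" "s < b" "c * (sqrt (y s) / s) < u"
      by (auto simp: Phi_less_iff)
    then have lt: "c * sqrt (y s) < u * s" by (simp add: field_simps)
    have "\<tau> \<le> s"
      using s(1,3) \<tau>(1) Phi_less_iff[of c y u "ereal \<tau>"] by force
    then show False using lt b(2)[of s] gt s by (cases "s = \<tau>") auto
  qed
  have "sqrt (left_lim y \<tau>) \<le> sqrt (y \<tau>)" using jump by simp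
  then have "c * sqrt (left_lim y \<tau>) \<le> c * sqrt (y \<tau>)" using c by simp
  with left right have "c * sqrt (left_lim y \<tau>) = c * sqrt (y \<tau>)" and *: "c * sqrt (y \<tau>) = u * \<tau>"
    by linarith+
  from this(1) c have "sqrt (left_lim y \<tau>) = sqrt (y \<tau>)" by simp
  then show "left_lim y \<tau> = y \<tau>" by simp
  show "c * sqrt (y \<tau>) = u * \<tau>" by (rule *)
qed

lemma eventually_compact_uniform:
  assumes K: "compact (K :: 'b::topological_space set)"
    and loc: "\<And>t. t \<in> K \<Longrightarrow> \<forall>\<^sub>F (k, s) in F \<times>\<^sub>F nhds t. P k s"
  shows "\<forall>\<^sub>F k in F. \<forall>s\<in>K. P k s"
proof -
  have "\<exists>U. open U \<and> t \<in> U \<and> (\<forall>\<^sub>F k in F. \<forall>s\<in>U. P k s)" if t: "t \<in> K" for t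
  proof -
    obtain Pf Pg where P: "eventually Pf F" "eventually Pg (nhds t)" "\<And>k s. Pf k \<Longrightarrow> Pg s \<Longrightarrow> P k s"
      using loc[OF t] unfolding eventually_prod_filter by auto
    from P(2) obtain U where "open U" "t \<in> U" "\<And>s. s \<in> U \<Longrightarrow> Pg s"
      unfolding eventually_nhds by blast
    moreover have "\<forall>\<^sub>F k in F. \<forall>s\<in>U. P k s"
      using P(1) by eventually_elim (use P(3) calculation in blast)
    ultimately show ?thesis by blast
  qed
  then obtain U where U: "\<And>t. t \<in> K \<Longrightarrow> open (U t) \<and> t \<in> U t \<and> (\<forall>\<^sub>F k in F. \<forall>s\<in>U t. P k s)"
    by metis
  obtain C where C: "C \<subseteq> K" "finite C" "K \<subseteq> (\<Union>c\<in>C. U c)"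
    by (rule compactE_image[OF K, of K U]) (use U in auto)
  have "\<forall>\<^sub>F k in F. \<forall>c\<in>C. \<forall>s\<in>U c. P k s"
    using C U by (intro eventually_ball_finite) auto
  then show ?thesis by eventually_elim (use C(3) in blast)
qed

lemma eventually_prod_compose:
  assumes "\<forall>\<^sub>F (k, s) in sequentially \<times>\<^sub>F nhds t. P k s" "tk \<longlonglongrightarrow> t"
  shows "\<forall>\<^sub>F k in sequentially. P k (tk k)"
proof -
  have "filterlim (\<lambda>k. (k, tk k)) (sequentially \<times>\<^sub>F nhds t) sequentially"
    using assms(2) by (intro filterlim_Pair filterlim_ident)
  from filterlim_iff[THEN iffD1, OF this, rule_format, OF assms(1)] show ?thesis by simp
qed

text \<open>Where the left limit equals the value, the upper and the lower bound of
  \<open>graph_conv\<close> meet.\<close>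

lemma graph_conv_tendsto:
  assumes "graph_conv X x" "0 < t" "left_lim x t = x t" "tk \<longlonglongrightarrow> t"
  shows "(\<lambda>k. X k (tk k)) \<longlonglongrightarrow> x t"
  by (rule order_tendstoI)
     (use eventually_prod_compose[OF graph_convD(1)[OF assms(1,2)] assms(4)]
          eventually_prod_compose[OF graph_convD(2)[OF assms(1,2)] assms(4)] assms(3) in auto)

text \<open>Continuity of \<open>Phi\<close> at 1 enters through the existence of some \<open>u > 1\<close> with \<open>c * sqrt (y s) \<ge> u * s\<close>
  strictly before \<open>\<tau>\<close>: this strict separation survives the perturbation of the path.\<close>

lemma hitting_time_tendsto:
  fixes T :: "nat \<Rightarrow> nat"
  assumes y: "cadlag y" and nonneg: "\<And>t. 0 \<le> t \<Longrightarrow> 0 \<le> y t" and c: "0 < c"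
    and \<tau>: "Phi c y 1 = ereal \<tau>" "0 < \<tau>" and cont: "isCont (Phi c y) 1"
    and X: "graph_conv X (\<lambda>t. sqrt (y t))"
    and a: "filterlim a at_top sequentially" and u: "u \<longlonglongrightarrow> 1" and r: "(\<lambda>k. r k / a k) \<longlonglongrightarrow> 0"
    and \<eta>: "\<eta> > 0"
    and K: "\<And>k n. K k n \<longleftrightarrow> r k < real n \<and> c * X k (real n / a k) < u k * (real n / a k)"
    and late: "\<forall>\<^sub>F k in sequentially. \<forall>n. K k n \<longrightarrow> \<eta> * a k < real n"
    and T: "\<forall>\<^sub>F k in sequentially. (\<exists>n. K k n) \<longrightarrow> T k = (LEAST n. K k n)"
  shows "\<forall>\<^sub>F k in sequentially. K k (T k)" and "(\<lambda>k. real (T k) / a k) \<longlonglongrightarrow> \<tau>"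
proof -
  have a0: "\<forall>\<^sub>F k in sequentially. 0 < a k"
    using a by (simp add: filterlim_at_top_dense)
  have sy: "cadlag (\<lambda>t. sqrt (y t))" and sl: "left_lim (\<lambda>t. sqrt (y t)) t = sqrt (left_lim y t)" for t
    by (rule cadlag_compose[OF y] left_lim_compose[OF y]; auto intro!: continuous_intros)+
  have un: "filterlim (\<lambda>p. u (fst p) * snd p) (nhds (1 * t)) (sequentially \<times>\<^sub>F nhds t)" for t :: real
    by (intro tendsto_mult filterlim_compose[OF u filterlim_fst] filterlim_snd)
  \<comment> \<open>A strict crossing at some s < t1 is first widened: a slope v < 1 and
    right-continuity give a whole interval (s, b) below the line of slope v. At an interior point t
    the left limit is then below as well, as \<open>graph_conv\<close> requires.\<close>
  have upper: "\<forall>\<^sub>F k in sequentially. \<exists>n. K k n \<and> real n / a k < t1" if t1: "\<tau> < t1" for t1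
  proof -
    from t1 \<tau> have "Phi c y 1 < ereal t1" by simp
    then obtain s where s: "0 < s" "s < t1" "c * (sqrt (y s) / s) < 1"
      by (auto simp: Phi_less_iff)
    obtain v where v: "c * (sqrt (y s) / s) < v" "v < 1" using dense[OF s(3)] by blast
    then have "c * sqrt (y s) - v * s < 0" using s by (simp add: field_simps)
    moreover have "((\<lambda>t. c * sqrt (y t) - v * t) \<longlongrightarrow> c * sqrt (y s) - v * s) (at_right s)"
      using s cadlag_tendsto_right[OF y, of s] by (intro tendsto_intros) auto
    ultimately have "\<forall>\<^sub>F t in at_right s. c * sqrt (y t) - v * t < 0"
      by (intro order_tendstoD(2)) auto
    then obtain b where b: "s < b" "\<And>t. s < t \<Longrightarrow> t < b \<Longrightarrow> c * sqrt (y t) < v * t"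
      unfolding eventually_at_right_field by auto
    define t where "t = (s + min b t1) / 2"
    have t: "s < t" "t < b" "t < t1" "0 < t" using s b by (auto simp: t_def)
    \<comment> \<open>c * m is the midpoint of v * t and t, which leaves room both for the path and
      for the slopes u k near 1.\<close>
    define m where "m = t * (1 + v) / (2 * c)"
    have vm: "v * t < c * m" "c * m < t" using v t c by (auto simp: m_def field_simps)
    have "c * sqrt (left_lim y t) \<le> v * t"
    proof (rule tendsto_le[of "at_left t"])
      show "((\<lambda>t. c * sqrt (y t)) \<longlongrightarrow> c * sqrt (left_lim y t)) (at_left t)"
        by (intro tendsto_intros cadlag_tendsto_left_lim y t)
      show "((\<lambda>s. v * s) \<longlongrightarrow> v * t) (at_left t)" by (intro tendsto_intros)
      show "\<forall>\<^sub>F r in at_left t. c * sqrt (y r) \<le> v * r"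
        using eventually_at_left_real[OF t(1)] by (rule eventually_mono) (use b t in \<open>auto intro!: less_imp_le\<close>)
    qed auto
    then have "c * sqrt (left_lim y t) < c * m" "c * sqrt (y t) < c * m"
      using vm b(2)[of t] t by auto
    then have "sqrt (y t) < m" "left_lim (\<lambda>t. sqrt (y t)) t < m" using c sl by auto
    then have e1: "\<forall>\<^sub>F (k, s) in sequentially \<times>\<^sub>F nhds t. X k s < m"
      by (rule graph_convD(1)[OF X t(4)])
    have e2: "\<forall>\<^sub>F (k, s) in sequentially \<times>\<^sub>F nhds t. c * m < u k * s"
      using order_tendstoD(1)[OF un, of "c * m" t] vm by (simp add: case_prod_unfold)
    \<comment> \<open>The first point at or after t of the grid with mesh 1 / a k, since the rule
      inspects only integer indices.\<close>
    define tk where "tk k = real (nat \<lceil>t * a k\<rceil>) / a k" for k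
    have tk: "tk \<longlonglongrightarrow> t"
    proof (rule tendsto_sandwich)
      show "\<forall>\<^sub>F k in sequentially. t \<le> tk k"
        using a0 by eventually_elim (use t in \<open>auto simp: tk_def field_simps\<close>)
      show "\<forall>\<^sub>F k in sequentially. tk k \<le> t + 1 / a k"
        using a0
      proof eventually_elim
        case (elim k)
        have "0 \<le> t * a k" using elim t by simp
        then have "real (nat \<lceil>t * a k\<rceil>) \<le> t * a k + 1" by linarith
        then show ?case using elim by (simp add: tk_def field_simps)
      qed
      have "(\<lambda>k. 1 / a k) \<longlonglongrightarrow> 0"
        using a by (intro tendsto_divide_0[OF tendsto_const] filterlim_at_top_imp_at_infinity)
      from tendsto_add[OF tendsto_const[of t] this] show "(\<lambda>k. t + 1 / a k) \<longlonglongrightarrow> t" by simp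
    qed auto
    have "(\<lambda>k. tk k - r k / a k) \<longlonglongrightarrow> t - 0" by (intro tendsto_diff tk r)
    then have "\<forall>\<^sub>F k in sequentially. 0 < tk k - r k / a k" using t by (intro order_tendstoD(1)) auto
    with eventually_prod_compose[OF e1 tk] eventually_prod_compose[OF e2 tk]
      a0 order_tendstoD(2)[OF tk t(3)]
    show ?thesis
    proof eventually_elim
      case (elim k)
      have "c * X k (tk k) < c * m" using elim c by simp
      also have "\<dots> < u k * tk k" using elim by simp
      finally have "K k (nat \<lceil>t * a k\<rceil>)"
        unfolding K tk_def[symmetric] using elim by (simp add: tk_def divide_less_cancel)
      then show ?case using elim by (auto simp: tk_def)
    qed
  qed
  have KT: "\<forall>\<^sub>F k in sequentially. K k (T k) \<and> real (T k) / a k < t1" if "\<tau> < t1" for t1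
    using upper[OF that] T a0
  proof eventually_elim
    case (elim k)
    then obtain n where n: "K k n" "real n / a k < t1" by blast
    then have "T k = (LEAST n. K k n)" using elim by blast
    with n have "K k (T k)" "T k \<le> n" by (auto intro: LeastI Least_le)
    moreover have "real (T k) / a k \<le> real n / a k"
      using calculation elim by (intro divide_right_mono) auto
    ultimately show ?case using n by simp
  qed
  show "\<forall>\<^sub>F k in sequentially. K k (T k)"
    using KT[of "\<tau> + 1"] by (auto elim: eventually_mono)
  show "(\<lambda>k. real (T k) / a k) \<longlonglongrightarrow> \<tau>"
  proof (rule order_tendstoI)
    fix t1 assume "\<tau> < t1"
    from KT[OF this] show "\<forall>\<^sub>F k in sequentially. real (T k) / a k < t1"
      by (auto elim: eventually_mono)
  next
    fix t0 assume t0: "t0 < \<tau>"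
    have "(Phi c y \<longlongrightarrow> ereal \<tau>) (at_right 1)"
      using cont \<tau> by (simp add: continuous_at_imp_continuous_within isCont_def filterlim_at_split)
    then have "\<forall>\<^sub>F v in at_right 1. ereal t0 < Phi c y v"
      by (rule order_tendstoD(1)) (use t0 in simp)
    with eventually_at_right_less[of 1] have "\<forall>\<^sub>F v in at_right 1. 1 < v \<and> ereal t0 < Phi c y v"
      by eventually_elim simp
    then obtain v where v: "1 < v" "ereal t0 < Phi c y v"
      using eventually_happens'[OF trivial_limit_at_right_real] by blast
    \<comment> \<open>Compactness makes the strict separation uniform on [\<eta>, t0]. Times up to
      \<eta>, where path convergence gives no uniform control, are excluded by
      \<open>late\<close>.\<close>
    have "\<forall>\<^sub>F k in sequentially. \<forall>s\<in>{\<eta>..t0}. u k * s < c * X k s"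
    proof (rule eventually_compact_uniform)
      fix t assume t: "t \<in> {\<eta>..t0}"
      then have t': "0 < t" using \<eta> by simp
      define m where "m = t * (1 + v) / (2 * c)"
      have vm: "c * m < v * t" "t < c * m" using v t' c by (auto simp: m_def field_simps)
      have "ereal t < Phi c y v" using le_less_trans[OF _ v(2), of "ereal t"] t by simp
      then obtain b where b: "t < b" "ereal b < Phi c y v" using ereal_dense2[of "ereal t" "Phi c y v"] by auto
      have le: "v * s \<le> c * sqrt (y s)" if "0 < s" "s < b" for s
        using that less_trans[OF _ b(2), of "ereal s"] by (intro le_of_less_Phi) auto
      have "v * t \<le> c * sqrt (left_lim y t)"
      proof (rule tendsto_le[of "at_left t"])
        show "((\<lambda>t. c * sqrt (y t)) \<longlongrightarrow> c * sqrt (left_lim y t)) (at_left t)"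
          by (intro tendsto_intros cadlag_tendsto_left_lim y t')
        show "((\<lambda>s. v * s) \<longlongrightarrow> v * t) (at_left t)" by (intro tendsto_intros)
        show "\<forall>\<^sub>F r in at_left t. v * r \<le> c * sqrt (y r)"
          using eventually_at_left_real[OF t'] by (rule eventually_mono) (use le b in auto)
      qed auto
      then have "c * m < c * sqrt (left_lim y t)" "c * m < c * sqrt (y t)"
        using vm le[of t] t' b by auto
      then have "m < sqrt (y t)" "m < left_lim (\<lambda>t. sqrt (y t)) t" using c sl by auto
      then have e1: "\<forall>\<^sub>F (k, s) in sequentially \<times>\<^sub>F nhds t. m < X k s"
        by (rule graph_convD(2)[OF X t'])
      have e2: "\<forall>\<^sub>F (k, s) in sequentially \<times>\<^sub>F nhds t. u k * s < c * m"
        using order_tendstoD(2)[OF un, of t "c * m"] vm by (simp add: case_prod_unfold)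
      show "\<forall>\<^sub>F (k, s) in sequentially \<times>\<^sub>F nhds t. u k * s < c * X k s"
        using e1 e2 unfolding case_prod_unfold
      proof eventually_elim
        case (elim p)
        then have "c * m < c * X (fst p) (snd p)" using c by simp
        with elim(2) show ?case by (rule less_trans)
      qed
    qed simp
    with KT[of "\<tau> + 1", simplified] late a0
    show "\<forall>\<^sub>F k in sequentially. t0 < real (T k) / a k"
    proof eventually_elim
      case (elim k)
      then have T: "\<eta> < real (T k) / a k" "\<not> u k * (real (T k) / a k) < c * X k (real (T k) / a k)"
        by (auto simp: K field_simps)
      show ?case
      proof (rule ccontr)
        assume "\<not> t0 < real (T k) / a k"
        with T(1) have "real (T k) / a k \<in> {\<eta>..t0}" by simp
        with elim(4) T(2) show False by blast
      qed
    qed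
  qed
qed

section \<open>Self-similarity\<close>

text \<open>The \<open>Suc\<close> puts the dyadic points strictly to the right of t, so
  right-continuity alone suffices. A path is thus evaluated at a random time through countably many
  fixed times, hence measurably.\<close>

lemma right_dyadic_lim:
  assumes "(x \<longlongrightarrow> x t) (at_right t)" "0 \<le> t"
  shows "lim (\<lambda>n. x (real (Suc (nat \<lfloor>2 ^ n * t\<rfloor>)) / 2 ^ n)) = (x t :: real)"
proof (rule limI, rule filterlim_compose[OF assms(1)])
  define d where "d n = real (Suc (nat \<lfloor>2 ^ n * t\<rfloor>)) / 2 ^ n" for n
  have "t < d n \<and> d n \<le> t + (1 / 2) ^ n" for n
  proof -
    have "0 \<le> 2 ^ n * t" using assms by simp
    then have "2 ^ n * t < real (Suc (nat \<lfloor>2 ^ n * t\<rfloor>))" "real (Suc (nat \<lfloor>2 ^ n * t\<rfloor>)) \<le> 2 ^ n * t + 1"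
      by linarith+
    then show ?thesis by (simp add: d_def field_simps)
  qed
  note d = this
  have "(\<lambda>n. t + (1 / 2) ^ n) \<longlonglongrightarrow> t + 0"
    by (intro tendsto_intros LIMSEQ_power_zero) simp
  then have "d \<longlonglongrightarrow> t"
    by (intro tendsto_sandwich[OF _ _ tendsto_const, of _ d _ "\<lambda>n. t + (1/2)^n"])
       (use d in \<open>auto simp: less_imp_le\<close>)
  then show "filterlim (\<lambda>n. real (Suc (nat \<lfloor>2 ^ n * t\<rfloor>)) / 2 ^ n) (at_right t) sequentially"
    unfolding filterlim_at d_def[symmetric] using d by (auto simp: less_imp_neq[THEN not_sym])
qed

text \<open>A version of the limit variable that makes sense, and is measurable, on the space of all paths
  with the product sigma-algebra.\<close>

definition path_Phi :: "(real \<Rightarrow> 'a \<Rightarrow> real) \<Rightarrow> real \<Rightarrow> real \<Rightarrow> 'a \<Rightarrow> ereal" where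
  "path_Phi A c u \<omega> = (INF q\<in>\<rat> \<inter> {0<..}. if c * (sqrt (A q \<omega>) / q) < u then ereal q else \<infinity>)"

definition path_eval :: "(real \<Rightarrow> 'a \<Rightarrow> real) \<Rightarrow> ('a \<Rightarrow> real) \<Rightarrow> 'a \<Rightarrow> real" where
  "path_eval A s \<omega> = lim (\<lambda>n. A (real (Suc (nat \<lfloor>2 ^ n * s \<omega>\<rfloor>)) / 2 ^ n) \<omega>)"

definition path_statistic :: "(real \<Rightarrow> 'a \<Rightarrow> real) \<Rightarrow> (real \<Rightarrow> 'a \<Rightarrow> real) \<Rightarrow> real \<Rightarrow> 'a \<Rightarrow> real" where
  "path_statistic A B c \<omega> =
     path_eval A (\<lambda>\<omega>. real_of_ereal (path_Phi B c 1 \<omega>)) \<omega> /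
     sqrt (path_eval B (\<lambda>\<omega>. real_of_ereal (path_Phi B c 1 \<omega>)) \<omega>)"

lemma borel_measurable_path_Phi:
  assumes "\<And>t. 0 \<le> t \<Longrightarrow> A t \<in> borel_measurable M"
  shows "path_Phi A c u \<in> borel_measurable M"
  unfolding path_Phi_def
proof (rule borel_measurable_INF)
  fix q :: real assume "q \<in> \<rat> \<inter> {0<..}"
  then have [measurable]: "A q \<in> borel_measurable M" using assms by simp
  show "(\<lambda>\<omega>. if c * (sqrt (A q \<omega>) / q) < u then ereal q else \<infinity>) \<in> borel_measurable M"
    by measurable
qed (rule countable_Int1[OF countable_rat])

lemma borel_measurable_path_eval:
  assumes A: "\<And>t. 0 \<le> t \<Longrightarrow> A t \<in> borel_measurable M" and s [measurable]: "s \<in> borel_measurable M"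
  shows "path_eval A s \<in> borel_measurable M"
  unfolding path_eval_def
proof (rule borel_measurable_lim_metric)
  fix n :: nat
  have "(\<lambda>\<omega>. (\<lambda>k \<omega>. A (real (Suc k) / 2 ^ n) \<omega>) (nat \<lfloor>2 ^ n * s \<omega>\<rfloor>) \<omega>) \<in> borel_measurable M"
    by (rule measurable_compose_countable) (auto intro!: A)
  then show "(\<lambda>\<omega>. A (real (Suc (nat \<lfloor>2 ^ n * s \<omega>\<rfloor>)) / 2 ^ n) \<omega>) \<in> borel_measurable M" by simp
qed

lemma borel_measurable_path_statistic:
  assumes "\<And>t. 0 \<le> t \<Longrightarrow> A t \<in> borel_measurable M" "\<And>t. 0 \<le> t \<Longrightarrow> B t \<in> borel_measurable M"
  shows "path_statistic A B c \<in> borel_measurable M"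
proof -
  have "(\<lambda>\<omega>. real_of_ereal (path_Phi B c 1 \<omega>)) \<in> borel_measurable M"
    by (intro borel_measurable_real_of_ereal borel_measurable_path_Phi assms)
  then have [measurable]: "path_eval A (\<lambda>\<omega>. real_of_ereal (path_Phi B c 1 \<omega>)) \<in> borel_measurable M"
    "path_eval B (\<lambda>\<omega>. real_of_ereal (path_Phi B c 1 \<omega>)) \<in> borel_measurable M"
    using assms by (simp_all add: borel_measurable_path_eval)
  show ?thesis unfolding path_statistic_def by measurable
qed

lemma path_Phi_cadlag: "cadlag (\<lambda>t. A t \<omega>) \<Longrightarrow> path_Phi A c u \<omega> = Phi c (\<lambda>t. A t \<omega>) u"
  by (simp add: path_Phi_def Phi_rational)

lemma path_eval_cadlag: "cadlag (\<lambda>t. A t \<omega>) \<Longrightarrow> 0 \<le> s \<omega> \<Longrightarrow> path_eval A s \<omega> = A (s \<omega>) \<omega>"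
  unfolding path_eval_def by (rule right_dyadic_lim[of "\<lambda>t. A t \<omega>", OF cadlag_tendsto_right])

lemma path_statistic_cadlag:
  assumes "cadlag (\<lambda>t. A t \<omega>)" "cadlag (\<lambda>t. B t \<omega>)"
  shows "path_statistic A B c \<omega> = limit_variable A B c \<omega>"
proof -
  define s where "s \<omega> = real_of_ereal (path_Phi B c 1 \<omega>)" for \<omega>
  have s: "s \<omega> = real_of_ereal (Phi c (\<lambda>t. B t \<omega>) 1)"
    unfolding s_def path_Phi_cadlag[of B, OF assms(2)] ..
  then have "0 \<le> s \<omega>" using Phi_nonneg by (simp add: real_of_ereal_pos)
  then show ?thesis
    using path_eval_cadlag[of A \<omega> s, OF assms(1)] path_eval_cadlag[of B \<omega> s, OF assms(2)]
    unfolding path_statistic_def limit_variable_def Let_def s_def[symmetric] s[symmetric] by simp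
qed

abbreviation path_space :: "(real \<Rightarrow> real \<times> real) measure" where
  "path_space \<equiv> Pi\<^sub>M {0..} (\<lambda>_. borel)"

lemma path_Phi_restrict:
  "path_Phi (\<lambda>t p. snd (p t)) c u (\<lambda>t\<in>{0..}. (A t \<omega>, B t \<omega>)) = path_Phi B c u \<omega>"
  unfolding path_Phi_def by (intro INF_cong) auto

text \<open>Only positive times are ever read: \<open>path_Phi\<close> looks at positive rationals,
  and \<open>Suc (nat _)\<close> is positive whatever the evaluation time.\<close>

lemma path_statistic_restrict:
  "path_statistic (\<lambda>t p. fst (p t)) (\<lambda>t p. snd (p t)) c (\<lambda>t\<in>{0..}. (A t \<omega>, B t \<omega>)) =
   path_statistic A B c \<omega>"
  unfolding path_statistic_def path_eval_def path_Phi_restrict by simp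

lemma measurable_path_coordinates:
  assumes "0 \<le> t"
  shows "(\<lambda>p. fst (p t)) \<in> borel_measurable path_space" "(\<lambda>p. snd (p t)) \<in> borel_measurable path_space"
proof -
  have t: "(\<lambda>p. p t) \<in> measurable path_space (borel :: (real \<times> real) measure)"
    by (rule measurable_component_singleton) (use assms in simp)
  have m: "fst \<in> borel_measurable (borel :: (real \<times> real) measure)" "snd \<in> borel_measurable (borel :: (real \<times> real) measure)"
    by (rule borel_measurable_continuous_onI, intro continuous_intros)+
  show "(\<lambda>p. fst (p t)) \<in> borel_measurable path_space" "(\<lambda>p. snd (p t)) \<in> borel_measurable path_space"
    by (rule measurable_compose[OF t m(1)] measurable_compose[OF t m(2)])+
qed

lemma process_law_transfer:
  assumes law: "process_law N X1 X2 = process_law N X1' X2'"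
    and X: "\<And>t. 0 \<le> t \<Longrightarrow> X1 t \<in> borel_measurable N" "\<And>t. 0 \<le> t \<Longrightarrow> X2 t \<in> borel_measurable N"
    and X': "\<And>t. 0 \<le> t \<Longrightarrow> X1' t \<in> borel_measurable N" "\<And>t. 0 \<le> t \<Longrightarrow> X2' t \<in> borel_measurable N"
    and \<Psi>: "\<Psi> \<in> measurable path_space R"
  shows "distr N R (\<lambda>\<omega>. \<Psi> (\<lambda>t\<in>{0..}. (X1 t \<omega>, X2 t \<omega>))) = distr N R (\<lambda>\<omega>. \<Psi> (\<lambda>t\<in>{0..}. (X1' t \<omega>, X2' t \<omega>)))"
proof -
  have m: "(\<lambda>\<omega>. \<lambda>t\<in>{0..}. (U t \<omega>, V t \<omega>)) \<in> measurable N path_space"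
    if "\<And>t. 0 \<le> t \<Longrightarrow> U t \<in> borel_measurable N" "\<And>t. 0 \<le> t \<Longrightarrow> V t \<in> borel_measurable N" for U V
    using that by (intro measurable_restrict borel_measurable_Pair) auto
  have "distr N R (\<lambda>\<omega>. \<Psi> (\<lambda>t\<in>{0..}. (X1 t \<omega>, X2 t \<omega>))) = distr (process_law N X1 X2) R \<Psi>"
    unfolding process_law_def by (subst distr_distr[OF \<Psi> m[OF X]]) (auto simp: o_def)
  also have "\<dots> = distr N R (\<lambda>\<omega>. \<Psi> (\<lambda>t\<in>{0..}. (X1' t \<omega>, X2' t \<omega>)))"
    unfolding law unfolding process_law_def by (subst distr_distr[OF \<Psi> m[OF X']]) (auto simp: o_def)
  finally show ?thesis .
qed

section \<open>The boundary functional under scaling of time and of values\<close>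

lemma ereal_eqI:
  assumes "\<And>t. x < ereal t \<longleftrightarrow> y < ereal t"
  shows "x = y"
proof (rule ccontr)
  assume "x \<noteq> y"
  then consider "x < y" | "y < x" by (rule linorder_neqE)
  then show False
  proof cases
    case 1
    from ereal_dense2[OF 1] obtain t where "x < ereal t" "ereal t < y" by blast
    then show False using assms[of t] by simp
  next
    case 2
    from ereal_dense2[OF 2] obtain t where "y < ereal t" "ereal t < x" by blast
    then show False using assms[of t] by simp
  qed
qed

lemma Phi_time_scale:
  assumes a: "a > 0"
  shows "Phi c (\<lambda>t. y (a * t)) u = Phi (c * a) y u / ereal a"
proof (rule ereal_eqI)
  fix t
  have "Phi c (\<lambda>t. y (a * t)) u < ereal t \<longleftrightarrow> (\<exists>s>0. s < t \<and> c * (sqrt (y (a * s)) / s) < u)"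
    by (simp add: Phi_less_iff)
  also have "\<dots> \<longleftrightarrow> (\<exists>r>0. r < a * t \<and> c * a * (sqrt (y r) / r) < u)"
  proof safe
    fix s assume "0 < s" "s < t" "c * (sqrt (y (a * s)) / s) < u"
    then show "\<exists>r>0. r < a * t \<and> c * a * (sqrt (y r) / r) < u"
      using a by (intro exI[of _ "a * s"]) auto
  next
    fix r assume "0 < r" "r < a * t" "c * a * (sqrt (y r) / r) < u"
    then show "\<exists>s>0. s < t \<and> c * (sqrt (y (a * s)) / s) < u"
      using a by (intro exI[of _ "r / a"]) (auto simp: field_simps)
  qed
  also have "\<dots> \<longleftrightarrow> Phi (c * a) y u < ereal (a * t)"
    by (simp add: Phi_less_iff)
  also have "\<dots> \<longleftrightarrow> Phi (c * a) y u / ereal a < ereal t"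
    using a by (cases "Phi (c * a) y u") (auto simp: field_simps divide_ereal_def)
  finally show "Phi c (\<lambda>t. y (a * t)) u < ereal t \<longleftrightarrow> Phi (c * a) y u / ereal a < ereal t" .
qed

lemma Phi_value_scale: "Phi c (\<lambda>t. a powr (2 * h) * y t) u = Phi (c * a powr h) y u"
proof -
  have "a powr (2 * h) = a powr h * a powr h" by (simp add: powr_add[symmetric])
  then have "sqrt (a powr (2 * h) * z) = a powr h * sqrt z" for z
    by (simp add: real_sqrt_mult)
  then show ?thesis by (simp add: Phi_def mult.assoc)
qed

lemma limit_variable_time_scale:
  assumes a: "a > 0"
  shows "limit_variable (\<lambda>t. A (a * t)) (\<lambda>t. B (a * t)) c \<omega> = limit_variable A B (c * a) \<omega>"
proof -
  have "a * real_of_ereal (Phi c (\<lambda>t. B (a * t) \<omega>) 1) = real_of_ereal (Phi (c * a) (\<lambda>t. B t \<omega>) 1)"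
    unfolding Phi_time_scale[OF a, of c "\<lambda>t. B t \<omega>" 1]
    using a by (cases "Phi (c * a) (\<lambda>t. B t \<omega>) 1") auto
  then show ?thesis unfolding limit_variable_def Let_def by simp
qed

lemma limit_variable_value_scale:
  assumes a: "a > 0"
  shows "limit_variable (\<lambda>t \<omega>. a powr h * A t \<omega>) (\<lambda>t \<omega>. a powr (2 * h) * B t \<omega>) c \<omega> =
         limit_variable A B (c * a powr h) \<omega>"
proof -
  have "a powr (2 * h) = a powr h * a powr h" by (simp add: powr_add[symmetric])
  then have "sqrt (a powr (2 * h) * z) = a powr h * sqrt z" for z
    by (simp add: real_sqrt_mult)
  then show ?thesis using a by (simp add: limit_variable_def Let_def Phi_value_scale)
qed

lemma cadlag_cmult: "cadlag y \<Longrightarrow> cadlag (\<lambda>t. c * y t)"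
  by (rule cadlag_compose) (auto intro!: continuous_intros)

context functional_limit
begin

lemma limit_variable_measurable: "limit_variable Y1 Y2 c \<in> borel_measurable N"
proof -
  have "path_statistic Y1 Y2 c \<in> borel_measurable N"
    by (intro borel_measurable_path_statistic Y_measurable)
  then show ?thesis
    by (rule measurable_cong[THEN iffD1, rotated]) (simp add: path_statistic_cadlag Y_cadlag)
qed

lemma Phi_measurable: "(\<lambda>\<omega>. Phi c (\<lambda>t. Y2 t \<omega>) u) \<in> borel_measurable N"
proof -
  have "path_Phi Y2 c u \<in> borel_measurable N"
    by (intro borel_measurable_path_Phi Y_measurable)
  then show ?thesis
    by (rule measurable_cong[THEN iffD1, rotated]) (simp add: path_Phi_cadlag Y_cadlag)
qed

lemma scaled_measurable:
  assumes "a > 0" "0 \<le> t"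
  shows "Y1 (a * t) \<in> borel_measurable N" "Y2 (a * t) \<in> borel_measurable N"
    "(\<lambda>\<omega>. b * Y1 t \<omega>) \<in> borel_measurable N" "(\<lambda>\<omega>. b * Y2 t \<omega>) \<in> borel_measurable N"
  by (intro borel_measurable_times borel_measurable_const Y_measurable mult_nonneg_nonneg
      less_imp_le[OF assms(1)] assms(2))+

text \<open>Speeding up time by a turns c into c * a. Rescaling the values turns c into c * a powr h
  and otherwise cancels in the self-normalized ratio. Self-similarity equates the two laws.\<close>

lemma limit_variable_scale_law:
  assumes a: "a > 0"
  shows "distr N borel (limit_variable Y1 Y2 (c * a)) = distr N borel (limit_variable Y1 Y2 (c * a powr h))"
proof -
  let ?\<Psi> = "path_statistic (\<lambda>t p. fst (p t)) (\<lambda>t p. snd (p t)) c"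
  have \<Psi>: "?\<Psi> \<in> borel_measurable path_space"
    by (rule borel_measurable_path_statistic) (rule measurable_path_coordinates, assumption)+
  have "distr N borel (limit_variable Y1 Y2 (c * a)) =
    distr N borel (\<lambda>\<omega>. ?\<Psi> (\<lambda>t\<in>{0..}. (Y1 (a * t) \<omega>, Y2 (a * t) \<omega>)))"
  proof (rule distr_cong[OF refl refl])
    fix \<omega> assume \<omega>: "\<omega> \<in> space N"
    have "path_statistic (\<lambda>t. Y1 (a * t)) (\<lambda>t. Y2 (a * t)) c \<omega> = limit_variable Y1 Y2 (c * a) \<omega>"
      using path_statistic_cadlag[of "\<lambda>t. Y1 (a * t)" \<omega> "\<lambda>t. Y2 (a * t)" c]
        cadlag_scale[OF Y_cadlag(1)[OF \<omega>] a] cadlag_scale[OF Y_cadlag(2)[OF \<omega>] a]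
        limit_variable_time_scale[OF a] by simp
    then show "limit_variable Y1 Y2 (c * a) \<omega> = ?\<Psi> (\<lambda>t\<in>{0..}. (Y1 (a * t) \<omega>, Y2 (a * t) \<omega>))"
      using path_statistic_restrict[of c "\<lambda>t. Y1 (a * t)" \<omega> "\<lambda>t. Y2 (a * t)"] by simp
  qed
  also have "\<dots> = distr N borel (\<lambda>\<omega>. ?\<Psi> (\<lambda>t\<in>{0..}. (a powr h * Y1 t \<omega>, a powr (2 * h) * Y2 t \<omega>)))"
    by (rule process_law_transfer[OF self_similar[OF a] _ _ _ _ \<Psi>]) (use scaled_measurable a in auto)
  also have "\<dots> = distr N borel (limit_variable Y1 Y2 (c * a powr h))"
  proof (rule distr_cong[OF refl refl])
    fix \<omega> assume \<omega>: "\<omega> \<in> space N"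
    have "path_statistic (\<lambda>t \<omega>. a powr h * Y1 t \<omega>) (\<lambda>t \<omega>. a powr (2 * h) * Y2 t \<omega>) c \<omega> = limit_variable Y1 Y2 (c * a powr h) \<omega>"
      using path_statistic_cadlag[of "\<lambda>t \<omega>. a powr h * Y1 t \<omega>" \<omega> "\<lambda>t \<omega>. a powr (2 * h) * Y2 t \<omega>" c]
        cadlag_cmult[OF Y_cadlag(1)[OF \<omega>]] cadlag_cmult[OF Y_cadlag(2)[OF \<omega>]]
        limit_variable_value_scale[OF a] by simp
    then show "?\<Psi> (\<lambda>t\<in>{0..}. (a powr h * Y1 t \<omega>, a powr (2 * h) * Y2 t \<omega>)) = limit_variable Y1 Y2 (c * a powr h) \<omega>"
      using path_statistic_restrict[of c "\<lambda>t \<omega>. a powr h * Y1 t \<omega>" \<omega> "\<lambda>t \<omega>. a powr (2 * h) * Y2 t \<omega>"] by simp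
  qed
  finally show ?thesis .
qed

text \<open>Since h < 1, the map sending a to c * a powr (h - 1) is onto the positive reals; the
  witness solves for c'.\<close>

lemma scale_factor:
  assumes "c > 0" "c' > 0"
  obtains a where "a > 0" "(c / a) * a powr h = c'"
proof
  define a where "a = (c / c') powr (1 / (1 - h))"
  show "a > 0" using assms by (simp add: a_def)
  have "a powr (h - 1) = (c / c') powr (1 / (1 - h) * (h - 1))"
    by (simp add: a_def powr_powr)
  also have "1 / (1 - h) * (h - 1) = - 1" using h_bounds by (simp add: field_simps)
  also have "(c / c') powr - 1 = c' / c" using assms by (simp add: powr_minus)
  finally have "a powr (h - 1) = c' / c" .
  moreover have "a powr (h - 1) = a powr h / a" using \<open>a > 0\<close> by (simp add: powr_diff)
  ultimately show "(c / a) * a powr h = c'" using assms \<open>a > 0\<close> by (simp add: field_simps)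
qed

lemma limit_variable_law:
  assumes "c > 0" "c' > 0"
  shows "distr N borel (limit_variable Y1 Y2 c) = distr N borel (limit_variable Y1 Y2 c')"
proof -
  obtain a where a: "a > 0" "(c / a) * a powr h = c'" using scale_factor[OF assms] .
  then show ?thesis using limit_variable_scale_law[OF a(1), of "c / a"] by simp
qed

text \<open>For the right a, dividing the time for c by a gives a variable with the law of the time
  for c = 1, so its positivity transfers.\<close>

lemma Phi_pos_scale:
  assumes pos: "AE \<omega> in N. Phi 1 (\<lambda>t. Y2 t \<omega>) 1 > 0" and c: "c > 0"
  shows "AE \<omega> in N. Phi c (\<lambda>t. Y2 t \<omega>) 1 > 0"
proof -
  obtain a where a: "a > 0" "(c / a) * a powr h = 1" using scale_factor[OF c, of 1] by auto
  let ?\<Psi> = "path_Phi (\<lambda>t p. snd (p t)) (c / a) 1"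
  have \<Psi>: "?\<Psi> \<in> borel_measurable path_space"
    by (rule borel_measurable_path_Phi) (rule measurable_path_coordinates, assumption)
  have 1: "?\<Psi> (\<lambda>t\<in>{0..}. (Y1 (a * t) \<omega>, Y2 (a * t) \<omega>)) = Phi c (\<lambda>t. Y2 t \<omega>) 1 / ereal a" if "\<omega> \<in> space N" for \<omega>
    using path_Phi_restrict[of "c / a" 1 "\<lambda>t. Y1 (a * t)" \<omega> "\<lambda>t. Y2 (a * t)"]
      path_Phi_cadlag[of "\<lambda>t. Y2 (a * t)", OF cadlag_scale[OF Y_cadlag(2)[OF that] a(1)]]
      Phi_time_scale[OF a(1), of "c / a" "\<lambda>t. Y2 t \<omega>" 1] a(1) by simp
  have 2: "?\<Psi> (\<lambda>t\<in>{0..}. (a powr h * Y1 t \<omega>, a powr (2 * h) * Y2 t \<omega>)) = Phi 1 (\<lambda>t. Y2 t \<omega>) 1" if "\<omega> \<in> space N" for \<omega>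
    using path_Phi_restrict[of "c / a" 1 "\<lambda>t \<omega>. a powr h * Y1 t \<omega>" \<omega> "\<lambda>t \<omega>. a powr (2 * h) * Y2 t \<omega>"]
      path_Phi_cadlag[of "\<lambda>t \<omega>. a powr (2 * h) * Y2 t \<omega>", OF cadlag_cmult[OF Y_cadlag(2)[OF that]]]
      Phi_value_scale[of "c / a" a h "\<lambda>t. Y2 t \<omega>" 1] a(2) by simp
  have "distr N borel (\<lambda>\<omega>. Phi c (\<lambda>t. Y2 t \<omega>) 1 / ereal a) =
    distr N borel (\<lambda>\<omega>. ?\<Psi> (\<lambda>t\<in>{0..}. (Y1 (a * t) \<omega>, Y2 (a * t) \<omega>)))"
    by (rule distr_cong) (simp_all add: 1)
  also have "\<dots> = distr N borel (\<lambda>\<omega>. ?\<Psi> (\<lambda>t\<in>{0..}. (a powr h * Y1 t \<omega>, a powr (2 * h) * Y2 t \<omega>)))"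
    by (rule process_law_transfer[OF self_similar[OF a(1)] _ _ _ _ \<Psi>]) (use scaled_measurable a in auto)
  also have "\<dots> = distr N borel (\<lambda>\<omega>. Phi 1 (\<lambda>t. Y2 t \<omega>) 1)"
    by (rule distr_cong) (simp_all add: 2)
  finally have eq: "distr N borel (\<lambda>\<omega>. Phi c (\<lambda>t. Y2 t \<omega>) 1 / ereal a) = distr N borel (\<lambda>\<omega>. Phi 1 (\<lambda>t. Y2 t \<omega>) 1)" .
  have "AE x in distr N borel (\<lambda>\<omega>. Phi 1 (\<lambda>t. Y2 t \<omega>) 1). 0 < x"
    using pos by (subst AE_distr_iff[OF Phi_measurable]) auto
  then have "AE \<omega> in N. 0 < Phi c (\<lambda>t. Y2 t \<omega>) 1 / ereal a"
    unfolding eq[symmetric] by (subst (asm) AE_distr_iff) (use Phi_measurable[of c 1] in auto)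
  then show ?thesis
  proof eventually_elim
    case (elim \<omega>)
    then show ?case using a(1) by (cases "Phi c (\<lambda>t. Y2 t \<omega>) 1") (auto simp: zero_less_divide_iff)
  qed
qed

lemma prob_boundary_scale:
  assumes a: "a > 0"
  shows "measure N {\<omega> \<in> space N. a \<le> c * sqrt (Y2 a \<omega>)} =
         measure N {\<omega> \<in> space N. a powr (1 - h) \<le> c * sqrt (Y2 1 \<omega>)}"
proof -
  have "(\<lambda>p. snd (p 1)) \<in> borel_measurable path_space" by (rule measurable_path_coordinates) simp
  from process_law_transfer[OF self_similar[OF a] _ _ _ _ this]
  have eq: "distr N borel (Y2 a) = distr N borel (\<lambda>\<omega>. a powr (2 * h) * Y2 1 \<omega>)"
    using scaled_measurable[OF a] by simp
  have [measurable]: "Y2 a \<in> borel_measurable N" "Y2 1 \<in> borel_measurable N"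
    using Y_measurable a by auto
  define S where "S = {z. a \<le> c * sqrt z}"
  have S: "S \<in> sets borel" unfolding S_def by measurable
  have "a powr (2 * h) = a powr h * a powr h" by (simp add: powr_add[symmetric])
  then have sq: "sqrt (a powr (2 * h) * z) = a powr h * sqrt z" for z
    by (simp add: real_sqrt_mult)
  have iff: "a \<le> c * (a powr h * w) \<longleftrightarrow> a powr (1 - h) \<le> c * w" for w
    using a by (simp add: powr_diff field_simps)
  have "{\<omega> \<in> space N. a \<le> c * sqrt (Y2 a \<omega>)} = Y2 a -` S \<inter> space N" by (auto simp: S_def)
  then have "measure N {\<omega> \<in> space N. a \<le> c * sqrt (Y2 a \<omega>)} = measure (distr N borel (Y2 a)) S"
    using S by (simp add: measure_distr)
  also have "\<dots> = measure N ((\<lambda>\<omega>. a powr (2 * h) * Y2 1 \<omega>) -` S \<inter> space N)"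
    unfolding eq using S by (intro measure_distr) auto
  also have "(\<lambda>\<omega>. a powr (2 * h) * Y2 1 \<omega>) -` S \<inter> space N =
      {\<omega> \<in> space N. a powr (1 - h) \<le> c * sqrt (Y2 1 \<omega>)}"
    by (auto simp: S_def sq iff)
  finally show ?thesis .
qed

text \<open>On the event of an infinite time the path stays on or above the line at every positive
  integer a. By self-similarity that has the probability of a powr (1 - h) <= c * sqrt (Y2 1), which
  vanishes as a grows because h < 1.\<close>

lemma Phi_finite: "AE \<omega> in N. Phi c (\<lambda>t. Y2 t \<omega>) 1 < \<infinity>"
proof -
  define a where "a n = real (Suc n)" for n
  have a: "a n > 0" for n by (simp add: a_def)
  define D where "D n = {\<omega> \<in> space N. a n powr (1 - h) \<le> c * sqrt (Y2 1 \<omega>)}" for n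
  have [measurable]: "Y2 (a n) \<in> borel_measurable N" "Y2 1 \<in> borel_measurable N" for n
    using Y_measurable a[of n] by auto
  have D [measurable]: "D n \<in> sets N" for n unfolding D_def by measurable
  have "a m powr (1 - h) \<le> a n powr (1 - h)" if "m \<le> n" for m n
    using that h_bounds by (intro powr_mono2) (auto simp: a_def)
  then have "decseq D"
    unfolding decseq_def D_def using order_trans by blast
  then have "(\<lambda>n. measure N (D n)) \<longlonglongrightarrow> measure N (\<Inter>n. D n)"
    by (intro Y.finite_Lim_measure_decseq) auto
  moreover have "\<exists>n. \<omega> \<notin> D n" for \<omega>
  proof -
    define w where "w = max 0 (c * sqrt (Y2 1 \<omega>)) + 1"
    obtain n where n: "w powr (1 / (1 - h)) < real n" using reals_Archimedean2 by blast
    then have "(w powr (1 / (1 - h))) powr (1 - h) < a n powr (1 - h)"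
      using h_bounds by (intro powr_less_mono2) (auto simp: a_def)
    then have "w < a n powr (1 - h)"
      using h_bounds by (simp add: powr_powr w_def)
    then show ?thesis by (intro exI[of _ n]) (auto simp: w_def D_def)
  qed
  then have "(\<Inter>n. D n) = {}" by blast
  ultimately have lim: "(\<lambda>n. measure N (D n)) \<longlonglongrightarrow> 0" by simp
  define I where "I = {\<omega> \<in> space N. Phi c (\<lambda>t. Y2 t \<omega>) 1 = \<infinity>}"
  have Is: "I \<in> sets N" unfolding I_def using Phi_measurable[of c 1] by measurable
  have "I \<subseteq> {\<omega> \<in> space N. a n \<le> c * sqrt (Y2 (a n) \<omega>)}" for n
  proof
    fix \<omega> assume "\<omega> \<in> I"
    then show "\<omega> \<in> {\<omega> \<in> space N. a n \<le> c * sqrt (Y2 (a n) \<omega>)}"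
      using le_of_less_Phi[OF a, of n c "\<lambda>t. Y2 t \<omega>" 1] by (simp add: I_def)
  qed
  moreover have "{\<omega> \<in> space N. a n \<le> c * sqrt (Y2 (a n) \<omega>)} \<in> sets N" for n
    by measurable
  ultimately have "measure N I \<le> measure N (D n)" for n
    unfolding D_def prob_boundary_scale[OF a, symmetric] by (intro Y.finite_measure_mono)
  then have "measure N I \<le> 0"
    by (intro LIMSEQ_le_const[OF lim]) auto
  then have "I \<in> null_sets N"
    using Is by (simp add: null_sets_def Y.emeasure_eq_measure measure_le_0_iff)
  then show ?thesis
    by (rule AE_I') (auto simp: I_def)
qed

end

section \<open>Predictability of the hitting time\<close>

lemma Phi_less_rational_iff:
  assumes "cadlag y"
  shows "Phi c y u < t \<longleftrightarrow> (\<exists>q\<in>\<rat>. 0 < q \<and> ereal q < t \<and> c * (sqrt (y q) / q) < u)"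
  unfolding Phi_rational[OF assms] INF_less_iff by (auto split: if_splits)

context functional_limit
begin

abbreviation \<F> :: "real \<Rightarrow> 'b measure" where
  "\<F> \<equiv> usual_augmentation N (natural_filtration N Y1 Y2)"

abbreviation pre_sets :: "real \<Rightarrow> 'b set set" where
  "pre_sets s \<equiv> sigma_sets (space N) (natural_filtration N Y1 Y2 s \<union> null_sets (completion N))"

lemma natural_filtration_Pow: "natural_filtration N Y1 Y2 s \<subseteq> Pow (space N)"
proof
  fix A assume "A \<in> natural_filtration N Y1 Y2 s"
  then have "A \<subseteq> space N"
    unfolding natural_filtration_def by (rule sigma_sets_into_sp[rotated]) auto
  then show "A \<in> Pow (space N)" ..
qed

lemma sigma_algebra_pre_sets: "sigma_algebra (space N) (pre_sets s)"
proof (rule sigma_algebra_sigma_sets)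
  have "null_sets (completion N) \<subseteq> Pow (space N)"
    using sets.sets_into_space[of _ "completion N"] by auto
  then show "natural_filtration N Y1 Y2 s \<union> null_sets (completion N) \<subseteq> Pow (space N)"
    using natural_filtration_Pow by simp
qed

lemma space_augmentation: "space (\<F> t) = space N"
  unfolding usual_augmentation_def by (simp add: space_measure_of_conv)

lemma sets_augmentationI:
  assumes "\<And>s. t < s \<Longrightarrow> A \<in> pre_sets s"
  shows "A \<in> sets (\<F> t)"
proof -
  have "(\<Inter>s\<in>{t<..}. pre_sets s) \<subseteq> Pow (space N)"
  proof
    interpret sigma_algebra "space N" "pre_sets (t + 1)" by (rule sigma_algebra_pre_sets)
    fix B assume "B \<in> (\<Inter>s\<in>{t<..}. pre_sets s)"
    then have "B \<in> pre_sets (t + 1)" by simp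
    then show "B \<in> Pow (space N)"
      using space_closed by blast
  qed
  then show ?thesis
    unfolding usual_augmentation_def using assms by (simp add: sets_measure_of sigma_sets.Basic)
qed

text \<open>A strict crossing before t has a rational witness before t, so the event depends on
  countably many values of \<open>Y2\<close> up to time s.\<close>

lemma Phi_less_in_pre_sets:
  assumes s: "0 \<le> s" "t \<le> s"
  shows "{\<omega> \<in> space N. Phi c (\<lambda>t. Y2 t \<omega>) u < ereal t} \<in> pre_sets s"
proof -
  interpret sigma_algebra "space N" "pre_sets s" by (rule sigma_algebra_pre_sets)
  have "{\<omega> \<in> space N. Phi c (\<lambda>t. Y2 t \<omega>) u < ereal t} =
    {\<omega> \<in> space N. \<exists>q\<in>\<rat> \<inter> {0<..<t}. c * (sqrt (Y2 q \<omega>) / q) < u}"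
    using Phi_less_rational_iff[OF Y_cadlag(2), of _ c u "ereal t"] by (intro Collect_cong conj_cong refl) force
  also have "\<dots> \<in> pre_sets s"
  proof (rule sets_Collect_countable_Ex')
    fix q assume q: "q \<in> \<rat> \<inter> {0<..<t}"
    have "{z. c * (sqrt z / q) < u} \<in> sets borel" by measurable
    moreover have "{\<omega> \<in> space N. c * (sqrt (Y2 q \<omega>) / q) < u} = Y2 q -` {z. c * (sqrt z / q) < u} \<inter> space N"
      by auto
    ultimately have "{\<omega> \<in> space N. c * (sqrt (Y2 q \<omega>) / q) < u} \<in> {Y2 q -` B \<inter> space N | B. B \<in> sets borel}"
      by blast
    then have "{\<omega> \<in> space N. c * (sqrt (Y2 q \<omega>) / q) < u} \<in> natural_filtration N Y1 Y2 s"
      unfolding natural_filtration_def using q s by (intro sigma_sets.Basic UN_I[of q] UnI2) simp_all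
    then show "{\<omega> \<in> space N. c * (sqrt (Y2 q \<omega>) / q) < u} \<in> pre_sets s"
      by (intro sigma_sets.Basic UnI1)
  qed (rule countable_Int1[OF countable_rat])
  finally show ?thesis .
qed

text \<open>The infimum need not be attained, so that it is at most t may be seen only just after t.
  The right limit built into the augmentation absorbs this, and its null sets absorb the
  redefinition on \<open>Nn\<close>.\<close>

lemma stopping_time_Phi:
  assumes null: "Nn \<in> null_sets N"
    and fin: "\<And>\<omega>. \<omega> \<in> space N \<Longrightarrow> \<omega> \<notin> Nn \<Longrightarrow> Phi c (\<lambda>t. Y2 t \<omega>) u < \<infinity>"
  shows "stopping_time \<F> (\<lambda>\<omega>. if \<omega> \<in> Nn then 0 else real_of_ereal (Phi c (\<lambda>t. Y2 t \<omega>) u))"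
    (is "stopping_time _ ?\<sigma>")
  unfolding stopping_time_def
proof
  fix t :: real
  have "{\<omega> \<in> space N. ?\<sigma> \<omega> \<le> t} \<in> sets (\<F> t)"
  proof (cases "0 \<le> t")
    case False
    show ?thesis
    proof -
      have "0 \<le> ?\<sigma> \<omega>" for \<omega> by (simp add: real_of_ereal_pos Phi_nonneg)
      then have "\<not> ?\<sigma> \<omega> \<le> t" for \<omega> using False by (meson order_trans)
      then have "{\<omega> \<in> space N. ?\<sigma> \<omega> \<le> t} = {}" by blast
      then show ?thesis by (simp only: sets.empty_sets)
    qed
  next
    case t: True
    show ?thesis
    proof (rule sets_augmentationI)
      fix s assume s: "t < s"
      interpret sigma_algebra "space N" "pre_sets s" by (rule sigma_algebra_pre_sets)
      \<comment> \<open>These thresholds decrease to t, and the cap at s keeps their events in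
        \<open>pre_sets s\<close>.\<close>
      define b where "b m = min s (t + inverse (real (Suc m)))" for m
      have b: "t < b m" "b m \<le> s" for m using s by (auto simp: b_def)
      have "Phi c y u \<le> ereal t \<longleftrightarrow> (\<forall>m. Phi c y u < ereal (b m))" for y
      proof
        assume "Phi c y u \<le> ereal t"
        then show "\<forall>m. Phi c y u < ereal (b m)" using b by (auto intro: le_less_trans)
      next
        assume H: "\<forall>m. Phi c y u < ereal (b m)"
        show "Phi c y u \<le> ereal t"
        proof (rule dense_ge)
          fix z assume "ereal t < z"
          then obtain r where r: "ereal t < ereal r" "ereal r < z" using ereal_dense2 by blast
          then obtain m where "inverse (real (Suc m)) < r - t" using reals_Archimedean[of "r - t"] by auto
          then have "b m \<le> r" by (simp add: b_def)
          then have "Phi c y u < ereal r" using H[rule_format, of m] by (auto intro: less_le_trans)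
          with r show "Phi c y u \<le> z" by simp
        qed
      qed
      then have "{\<omega> \<in> space N. Phi c (\<lambda>t. Y2 t \<omega>) u \<le> ereal t} =
          {\<omega> \<in> space N. \<forall>m. Phi c (\<lambda>t. Y2 t \<omega>) u < ereal (b m)}" by simp
      also have "\<dots> \<in> pre_sets s"
        using b t s by (intro sets_Collect_countable_All Phi_less_in_pre_sets) auto
      finally have 1: "{\<omega> \<in> space N. Phi c (\<lambda>t. Y2 t \<omega>) u \<le> ereal t} \<in> pre_sets s" .
      have 2: "Nn \<in> pre_sets s"
        using null by (intro sigma_sets.Basic UnI2 null_sets_completionI)
      have "Nn \<subseteq> space N" using null sets.sets_into_space by auto
      moreover have "real_of_ereal (Phi c (\<lambda>t. Y2 t \<omega>) u) \<le> t \<longleftrightarrow> Phi c (\<lambda>t. Y2 t \<omega>) u \<le> ereal t"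
        if "\<omega> \<in> space N" "\<omega> \<notin> Nn" for \<omega>
        using fin[OF that] Phi_nonneg[of c "\<lambda>t. Y2 t \<omega>" u]
        by (cases "Phi c (\<lambda>t. Y2 t \<omega>) u") auto
      ultimately have "{\<omega> \<in> space N. ?\<sigma> \<omega> \<le> t} =
          Nn \<union> ({\<omega> \<in> space N. Phi c (\<lambda>t. Y2 t \<omega>) u \<le> ereal t} - Nn)"
        using t by auto
      with 1 2 show "{\<omega> \<in> space N. ?\<sigma> \<omega> \<le> t} \<in> pre_sets s" by auto
    qed
  qed
  then show "Measurable.pred (\<F> t) (\<lambda>\<omega>. ?\<sigma> \<omega> \<le> t)"
    unfolding pred_def space_augmentation by simp
qed

text \<open>The times \<open>Phi c _ (1 + 1 / (n + 1))\<close> announce \<open>Phi c _ 1\<close>: they increase to it by continuity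
  of \<open>Phi\<close> at 1, and strictly, since both being equal to \<open>\<tau>\<close> would give \<open>c * sqrt (Y2 \<tau>) = u * \<tau>\<close> for two
  different \<open>u\<close>.\<close>

lemma Y1_continuous_at_Phi:
  assumes c: "c > 0"
    and pos: "AE \<omega> in N. Phi c (\<lambda>t. Y2 t \<omega>) 1 > 0"
    and cont: "AE \<omega> in N. isCont (Phi c (\<lambda>t. Y2 t \<omega>)) 1"
  shows "AE \<omega> in N. left_lim (\<lambda>t. Y1 t \<omega>) (real_of_ereal (Phi c (\<lambda>t. Y2 t \<omega>) 1)) =
    Y1 (real_of_ereal (Phi c (\<lambda>t. Y2 t \<omega>) 1)) \<omega>"
proof -
  have "AE \<omega> in N. Phi c (\<lambda>t. Y2 t \<omega>) 1 > 0 \<and> Phi c (\<lambda>t. Y2 t \<omega>) 1 < \<infinity> \<and>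
      isCont (Phi c (\<lambda>t. Y2 t \<omega>)) 1 \<and> (\<forall>t>0. left_lim (\<lambda>s. Y2 s \<omega>) t \<le> Y2 t \<omega>)" (is "AE \<omega> in N. ?P \<omega>")
    using pos cont Phi_finite[of c] Y2_no_neg_jumps by eventually_elim simp
  \<comment> \<open>One measurable null set collects all exceptions; the times are set to 0 on it,
    so that they are finite wherever they are read through \<open>real_of_ereal\<close>.\<close>
  then obtain Nn where Nn: "{\<omega> \<in> space N. \<not> ?P \<omega>} \<subseteq> Nn" "emeasure N Nn = 0" "Nn \<in> sets N"
    by (rule AE_E)
  then have null: "Nn \<in> null_sets N" by blast
  have P: "?P \<omega>" if "\<omega> \<in> space N" "\<omega> \<notin> Nn" for \<omega>
    using that Nn(1) by blast
  define \<sigma> where "\<sigma> u \<omega> = (if \<omega> \<in> Nn then 0 else real_of_ereal (Phi c (\<lambda>t. Y2 t \<omega>) u))" for u \<omega>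
  have fin: "Phi c (\<lambda>t. Y2 t \<omega>) u < \<infinity>" if "1 \<le> u" "\<omega> \<in> space N" "\<omega> \<notin> Nn" for u \<omega>
    using P[OF that(2,3)] Phi_antimono[OF that(1), of c "\<lambda>t. Y2 t \<omega>"] by (auto intro: le_less_trans)
  have stop: "stopping_time \<F> (\<sigma> u)" if "1 \<le> u" for u
    unfolding \<sigma>_def by (rule stopping_time_Phi[OF null]) (rule fin[OF that])
  have nonneg: "0 \<le> \<sigma> u \<omega>" for u \<omega>
    by (simp add: \<sigma>_def real_of_ereal_pos Phi_nonneg)
  have eq: "Phi c (\<lambda>t. Y2 t \<omega>) u = ereal (\<sigma> u \<omega>)" if "1 \<le> u" "\<omega> \<in> space N" "\<omega> \<notin> Nn" for u \<omega>
    using fin[OF that] Phi_nonneg[of c "\<lambda>t. Y2 t \<omega>" u] that(3) unfolding \<sigma>_def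
    by (cases "Phi c (\<lambda>t. Y2 t \<omega>) u") auto
  define u where "u n = 1 + inverse (real (Suc n))" for n
  have u1: "1 < u n" for n by (simp add: u_def)
  have u_lim: "u \<longlonglongrightarrow> 1"
    unfolding u_def using tendsto_add[OF tendsto_const LIMSEQ_inverse_real_of_nat, of 1] by simp
  have good: "incseq (\<lambda>n. \<sigma> (u n) \<omega>) \<and> (\<lambda>n. \<sigma> (u n) \<omega>) \<longlonglongrightarrow> \<sigma> 1 \<omega> \<and>
      (\<sigma> 1 \<omega> > 0 \<longrightarrow> (\<forall>n. \<sigma> (u n) \<omega> < \<sigma> 1 \<omega>))" if \<omega>: "\<omega> \<in> space N" "\<omega> \<notin> Nn" for \<omega>
  proof (intro conjI impI allI)
    have mono: "\<sigma> v' \<omega> \<le> \<sigma> v \<omega>" if "1 \<le> v" "v \<le> v'" for v v'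
      using Phi_antimono[OF that(2), of c "\<lambda>t. Y2 t \<omega>"] eq[OF _ \<omega>, of v] eq[OF _ \<omega>, of v'] that by simp
    show "incseq (\<lambda>n. \<sigma> (u n) \<omega>)"
      unfolding incseq_def
    proof (intro allI impI mono)
      fix m n :: nat assume "m \<le> n"
      then show "u n \<le> u m" by (simp add: u_def le_imp_inverse_le)
    qed (rule less_imp_le[OF u1])
    have "(\<lambda>n. Phi c (\<lambda>t. Y2 t \<omega>) (u n)) \<longlonglongrightarrow> Phi c (\<lambda>t. Y2 t \<omega>) 1"
      using P[OF \<omega>] u_lim isCont_tendsto_compose by blast
    then show "(\<lambda>n. \<sigma> (u n) \<omega>) \<longlonglongrightarrow> \<sigma> 1 \<omega>"
      using eq[OF less_imp_le[OF u1] \<omega>] eq[OF order_refl \<omega>] by simp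
    fix n assume s1: "0 < \<sigma> 1 \<omega>"
    have jump: "left_lim (\<lambda>t. Y2 t \<omega>) (\<sigma> 1 \<omega>) \<le> Y2 (\<sigma> 1 \<omega>) \<omega>" using P[OF \<omega>] s1 by blast
    note att = Phi_attained(1)[OF Y_cadlag(2)[OF \<omega>(1)] Y2_nonneg[OF _ \<omega>(1)] c _ s1 jump]
    have "\<sigma> (u n) \<omega> \<noteq> \<sigma> 1 \<omega>"
    proof
      assume "\<sigma> (u n) \<omega> = \<sigma> 1 \<omega>"
      then have "c * sqrt (Y2 (\<sigma> 1 \<omega>) \<omega>) = u n * \<sigma> 1 \<omega>"
        using eq[OF less_imp_le[OF u1] \<omega>, of n] by (intro att) simp_all
      moreover have "c * sqrt (Y2 (\<sigma> 1 \<omega>) \<omega>) = 1 * \<sigma> 1 \<omega>"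
        using eq[OF order_refl \<omega>] by (intro att) simp_all
      ultimately have "u n = 1" using s1 by simp
      then show False using u1[of n] by simp
    qed
    then show "\<sigma> (u n) \<omega> < \<sigma> 1 \<omega>" using mono[of 1 "u n"] u1[of n] by simp
  qed
  have "finite_predictable_time N \<F> (\<sigma> 1)"
    unfolding finite_predictable_time_def
  proof (intro conjI exI[of _ "\<lambda>n. \<sigma> (u n)"] allI ballI)
    show "AE \<omega> in N. incseq (\<lambda>n. \<sigma> (u n) \<omega>) \<and> (\<lambda>n. \<sigma> (u n) \<omega>) \<longlonglongrightarrow> \<sigma> 1 \<omega> \<and>
      (\<sigma> 1 \<omega> > 0 \<longrightarrow> (\<forall>n. \<sigma> (u n) \<omega> < \<sigma> 1 \<omega>))"
      by (rule AE_I'[OF null]) (use good in blast)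
  qed (use stop nonneg less_imp_le[OF u1] in auto)
  then have "AE \<omega> in N. Y1 (\<sigma> 1 \<omega>) \<omega> - left_lim (\<lambda>t. Y1 t \<omega>) (\<sigma> 1 \<omega>) = 0"
    using Y1_qlc unfolding quasi_left_continuous_def by blast
  moreover have "AE \<omega> in N. \<omega> \<notin> Nn"
    using null by (rule AE_not_in)
  ultimately show ?thesis
    by eventually_elim (simp add: \<sigma>_def)
qed

end

section \<open>Stopped paths\<close>

lemma stop_nat_eq_Least:
  assumes "\<exists>n. real n > \<epsilon> powr (- \<nu>) \<and> c * sqrt (Z (real n) \<omega> / (real n)^2) < \<epsilon>"
  shows "stop_nat Z \<nu> c \<epsilon> \<omega> = (LEAST n. real n > \<epsilon> powr (- \<nu>) \<and> c * sqrt (Z (real n) \<omega> / (real n)^2) < \<epsilon>)"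
proof -
  have "Inf (enat ` {n. P n}) = enat (LEAST n. P n)" if "\<exists>n. P n" for P
  proof (rule antisym)
    show "Inf (enat ` {n. P n}) \<le> enat (LEAST n. P n)"
      using LeastI_ex[OF that] by (intro Inf_lower) auto
    show "enat (LEAST n. P n) \<le> Inf (enat ` {n. P n})"
      by (intro Inf_greatest) (auto intro: Least_le)
  qed
  from this[OF assms] show ?thesis
    unfolding stop_nat_def stop_time_def by simp
qed

text \<open>On the event of never stopping, the time is the fixed value
  \<open>the_enat \<infinity>\<close>; elsewhere it is the least index among measurable
  events.\<close>

lemma stop_nat_measurable:
  assumes "\<And>t. 0 \<le> t \<Longrightarrow> Z t \<in> borel_measurable M"
  shows "stop_nat Z \<nu> c \<epsilon> \<in> measurable M (count_space UNIV)"
proof -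
  have [measurable]: "Z (real n) \<in> borel_measurable M" for n using assms by simp
  define P where "P n \<omega> \<longleftrightarrow> real n > \<epsilon> powr (- \<nu>) \<and> c * sqrt (Z (real n) \<omega> / (real n)^2) < \<epsilon>" for n \<omega>
  have [measurable]: "Measurable.pred M (P n)" for n unfolding P_def by measurable
  have "stop_nat Z \<nu> c \<epsilon> \<omega> = (if \<exists>n. P n \<omega> then LEAST n. P n \<omega> else the_enat \<infinity>)" for \<omega>
  proof (cases "\<exists>n. P n \<omega>")
    case True
    then show ?thesis using stop_nat_eq_Least[of \<epsilon> \<nu> c Z \<omega>] unfolding P_def by simp
  next
    case False
    then have "{n. real n > \<epsilon> powr (- \<nu>) \<and> c * sqrt (Z (real n) \<omega> / (real n)^2) < \<epsilon>} = {}"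
      unfolding P_def by blast
    then have "stop_nat Z \<nu> c \<epsilon> \<omega> = the_enat \<infinity>"
      unfolding stop_nat_def stop_time_def by (simp only: image_empty Inf_empty top_enat_def)
    then show ?thesis using False by simp
  qed
  then have "stop_nat Z \<nu> c \<epsilon> = (\<lambda>\<omega>. if \<exists>n. P n \<omega> then LEAST n. P n \<omega> else the_enat \<infinity>)" by blast
  also have "\<dots> \<in> measurable M (count_space UNIV)" by measurable
  finally show ?thesis .
qed

text \<open>Both sides carry the factor (1 / a) powr h * l. In the scaled picture the rule at level
  \<epsilon> is the crossing of a line with slope \<epsilon> * (a powr (1 - h) * l), and a is chosen
  so that this slope tends to 1.\<close>

lemma scaled_boundary_iff:
  fixes a l n z c \<epsilon> h :: real
  assumes "a > 0" "l > 0" "n > 0"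
  shows "c * ((1 / a) powr h * l * sqrt z) < \<epsilon> * (a powr (1 - h) * l) * (n / a) \<longleftrightarrow> c * sqrt (z / n^2) < \<epsilon>"
proof -
  define k where "k = (1 / a) powr h * l"
  have k: "k > 0" using assms by (simp add: k_def)
  have "a powr (1 - h) = (1 / a) powr h * a"
    using assms by (simp add: powr_diff powr_divide)
  then have "\<epsilon> * (a powr (1 - h) * l) * (n / a) = k * (\<epsilon> * n)"
    using assms by (simp add: k_def)
  moreover have "c * ((1 / a) powr h * l * sqrt z) = k * (c * sqrt z)" by (simp add: k_def)
  moreover have "c * sqrt (z / n^2) < \<epsilon> \<longleftrightarrow> c * sqrt z < \<epsilon> * n"
    using assms by (simp add: real_sqrt_divide field_simps)
  ultimately show ?thesis using mult_less_cancel_left_pos[OF k] by metis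
qed

text \<open>The distribution function is at least p to the right of the quantile and at most p to
  its left; continuity equates the two. That p is strictly between 0 and 1 makes the set under
  \<open>Inf\<close> nonempty and bounded below.\<close>

lemma cdf_quantile:
  assumes M: "real_distribution M" and p: "0 < p" "p < 1" and cont: "isCont (cdf M) (quantile (cdf M) p)"
  shows "cdf M (quantile (cdf M) p) = p"
proof -
  interpret real_distribution M by fact
  define q where "q = quantile (cdf M) p"
  have "\<forall>\<^sub>F x in at_top. p < cdf M x" by (rule order_tendstoD(1)[OF cdf_lim_at_top_prob p(2)])
  then obtain x1 where "p < cdf M x1" by (auto simp: eventually_at_top_linorder)
  then have ne: "{x. p \<le> cdf M x} \<noteq> {}" by (auto intro: less_imp_le)
  have "\<forall>\<^sub>F x in at_bot. cdf M x < p" by (rule order_tendstoD(2)[OF cdf_lim_at_bot p(1)])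
  then obtain x2 where x2: "\<And>x. x \<le> x2 \<Longrightarrow> cdf M x < p" by (auto simp: eventually_at_bot_linorder)
  have bdd: "bdd_below {x. p \<le> cdf M x}"
  proof (rule bdd_belowI[of _ x2])
    fix x assume "x \<in> {x. p \<le> cdf M x}"
    then show "x2 \<le> x" using x2[of x] by (cases "x \<le> x2") auto
  qed
  have cont: "isCont (cdf M) q" using cont by (simp add: q_def)
  have "p \<le> cdf M q"
  proof (rule tendsto_lowerbound)
    show "(cdf M \<longlongrightarrow> cdf M q) (at_right q)"
      using cont by (simp add: isCont_def filterlim_at_split)
    have "p \<le> cdf M x" if "q < x" for x
    proof -
      have "Inf {x. p \<le> cdf M x} < x" using that by (simp add: q_def quantile_def)
      then obtain y where "p \<le> cdf M y" "y < x" using cInf_lessD[OF ne] by auto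
      then show ?thesis using cdf_nondecreasing[of y x] by simp
    qed
    then show "\<forall>\<^sub>F x in at_right q. p \<le> cdf M x"
      by (simp add: eventually_at_filter)
  qed simp
  moreover have "cdf M q \<le> p"
  proof (rule tendsto_upperbound)
    show "(cdf M \<longlongrightarrow> cdf M q) (at_left q)"
      using cont by (simp add: isCont_def filterlim_at_split)
    have "cdf M x \<le> p" if "x < q" for x
    proof (rule ccontr)
      assume "\<not> cdf M x \<le> p"
      then have "q \<le> x" unfolding q_def quantile_def by (intro cInf_lower bdd) simp
      with that show False by simp
    qed
    then show "\<forall>\<^sub>F x in at_left q. cdf M x \<le> p"
      by (simp add: eventually_at_filter)
  qed simp
  ultimately show ?thesis by (simp add: q_def)
qed

section \<open>From converging scaled paths to converging stopped statistics\<close>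

context functional_limit
begin

text \<open>Truncation at 1 makes every \<open>a n\<close> positive and changes only finitely many
  terms. The last claim compares the starting index \<epsilon> powr (- \<nu>) with the time
  scale.\<close>

lemma time_scale:
  fixes e :: "nat \<Rightarrow> real"
  assumes Ainv: "asymptotic_inverse (\<lambda>x. x powr (1 - h) * L x) Ainv"
    and nu: "0 < \<nu>" "\<nu> < 1 / (1 - h)"
    and e: "\<And>n. e n > 0" "e \<longlonglongrightarrow> 0"
  defines "a \<equiv> \<lambda>n. max 1 (Ainv (1 / e n))"
  shows "filterlim a at_top sequentially"
    and "\<forall>\<^sub>F n in sequentially. a n = Ainv (1 / e n)"
    and "\<forall>\<^sub>F n in sequentially. 0 < L (a n)"
    and "(\<lambda>n. e n * (a n powr (1 - h) * L (a n))) \<longlonglongrightarrow> 1"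
    and "(\<lambda>n. e n powr (- \<nu>) / a n) \<longlonglongrightarrow> 0"
proof -
  have inv: "filterlim (\<lambda>n. 1 / e n) at_top sequentially"
    using filterlim_inverse_at_top[OF e(2)] e(1) by (simp add: inverse_eq_divide)
  have Ai: "filterlim (\<lambda>n. Ainv (1 / e n)) at_top sequentially"
    using Ainv filterlim_compose[OF _ inv] by (auto simp: asymptotic_inverse_def)
  have "\<forall>\<^sub>F n in sequentially. 1 \<le> Ainv (1 / e n)"
    using Ai unfolding filterlim_at_top by blast
  then show eq: "\<forall>\<^sub>F n in sequentially. a n = Ainv (1 / e n)"
    by eventually_elim (simp add: a_def)
  show a: "filterlim a at_top sequentially"
    by (rule filterlim_at_top_mono[OF Ai]) (simp add: a_def)
  show Lp: "\<forall>\<^sub>F n in sequentially. 0 < L (a n)"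
    by (rule eventually_compose_filterlim[OF L_pos a])
  have a1: "1 \<le> a n" for n by (simp add: a_def)
  define g where "g x = x powr (1 - h) * L x" for x
  have "((\<lambda>x. if g (Ainv x) = 0 \<and> x = 0 then 1 else g (Ainv x) / x) \<longlongrightarrow> 1) at_top"
    using asymp_equivD[of "\<lambda>x. g (Ainv x)" at_top "\<lambda>x. x"] Ainv
    unfolding asymptotic_inverse_def g_def by blast
  from filterlim_compose[OF this inv]
  have "(\<lambda>n. e n * g (Ainv (1 / e n))) \<longlonglongrightarrow> 1"
    using e(1) by (simp add: less_imp_neq[THEN not_sym] mult.commute)
  moreover have "\<forall>\<^sub>F n in sequentially. e n * g (Ainv (1 / e n)) = e n * g (a n)"
    using eq by eventually_elim simp
  ultimately have u: "(\<lambda>n. e n * g (a n)) \<longlonglongrightarrow> 1"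
    by (rule Lim_transform_eventually)
  then show "(\<lambda>n. e n * (a n powr (1 - h) * L (a n))) \<longlonglongrightarrow> 1"
    by (simp add: g_def)
  have "((\<lambda>x. g x powr \<nu> / x) \<longlongrightarrow> 0) at_top"
    unfolding g_def by (rule powr_scale_negligible[OF L_slowly_varying L_pos h_bounds(2) nu])
  \<comment> \<open>Dividing by (e n * g (a n)) powr \<nu>, which tends to 1, trades g (a n) for 1 /
    e n.\<close>
  from filterlim_compose[OF this a]
  have "(\<lambda>n. (g (a n) powr \<nu> / a n) / (e n * g (a n)) powr \<nu>) \<longlonglongrightarrow> 0 / 1 powr \<nu>"
    by (intro tendsto_divide tendsto_powr u tendsto_const) auto
  moreover have "\<forall>\<^sub>F n in sequentially. (g (a n) powr \<nu> / a n) / (e n * g (a n)) powr \<nu> = e n powr (- \<nu>) / a n"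
    using Lp
  proof eventually_elim
    case (elim n)
    have "g (a n) > 0" using elim a1[of n] by (simp add: g_def)
    then have G: "g (a n) powr \<nu> \<noteq> 0" and m: "(e n * g (a n)) powr \<nu> = e n powr \<nu> * g (a n) powr \<nu>"
      using e(1)[of n] by (simp_all add: powr_mult)
    show ?case unfolding m powr_minus using G by (simp add: divide_inverse mult_ac)
  qed
  ultimately have "(\<lambda>n. e n powr (- \<nu>) / a n) \<longlonglongrightarrow> 0 / 1 powr \<nu>"
    by (rule Lim_transform_eventually)
  then show "(\<lambda>n. e n powr (- \<nu>) / a n) \<longlonglongrightarrow> 0" by simp
qed

lemma terminal_statistic_measurable: "terminal_statistic Z1 Z2 \<mu> \<nu> c \<epsilon> \<in> borel_measurable M"
proof -
  have [measurable]: "Z1 (real n) \<in> borel_measurable M" "Z2 (real n) \<in> borel_measurable M" for n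
    using Z_measurable by auto
  have "(\<lambda>\<omega>. (\<lambda>n \<omega>. (Z1 (real n) \<omega> - real n * \<mu>) / sqrt (Z2 (real n) \<omega>)) (stop_nat Z2 \<nu> c \<epsilon> \<omega>) \<omega>) \<in> borel_measurable M"
    by (rule measurable_compose_countable[OF _ stop_nat_measurable[OF Z_measurable(2)]]) measurable
  then show ?thesis by (simp add: terminal_statistic_def[abs_def] Let_def)
qed

lemma coverage_event_measurable: "{\<omega> \<in> space M. \<mu> \<in> confidence_interval Z1 Z2 \<nu> cl cu \<epsilon> \<omega>} \<in> sets M"
proof -
  have [measurable]: "Z1 (real n) \<in> borel_measurable M" "Z2 (real n) \<in> borel_measurable M" for n
    using Z_measurable by auto
  have "Measurable.pred M (\<lambda>\<omega>. (\<lambda>n \<omega>. Z1 (real n) \<omega> / real n - cu * sqrt (Z2 (real n) \<omega> / (real n)^2) \<le> \<mu> \<and>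
      \<mu> \<le> Z1 (real n) \<omega> / real n - cl * sqrt (Z2 (real n) \<omega> / (real n)^2)) (stop_nat Z2 \<nu> (cu - cl) \<epsilon> \<omega>) \<omega>)"
    by (rule measurable_compose_countable[OF _ stop_nat_measurable[OF Z_measurable(2)]]) measurable
  then show ?thesis by (simp add: confidence_interval_def Let_def pred_def)
qed

text \<open>A property of a sequence of samples, so that limits of events can be discussed pathwise.
  The positivity clause keeps the zero-denominator conventions away, which the coverage event needs
  in addition to the limit of the statistic.\<close>

definition stops_near :: "real \<Rightarrow> real \<Rightarrow> 'b \<Rightarrow> (nat \<Rightarrow> real) \<Rightarrow> (nat \<Rightarrow> 'a) \<Rightarrow> bool" where
  "stops_near \<nu> c \<omega>' \<epsilon> \<omega> \<longleftrightarrow>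
     (\<forall>\<^sub>F k in sequentially. 0 < stop_nat Z2 \<nu> c (\<epsilon> k) (\<omega> k) \<and> 0 < Z2 (real (stop_nat Z2 \<nu> c (\<epsilon> k) (\<omega> k))) (\<omega> k)) \<and>
     (\<lambda>k. terminal_statistic Z1 Z2 \<mu> \<nu> c (\<epsilon> k) (\<omega> k)) \<longlonglongrightarrow> limit_variable Y1 Y2 c \<omega>'"

definition early_event :: "(real \<Rightarrow> real) \<Rightarrow> real \<Rightarrow> real \<Rightarrow> real \<Rightarrow> real \<Rightarrow> 'a set" where
  "early_event a \<nu> K \<eta> \<epsilon> = {\<omega> \<in> space M.
     (INF n\<in>{n::nat. \<epsilon> powr (- \<nu>) \<le> real n \<and> real n \<le> \<eta> * a \<epsilon>}. ereal (sqrt (Z2 (real n) \<omega>) / real n)) \<le> ereal (K * \<epsilon>)}"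

lemma early_event_measurable: "early_event a \<nu> K \<eta> \<epsilon> \<in> sets M"
proof -
  have [measurable]: "Z2 (real n) \<in> borel_measurable M" for n
    using Z_measurable by auto
  have "(\<lambda>\<omega>. INF n\<in>{n::nat. \<epsilon> powr (- \<nu>) \<le> real n \<and> real n \<le> \<eta> * a \<epsilon>}. ereal (sqrt (Z2 (real n) \<omega>) / real n)) \<in> borel_measurable M"
    by (rule borel_measurable_INF) auto
  then show ?thesis unfolding early_event_def by measurable
qed

definition scaled1 :: "real \<Rightarrow> 'a \<Rightarrow> real \<Rightarrow> real" where
  "scaled1 \<epsilon> \<omega> = (\<lambda>t. \<epsilon> powr h * L (1 / \<epsilon>) * (Z1 (t / \<epsilon>) \<omega> - t / \<epsilon> * \<mu>))"

definition scaled2 :: "real \<Rightarrow> 'a \<Rightarrow> real \<Rightarrow> real" where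
  "scaled2 \<epsilon> \<omega> = (\<lambda>t. \<epsilon> powr h * L (1 / \<epsilon>) * sqrt (Z2 (t / \<epsilon>) \<omega>))"

text \<open>The deterministic core: the scaled hitting times converge to \<tau>, both limit paths
  are continuous there, so both scaled coordinates converge at the stopped time and their common
  scale factor cancels in the ratio.\<close>

lemma stops_nearI:
  fixes e a :: "nat \<Rightarrow> real" and \<omega> :: "nat \<Rightarrow> 'a"
  assumes c: "c > 0" and \<omega>': "\<omega>' \<in> space N"
    and \<tau>: "0 < Phi c (\<lambda>t. Y2 t \<omega>') 1" "Phi c (\<lambda>t. Y2 t \<omega>') 1 < \<infinity>"
    and cont: "isCont (Phi c (\<lambda>t. Y2 t \<omega>')) 1"
    and jump: "\<forall>t>0. left_lim (\<lambda>t. Y2 t \<omega>') t \<le> Y2 t \<omega>'"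
    and Y1c: "left_lim (\<lambda>t. Y1 t \<omega>') (real_of_ereal (Phi c (\<lambda>t. Y2 t \<omega>') 1)) =
      Y1 (real_of_ereal (Phi c (\<lambda>t. Y2 t \<omega>') 1)) \<omega>'"
    and \<omega>: "\<And>k. \<omega> k \<in> space M" and e: "\<And>k. e k > 0" and a1: "\<And>k. a k > 0"
    and a: "filterlim a at_top sequentially"
    and Lp: "\<forall>\<^sub>F k in sequentially. 0 < L (a k)"
    and u: "(\<lambda>k. e k * (a k powr (1 - h) * L (a k))) \<longlonglongrightarrow> 1"
    and r: "(\<lambda>k. e k powr (- \<nu>) / a k) \<longlonglongrightarrow> 0"
    and X1: "graph_conv (\<lambda>k. scaled1 (1 / a k) (\<omega> k)) (\<lambda>t. Y1 t \<omega>')"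
    and X2: "graph_conv (\<lambda>k. scaled2 (1 / a k) (\<omega> k)) (\<lambda>t. sqrt (Y2 t \<omega>'))"
    and \<eta>: "\<eta> > 0"
    and late: "\<forall>\<^sub>F k in sequentially. \<forall>n. e k powr (- \<nu>) < real n \<longrightarrow>
        c * sqrt (Z2 (real n) (\<omega> k) / (real n)^2) < e k \<longrightarrow> \<eta> * a k < real n"
  shows "stops_near \<nu> c \<omega>' e \<omega>"
proof -
  define \<tau> where "\<tau> = real_of_ereal (Phi c (\<lambda>t. Y2 t \<omega>') 1)"
  have Phi: "Phi c (\<lambda>t. Y2 t \<omega>') 1 = ereal \<tau>" and pos: "\<tau> > 0"
    using \<tau> unfolding \<tau>_def by (cases "Phi c (\<lambda>t. Y2 t \<omega>') 1"; simp)+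
  note cl2 = Y_cadlag(2)[OF \<omega>'] and nn2 = Y2_nonneg[OF _ \<omega>']
  have att: "c * sqrt (Y2 \<tau> \<omega>') = 1 * \<tau>" "left_lim (\<lambda>t. Y2 t \<omega>') \<tau> = Y2 \<tau> \<omega>'"
    using jump pos by (intro Phi_attained[OF cl2 nn2 c Phi pos]; simp)+
  have sq: "sqrt (Y2 \<tau> \<omega>') > 0"
    by (rule zero_less_mult_pos[OF _ c]) (use att(1) pos in simp)
  define T where "T k = stop_nat Z2 \<nu> c (e k) (\<omega> k)" for k
  define u' where "u' k = e k * (a k powr (1 - h) * L (a k))" for k
  define X where "X k = scaled2 (1 / a k) (\<omega> k)" for k
  define P where "P k n \<longleftrightarrow> real n > e k powr (- \<nu>) \<and> c * sqrt (Z2 (real n) (\<omega> k) / (real n)^2) < e k" for k n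
  define K where "K k n \<longleftrightarrow> e k powr (- \<nu>) < real n \<and> c * X k (real n / a k) < u' k * (real n / a k)" for k n
  \<comment> \<open>An index exceeding e k powr (- \<nu>) >= 0 is positive, as the equivalence of
    the scaled and the original rule requires.\<close>
  have KP: "\<forall>\<^sub>F k in sequentially. K k = P k"
    using Lp
  proof (eventually_elim, intro ext)
    fix k n assume l: "0 < L (a k)"
    show "K k n = P k n"
    proof (cases "e k powr (- \<nu>) < real n")
      case True
      then have "0 < real n" using le_less_trans[OF powr_ge_zero] by blast
      from scaled_boundary_iff[OF a1[of k] l this, of c h "Z2 (real n) (\<omega> k)" "e k"]
      show ?thesis using True a1[of k] by (simp add: K_def P_def X_def u'_def scaled2_def)
    qed (simp add: K_def P_def)
  qed
  have late': "\<forall>\<^sub>F k in sequentially. \<forall>n. K k n \<longrightarrow> \<eta> * a k < real n"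
    using late KP by eventually_elim (simp add: P_def)
  have "\<forall>\<^sub>F k in sequentially. (\<exists>n. K k n) \<longrightarrow> T k = (LEAST n. K k n)"
    using KP
  proof eventually_elim
    case (elim k)
    show ?case unfolding elim using stop_nat_eq_Least[of "e k" \<nu> c Z2 "\<omega> k"] by (auto simp: P_def T_def)
  qed
  note hit' = hitting_time_tendsto[OF cl2 nn2 c Phi pos cont X2[folded X_def] a u[folded u'_def] r \<eta> K_def late' this]
  have hit: "\<forall>\<^sub>F k in sequentially. K k (T k)" "(\<lambda>k. real (T k) / a k) \<longlonglongrightarrow> \<tau>"
    by (rule hit', assumption)+
  have XT: "(\<lambda>k. X k (real (T k) / a k)) \<longlonglongrightarrow> sqrt (Y2 \<tau> \<omega>')"
  proof (rule graph_conv_tendsto[OF X2[folded X_def] pos _ hit(2)])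
    show "left_lim (\<lambda>t. sqrt (Y2 t \<omega>')) \<tau> = sqrt (Y2 \<tau> \<omega>')"
      using left_lim_compose[OF cl2, of sqrt \<tau>] att(2) continuous_on_real_sqrt[OF continuous_on_id] by simp
  qed
  have X1T: "(\<lambda>k. scaled1 (1 / a k) (\<omega> k) (real (T k) / a k)) \<longlonglongrightarrow> Y1 \<tau> \<omega>'"
    by (rule graph_conv_tendsto[OF X1 pos _ hit(2)]) (use Y1c in \<open>simp add: \<tau>_def\<close>)
  have quot: "\<forall>\<^sub>F k in sequentially. scaled1 (1 / a k) (\<omega> k) (real (T k) / a k) / X k (real (T k) / a k) =
      terminal_statistic Z1 Z2 \<mu> \<nu> c (e k) (\<omega> k)"
    using Lp
  proof eventually_elim
    case (elim k)
    have "(1 / a k) powr h * L (a k) \<noteq> 0" using elim a1[of k] by simp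
    then show ?case using a1[of k]
      by (simp add: scaled1_def scaled2_def X_def terminal_statistic_def T_def Let_def)
  qed
  have "(\<lambda>k. scaled1 (1 / a k) (\<omega> k) (real (T k) / a k) / X k (real (T k) / a k)) \<longlonglongrightarrow> Y1 \<tau> \<omega>' / sqrt (Y2 \<tau> \<omega>')"
    using sq by (intro tendsto_divide X1T XT) simp
  then have "(\<lambda>k. terminal_statistic Z1 Z2 \<mu> \<nu> c (e k) (\<omega> k)) \<longlonglongrightarrow> Y1 \<tau> \<omega>' / sqrt (Y2 \<tau> \<omega>')"
    by (rule Lim_transform_eventually[OF _ quot])
  then have lim: "(\<lambda>k. terminal_statistic Z1 Z2 \<mu> \<nu> c (e k) (\<omega> k)) \<longlonglongrightarrow> limit_variable Y1 Y2 c \<omega>'"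
    by (simp add: limit_variable_def Let_def \<tau>_def)
  have "\<forall>\<^sub>F k in sequentially. 0 < X k (real (T k) / a k)"
    by (rule order_tendstoD(1)[OF XT sq])
  with hit(1) Lp have "\<forall>\<^sub>F k in sequentially. 0 < T k \<and> 0 < Z2 (real (T k)) (\<omega> k)"
  proof eventually_elim
    case (elim k)
    have "0 < real (T k)" using elim(1) le_less_trans[OF powr_ge_zero] unfolding K_def by blast
    moreover have "0 < Z2 (real (T k)) (\<omega> k)"
    proof -
      have "0 < (1 / a k) powr h * L (a k)" using elim(2) a1[of k] by simp
      moreover have "0 < (1 / a k) powr h * L (a k) * sqrt (Z2 (real (T k)) (\<omega> k))"
        using elim(3) a1[of k] by (simp add: X_def scaled2_def)
      ultimately have "0 < sqrt (Z2 (real (T k)) (\<omega> k))" by (rule zero_less_mult_pos[rotated])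
      then show ?thesis by simp
    qed
    ultimately show ?case by simp
  qed
  with lim show ?thesis by (simp add: stops_near_def T_def)
qed

text \<open>Half of \<open>d\<close> pays for the early event \<open>Q\<close>, with \<eta> fixed
  before \<epsilon> tends to 0. Off \<open>Q\<close> every index that meets the rule exceeds \<eta>
  * a, and the mapping argument applied to \<open>E n - Q \<eta> (e n)\<close> costs the other
  half.\<close>

lemma eventually_prob_less_of_stopping:
  assumes Ainv: "asymptotic_inverse (\<lambda>x. x powr (1 - h) * L x) Ainv"
    and nu: "0 < \<nu>" "\<nu> < 1 / (1 - h)"
    and early: "no_early_stopping M Z2 (\<lambda>\<epsilon>. Ainv (1 / \<epsilon>)) \<nu>"
    and c: "c > 0"
    and pos: "AE \<omega> in N. Phi c (\<lambda>t. Y2 t \<omega>) 1 > 0"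
    and cont: "AE \<omega> in N. isCont (Phi c (\<lambda>t. Y2 t \<omega>)) 1"
    and e: "\<And>n. e n > 0" "e \<longlonglongrightarrow> 0"
    and E: "\<And>n. E n \<in> sets M" and E': "E' \<in> sets N"
    and closed: "\<And>\<omega>' nk \<omega>. \<omega>' \<in> space N \<Longrightarrow> (\<And>k. \<omega> k \<in> E (nk k)) \<Longrightarrow>
        stops_near \<nu> c \<omega>' (\<lambda>k. e (nk k)) \<omega> \<Longrightarrow> \<omega>' \<in> E'"
    and d: "d > 0"
  shows "\<forall>\<^sub>F n in sequentially. measure M (E n) < measure N E' + d"
proof -
  define a where "a n = max 1 (Ainv (1 / e n))" for n
  note ts = time_scale[OF Ainv nu e, folded a_def]
  have a1: "a n > 0" for n by (simp add: a_def)
  \<comment> \<open>The rule c * sqrt (Z2 n) / n < \<epsilon> reads sqrt (Z2 n) / n < \<epsilon> /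
    c, whence K = 1 / c.\<close>
  define Q where "Q \<eta> \<epsilon> = early_event (\<lambda>\<epsilon>. Ainv (1 / \<epsilon>)) \<nu> (1 / c) \<eta> \<epsilon>" for \<eta> \<epsilon>
  have Qm: "Q \<eta> \<epsilon> \<in> sets M" for \<eta> \<epsilon> unfolding Q_def by (rule early_event_measurable)
  have e_right: "filterlim e (at_right 0) sequentially"
    unfolding filterlim_at using e by (auto simp: less_imp_neq[THEN not_sym])
  have "((\<lambda>\<eta>. Limsup (at_right 0) (\<lambda>\<epsilon>. ereal (measure M (Q \<eta> \<epsilon>)))) \<longlongrightarrow> 0) (at_right 0)"
  proof -
    have "0 < 1 / c" using c by simp
    from early[unfolded no_early_stopping_def, rule_format, OF this]
    show ?thesis unfolding Q_def early_event_def .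
  qed
  then have "\<forall>\<^sub>F \<eta> in at_right 0. Limsup (at_right 0) (\<lambda>\<epsilon>. ereal (measure M (Q \<eta> \<epsilon>))) < ereal (d / 2)"
    by (rule order_tendstoD(2)) (use d in simp)
  with eventually_at_right_less[of 0]
  have "\<forall>\<^sub>F \<eta> in at_right 0. 0 < \<eta> \<and> Limsup (at_right 0) (\<lambda>\<epsilon>. ereal (measure M (Q \<eta> \<epsilon>))) < ereal (d / 2)"
    by eventually_elim simp
  then obtain \<eta> where \<eta>: "0 < \<eta>" "Limsup (at_right 0) (\<lambda>\<epsilon>. ereal (measure M (Q \<eta> \<epsilon>))) < ereal (d / 2)"
    using eventually_happens'[OF trivial_limit_at_right_real] by blast
  have "\<forall>\<^sub>F \<epsilon> in at_right 0. ereal (measure M (Q \<eta> \<epsilon>)) < ereal (d / 2)"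
    by (rule Limsup_lessD[OF \<eta>(2)])
  from eventually_compose_filterlim[OF this e_right]
  have Q_small: "\<forall>\<^sub>F n in sequentially. measure M (Q \<eta> (e n)) < d / 2" by simp
  \<comment> \<open>The functional limit is used at scale 1 / a n, not at the accuracy level e
    n.\<close>
  define V where "V n \<omega> = peak_code (scaled1 (1 / a n) \<omega>, scaled2 (1 / a n) \<omega>)" for n \<omega>
  define V' where "V' \<omega> = peak_code ((\<lambda>t. Y1 t \<omega>), (\<lambda>t. sqrt (Y2 t \<omega>)))" for \<omega>
  have sqrt_cadlag: "cadlag (\<lambda>t. sqrt (y t))" if "cadlag y" for y
    by (rule cadlag_compose[OF that continuous_on_real_sqrt[OF continuous_on_id]])
  have Vm: "V n \<in> borel_measurable M" for n
    unfolding V_def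
  proof (rule borel_measurable_peak_code)
    fix \<omega> assume \<omega>: "\<omega> \<in> space M"
    have z: "cadlag (\<lambda>t. Z1 (t / (1 / a n)) \<omega>)" "cadlag (\<lambda>t. Z2 (t / (1 / a n)) \<omega>)"
      using cadlag_scale[OF Z_cadlag(1)[OF \<omega>] a1[of n]] cadlag_scale[OF Z_cadlag(2)[OF \<omega>] a1[of n]]
      by (simp_all add: mult.commute)
    show "cadlag (\<lambda>t. scaled2 (1 / a n) \<omega> t)"
      unfolding scaled2_def by (rule cadlag_cmult[OF sqrt_cadlag[OF z(2)]])
    have "cadlag (\<lambda>t. Z1 (t / (1 / a n)) \<omega> - t / (1 / a n) * \<mu>)"
      unfolding cadlag_def
    proof (intro conjI allI impI)
      fix t :: real
      show "continuous (at_right t) (\<lambda>t. Z1 (t / (1 / a n)) \<omega> - t / (1 / a n) * \<mu>)" if "0 \<le> t"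
        using cadlag_tendsto_right[OF z(1) that] a1[of n] unfolding continuous_within by (intro tendsto_intros) auto
      have "((\<lambda>t. Z1 (t / (1 / a n)) \<omega> - t / (1 / a n) * \<mu>) \<longlongrightarrow>
          left_lim (\<lambda>t. Z1 (t / (1 / a n)) \<omega>) t - t / (1 / a n) * \<mu>) (at_left t)" if "0 < t"
        using cadlag_tendsto_left_lim[OF z(1) that] a1[of n] by (intro tendsto_intros) auto
      then show "\<exists>l. ((\<lambda>t. Z1 (t / (1 / a n)) \<omega> - t / (1 / a n) * \<mu>) \<longlongrightarrow> l) (at_left t)" if "0 < t"
        using that by blast
    qed
    then show "cadlag (\<lambda>t. scaled1 (1 / a n) \<omega> t)"
      unfolding scaled1_def by (rule cadlag_cmult)
  next
    fix t :: real assume "0 \<le> t"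
    then have [measurable]: "Z1 (t / (1 / a n)) \<in> borel_measurable M" "Z2 (t / (1 / a n)) \<in> borel_measurable M"
      by (intro Z_measurable divide_nonneg_nonneg; use a1[of n] in simp)+
    show "(\<lambda>\<omega>. scaled1 (1 / a n) \<omega> t) \<in> borel_measurable M" "(\<lambda>\<omega>. scaled2 (1 / a n) \<omega> t) \<in> borel_measurable M"
      unfolding scaled1_def scaled2_def by measurable
  qed
  have "(\<lambda>\<omega>. sqrt (Y2 t \<omega>)) \<in> borel_measurable N" if "0 \<le> t" for t
  proof -
    have [measurable]: "Y2 t \<in> borel_measurable N" by (rule Y_measurable(2)[OF that])
    show ?thesis by measurable
  qed
  then have V'm: "V' \<in> borel_measurable N"
    unfolding V'_def by (intro borel_measurable_peak_code Y_measurable Y_cadlag sqrt_cadlag)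
  have conv: "(\<lambda>n. \<integral>\<omega>. f (V n \<omega>) \<partial>M) \<longlonglongrightarrow> (\<integral>\<omega>. f (V' \<omega>) \<partial>N)"
    if f: "continuous_on UNIV f" "\<And>v. \<bar>f v\<bar> \<le> 1" for f :: "_ \<Rightarrow> real"
  proof -
    have "bounded ((\<lambda>x. f (peak_code x)) ` ({x. cadlag x} \<times> {x. cadlag x}))"
      by (rule boundedI[of _ 1]) (use f(2) in auto)
    with WM2_continuous_peak_code[OF f(1)]
    have "WM2_continuous (\<lambda>x. f (peak_code x)) \<and>
        bounded ((\<lambda>x. f (peak_code x)) ` ({x. cadlag x} \<times> {x. cadlag x}))" ..
    from weak_limit[unfolded weak_conv_WM2_def, rule_format, OF this]
    have "((\<lambda>\<epsilon>. \<integral>\<omega>. f (peak_code (scaled1 \<epsilon> \<omega>, scaled2 \<epsilon> \<omega>)) \<partial>M) \<longlongrightarrow> (\<integral>\<omega>. f (V' \<omega>) \<partial>N)) (at_right 0)"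
      unfolding scaled1_def scaled2_def V'_def .
    moreover have "filterlim (\<lambda>n. 1 / a n) (at_right 0) sequentially"
      unfolding filterlim_at
      using a1 tendsto_inverse_0_at_top[OF ts(1)] by (auto simp: inverse_eq_divide less_imp_neq[THEN not_sym])
    ultimately show ?thesis unfolding V_def by (rule filterlim_compose)
  qed
  have good: "AE \<omega>' in N. \<forall>nk \<omega>k. filterlim nk at_top sequentially \<longrightarrow> (\<forall>k. \<omega>k k \<in> E (nk k) - Q \<eta> (e (nk k))) \<longrightarrow>
          (\<lambda>k. V (nk k) (\<omega>k k)) \<longlonglongrightarrow> V' \<omega>' \<longrightarrow> \<omega>' \<in> E'"
    using pos Phi_finite[of c] cont Y1_continuous_at_Phi[OF c pos cont] Y2_no_neg_jumps AE_space
  proof (eventually_elim, intro allI impI)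
    fix \<omega>' and nk :: "nat \<Rightarrow> nat" and \<omega> :: "nat \<Rightarrow> 'a"
    assume H: "0 < Phi c (\<lambda>t. Y2 t \<omega>') 1" "Phi c (\<lambda>t. Y2 t \<omega>') 1 < \<infinity>" "isCont (Phi c (\<lambda>t. Y2 t \<omega>')) 1"
      "left_lim (\<lambda>t. Y1 t \<omega>') (real_of_ereal (Phi c (\<lambda>t. Y2 t \<omega>') 1)) = Y1 (real_of_ereal (Phi c (\<lambda>t. Y2 t \<omega>') 1)) \<omega>'"
      "\<forall>t>0. left_lim (\<lambda>s. Y2 s \<omega>') t \<le> Y2 t \<omega>'" "\<omega>' \<in> space N"
      and nk: "filterlim nk at_top sequentially" and \<omega>: "\<forall>k. \<omega> k \<in> E (nk k) - Q \<eta> (e (nk k))"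
      and VV: "(\<lambda>k. V (nk k) (\<omega> k)) \<longlonglongrightarrow> V' \<omega>'"
    have \<omega>s: "\<omega> k \<in> space M" for k using \<omega> sets.sets_into_space[OF E] by blast
    note gc = peak_code_tendsto_imp_graph_conv[OF Y_cadlag(1)[OF H(6)] sqrt_cadlag[OF Y_cadlag(2)[OF H(6)]] VV[unfolded V_def V'_def]]
    have late: "\<forall>\<^sub>F k in sequentially. \<forall>n. e (nk k) powr (- \<nu>) < real n \<longrightarrow>
        c * sqrt (Z2 (real n) (\<omega> k) / (real n)^2) < e (nk k) \<longrightarrow> \<eta> * a (nk k) < real n"
      using eventually_compose_filterlim[OF ts(2) nk]
    proof (eventually_elim, intro allI impI)
      fix k n
      assume eq: "a (nk k) = Ainv (1 / e (nk k))" and n: "e (nk k) powr (- \<nu>) < real n"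
        and lt: "c * sqrt (Z2 (real n) (\<omega> k) / (real n)^2) < e (nk k)"
      show "\<eta> * a (nk k) < real n"
      proof (rule ccontr)
        assume "\<not> \<eta> * a (nk k) < real n"
        then have le: "real n \<le> \<eta> * Ainv (1 / e (nk k))" using eq by simp
        have n0: "0 < real n" using le_less_trans[OF powr_ge_zero n] .
        have "sqrt (Z2 (real n) (\<omega> k)) / real n < 1 / c * e (nk k)"
          using lt c n0 by (simp add: real_sqrt_divide field_simps)
        then have "(INF n\<in>{n::nat. e (nk k) powr (- \<nu>) \<le> real n \<and> real n \<le> \<eta> * Ainv (1 / e (nk k))}.
            ereal (sqrt (Z2 (real n) (\<omega> k)) / real n)) \<le> ereal (1 / c * e (nk k))"
          using n le by (intro INF_lower2[of n]) auto
        then have "\<omega> k \<in> Q \<eta> (e (nk k))"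
          using \<omega>s by (simp add: Q_def early_event_def)
        then show False using \<omega> by blast
      qed
    qed
    have "stops_near \<nu> c \<omega>' (\<lambda>k. e (nk k)) \<omega>"
      by (rule stops_nearI[OF c H(6) H(1-3) H(5) H(4) \<omega>s e(1) a1 filterlim_compose[OF ts(1) nk]
            eventually_compose_filterlim[OF ts(3) nk] filterlim_compose[OF ts(4) nk]
            filterlim_compose[OF ts(5) nk] gc \<eta>(1) late])
    then show "\<omega>' \<in> E'" using \<omega> by (intro closed[OF H(6), of \<omega> nk]) blast
  qed
  have "\<forall>\<^sub>F n in sequentially. measure M (E n - Q \<eta> (e n)) < measure N E' + d / 2"
    by (rule eventually_prob_less_of_closed_limit[OF Z.prob_space_axioms Y.prob_space_axioms Vm V'm conv _ E' good])
       (use E Qm d in auto)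
  with Q_small show ?thesis
  proof eventually_elim
    case (elim n)
    have "measure M (E n) \<le> measure M ((E n - Q \<eta> (e n)) \<union> Q \<eta> (e n))"
      using E Qm by (intro Z.finite_measure_mono) auto
    also have "\<dots> \<le> measure M (E n - Q \<eta> (e n)) + measure M (Q \<eta> (e n))"
      using E Qm by (intro measure_Un_le) auto
    finally show ?case using elim by simp
  qed
qed

end

lemma sets_Collect_in:
  assumes "f \<in> measurable M R" "B \<in> sets R"
  shows "{\<omega> \<in> space M. f \<omega> \<in> B} \<in> sets M"
proof -
  have "{\<omega> \<in> space M. f \<omega> \<in> B} = f -` B \<inter> space M" by auto
  then show ?thesis using measurable_sets[OF assms] by simp
qed

lemma measure_distr_Collect:
  assumes "f \<in> measurable M R" "B \<in> sets R"
  shows "measure (distr M R f) B = measure M {\<omega> \<in> space M. f \<omega> \<in> B}"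
proof -
  have "{\<omega> \<in> space M. f \<omega> \<in> B} = f -` B \<inter> space M" by auto
  then show ?thesis using measure_distr[OF assms] by simp
qed

section \<open>Convergence in distribution and asymptotic coverage\<close>

context functional_limit
begin

lemma stops_near_closed:
  assumes "closed B" "stops_near \<nu> c \<omega>' \<epsilon> \<omega>"
    and "\<And>k. terminal_statistic Z1 Z2 \<mu> \<nu> c (\<epsilon> k) (\<omega> k) \<in> B"
  shows "limit_variable Y1 Y2 c \<omega>' \<in> B"
  by (rule closed_sequentially[OF assms(1), of "\<lambda>k. terminal_statistic Z1 Z2 \<mu> \<nu> c (\<epsilon> k) (\<omega> k)"])
    (use assms(2,3) in \<open>simp_all add: stops_near_def\<close>)

text \<open>Positivity matters: with a zero denominator the statistic is 0 by convention, which says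
  nothing about the interval.\<close>

lemma coverage_iff:
  assumes "0 < stop_nat Z2 \<nu> (cu - cl) \<epsilon> \<omega>" "0 < Z2 (real (stop_nat Z2 \<nu> (cu - cl) \<epsilon> \<omega>)) \<omega>"
  shows "\<mu> \<in> confidence_interval Z1 Z2 \<nu> cl cu \<epsilon> \<omega> \<longleftrightarrow>
    terminal_statistic Z1 Z2 \<mu> \<nu> (cu - cl) \<epsilon> \<omega> \<in> {cl..cu}"
proof -
  define T where "T = real (stop_nat Z2 \<nu> (cu - cl) \<epsilon> \<omega>)"
  define s where "s = sqrt (Z2 T \<omega>)"
  have T: "T > 0" and s: "s > 0" using assms by (simp_all add: T_def s_def)
  have 1: "sqrt (Z2 T \<omega> / T\<^sup>2) = s / T" using T by (simp add: s_def real_sqrt_divide)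
  have "Z1 T \<omega> / T - b * (s / T) = (Z1 T \<omega> - b * s) / T" for b
    by (simp add: diff_divide_distrib)
  then have "Z1 T \<omega> / T - b * (s / T) \<le> \<mu> \<longleftrightarrow> (Z1 T \<omega> - T * \<mu>) / s \<le> b"
    "\<mu> \<le> Z1 T \<omega> / T - b * (s / T) \<longleftrightarrow> b \<le> (Z1 T \<omega> - T * \<mu>) / s" for b
    using T s by (simp_all add: pos_divide_le_eq pos_le_divide_eq algebra_simps)
  then show ?thesis
    unfolding confidence_interval_def terminal_statistic_def Let_def T_def[symmetric] 1
      s_def[symmetric] by auto
qed

lemma limit_variable_vimage:
  "B \<in> sets borel \<Longrightarrow> {\<omega> \<in> space N. limit_variable Y1 Y2 c \<omega> \<in> B} \<in> sets N"
  by (rule sets_Collect_in[OF limit_variable_measurable])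

lemma prob_limit_variable:
  "B \<in> sets borel \<Longrightarrow> measure N {\<omega> \<in> space N. limit_variable Y1 Y2 c \<omega> \<in> B} =
     measure (distr N borel (limit_variable Y1 Y2 c)) B"
  by (rule measure_distr_Collect[OF limit_variable_measurable, symmetric])

lemma real_distribution_limit_variable: "real_distribution (distr N borel (limit_variable Y1 Y2 c))"
  using limit_variable_measurable
  by (intro real_distribution.intro Y.prob_space_distr) (simp_all add: real_distribution_axioms_def)

text \<open>Upper bounds for the closed half-lines \<open>{..x}\<close> and \<open>{x..}\<close>
  suffice: at a continuity point of the limit distribution function the shared point x has no mass,
  so the second bound becomes a lower bound for the first.\<close>

lemma terminal_statistic_converges:
  assumes Ainv: "asymptotic_inverse (\<lambda>x. x powr (1 - h) * L x) Ainv"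
    and nu: "0 < \<nu>" "\<nu> < 1 / (1 - h)"
    and early: "no_early_stopping M Z2 (\<lambda>\<epsilon>. Ainv (1 / \<epsilon>)) \<nu>"
    and c: "c > 0"
    and pos: "AE \<omega> in N. Phi c (\<lambda>t. Y2 t \<omega>) 1 > 0"
    and cont: "AE \<omega> in N. isCont (Phi c (\<lambda>t. Y2 t \<omega>)) 1"
  shows "converges_in_distribution M (terminal_statistic Z1 Z2 \<mu> \<nu> c) N (limit_variable Y1 Y2 c)"
  unfolding converges_in_distribution_def
proof (intro conjI allI impI)
  fix e :: "nat \<Rightarrow> real" assume e: "(\<forall>n. e n > 0) \<and> e \<longlonglongrightarrow> 0"
  define W where "W = distr N borel (limit_variable Y1 Y2 c)"
  interpret W: real_distribution W unfolding W_def by (rule real_distribution_limit_variable)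
  define S where "S n = distr M borel (terminal_statistic Z1 Z2 \<mu> \<nu> c (e n))" for n
  have ub: "\<forall>\<^sub>F n in sequentially. measure (S n) B < measure W B + d" if "closed B" "d > 0" for B d
  proof -
    have B: "B \<in> sets borel" using that by simp
    have m: "{\<omega> \<in> space M. terminal_statistic Z1 Z2 \<mu> \<nu> c \<epsilon> \<omega> \<in> B} \<in> sets M" for \<epsilon>
      by (rule sets_Collect_in[OF terminal_statistic_measurable B])
    have eq: "measure (S n) B = measure M {\<omega> \<in> space M. terminal_statistic Z1 Z2 \<mu> \<nu> c (e n) \<omega> \<in> B}" for n
      unfolding S_def by (rule measure_distr_Collect[OF terminal_statistic_measurable B])
    show ?thesis
      unfolding eq W_def prob_limit_variable[OF B, symmetric]
    proof (rule eventually_prob_less_of_stopping[OF Ainv nu early c pos cont])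
      fix \<omega>' nk \<omega> assume "\<omega>' \<in> space N"
        "\<And>k. \<omega> k \<in> {\<omega> \<in> space M. terminal_statistic Z1 Z2 \<mu> \<nu> c (e (nk k)) \<omega> \<in> B}"
        "stops_near \<nu> c \<omega>' (\<lambda>k. e (nk k)) \<omega>"
      then show "\<omega>' \<in> {\<omega> \<in> space N. limit_variable Y1 Y2 c \<omega> \<in> B}"
        using stops_near_closed[OF that(1), of \<nu> c \<omega>' "\<lambda>k. e (nk k)" \<omega>] by simp
    qed (use e m limit_variable_vimage[OF B] that in auto)
  qed
  show "weak_conv_m (\<lambda>n. distr M borel (terminal_statistic Z1 Z2 \<mu> \<nu> c (e n))) (distr N borel (limit_variable Y1 Y2 c))"
    unfolding weak_conv_m_def weak_conv_def S_def[symmetric] W_def[symmetric]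
  proof (intro allI impI)
    fix x assume "isCont (cdf W) x"
    then have x0: "measure W {x} = 0" by (simp add: W.isCont_cdf)
    have Wx: "measure W {x..} = 1 - measure W {..x}"
    proof -
      have "measure W {x..} = measure W ({x} \<union> {x<..})" by (rule arg_cong[of _ _ "measure W"]) auto
      also have "\<dots> = measure W {x} + measure W {x<..}" by (intro W.finite_measure_Union) auto
      also have "{x<..} = space W - {..x}" by auto
      finally show ?thesis using x0 W.prob_compl[of "{..x}"] by simp
    qed
    have lb: "1 - measure (S n) {x..} \<le> measure (S n) {..x}" for n
    proof -
      interpret S: prob_space "S n"
        unfolding S_def by (rule Z.prob_space_distr[OF terminal_statistic_measurable])
      have "1 - measure (S n) {x..} = measure (S n) (space (S n) - {x..})"
        by (subst S.prob_compl) (simp_all add: S_def)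
      also have "\<dots> \<le> measure (S n) {..x}"
        by (rule S.finite_measure_mono) (auto simp: S_def)
      finally show ?thesis .
    qed
    show "(\<lambda>n. cdf (S n) x) \<longlonglongrightarrow> cdf W x"
      unfolding cdf_def
    proof (rule order_tendstoI)
      fix b assume "measure W {..x} < b"
      then show "\<forall>\<^sub>F n in sequentially. measure (S n) {..x} < b"
        using ub[of "{..x}" "b - measure W {..x}"] by simp
    next
      fix b assume "b < measure W {..x}"
      then have "\<forall>\<^sub>F n in sequentially. measure (S n) {x..} < measure W {x..} + (measure W {..x} - b)"
        by (intro ub) auto
      then show "\<forall>\<^sub>F n in sequentially. b < measure (S n) {..x}"
        by eventually_elim (use Wx lb in \<open>smt (verit)\<close>)
    qed
  qed
qed (rule terminal_statistic_measurable limit_variable_measurable)+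

text \<open>Coverage agrees with an event of the statistic only when the denominators are positive,
  so the stopping argument is run directly on the coverage event and on its complement instead of
  quoting convergence in distribution.\<close>

lemma coverage_converges:
  fixes \<delta> :: real
  defines "F \<equiv> cdf (distr N borel (limit_variable Y1 Y2 1))"
  assumes Ainv: "asymptotic_inverse (\<lambda>x. x powr (1 - h) * L x) Ainv"
    and nu: "0 < \<nu>" "\<nu> < 1 / (1 - h)"
    and early: "no_early_stopping M Z2 (\<lambda>\<epsilon>. Ainv (1 / \<epsilon>)) \<nu>"
    and c: "cl < cu"
    and pos: "AE \<omega> in N. Phi (cu - cl) (\<lambda>t. Y2 t \<omega>) 1 > 0"
    and cont: "AE \<omega> in N. isCont (Phi (cu - cl) (\<lambda>t. Y2 t \<omega>)) 1"
    and F: "isCont F cl" "isCont F cu" "F cl = \<delta> / 2" "F cu = 1 - \<delta> / 2"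
  shows "((\<lambda>\<epsilon>. measure M {\<omega> \<in> space M. \<mu> \<in> confidence_interval Z1 Z2 \<nu> cl cu \<epsilon> \<omega>}) \<longlongrightarrow> 1 - \<delta>) (at_right 0)"
proof (rule tendsto_at_right_sequentially[of 0 1])
  fix e :: "nat \<Rightarrow> real" assume e: "\<And>n. 0 < e n" "e \<longlonglongrightarrow> 0"
  define c where "c = cu - cl"
  have c0: "c > 0" using c by (simp add: c_def)
  note pos' = pos[folded c_def] and cont' = cont[folded c_def]
  define W where "W = distr N borel (limit_variable Y1 Y2 1)"
  interpret W: real_distribution W unfolding W_def by (rule real_distribution_limit_variable)
  \<comment> \<open>The quantiles refer to the law for c = 1, while the rule uses c = cu - cl; the
    laws coincide.\<close>
  have W: "W = distr N borel (limit_variable Y1 Y2 c)"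
    unfolding W_def by (rule limit_variable_law) (use c0 in auto)
  have FW: "F x = measure W {..x}" for x by (simp add: F_def W_def cdf_def)
  have null: "measure W {cl} = 0" "measure W {cu} = 0"
    using F(1,2) unfolding F_def W_def[symmetric] W.isCont_cdf by auto
  have in_W: "measure W {cl..cu} = 1 - \<delta>"
  proof -
    have "{cl..cu} = {cl} \<union> ({..cu} - {..cl})" using c by auto
    then have "measure W {cl..cu} = measure W {cl} + measure W ({..cu} - {..cl})"
      using W.finite_measure_Union[of "{cl}" "{..cu} - {..cl}"] by simp
    also have "measure W ({..cu} - {..cl}) = measure W {..cu} - measure W {..cl}"
      using c by (intro W.finite_measure_Diff) auto
    finally show ?thesis using null F by (simp add: FW)
  qed
  have out_W: "measure W ({..cl} \<union> {cu..}) = \<delta>"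
  proof -
    have "{..cl} \<union> {cu..} = {cl} \<union> ({cu} \<union> (space W - {cl..cu}))" using c by auto
    then have "measure W ({..cl} \<union> {cu..}) = measure W {cl} + (measure W {cu} + measure W (space W - {cl..cu}))"
      using c W.finite_measure_Union[of "{cl}" "{cu} \<union> (space W - {cl..cu})"]
        W.finite_measure_Union[of "{cu}" "space W - {cl..cu}"] by auto
    then show ?thesis using null in_W W.prob_compl[of "{cl..cu}"] by simp
  qed
  define C where "C n = {\<omega> \<in> space M. \<mu> \<in> confidence_interval Z1 Z2 \<nu> cl cu (e n) \<omega>}" for n
  have Cm: "C n \<in> sets M" for n unfolding C_def by (rule coverage_event_measurable)
  have near: "\<forall>\<^sub>F k in sequentially. \<omega> k \<in> C (nk k) \<longleftrightarrow> terminal_statistic Z1 Z2 \<mu> \<nu> c (e (nk k)) (\<omega> k) \<in> {cl..cu}"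
    if "stops_near \<nu> c \<omega>' (\<lambda>k. e (nk k)) \<omega>" "\<And>k. \<omega> k \<in> space M" for \<omega>' nk \<omega>
  proof -
    have "\<forall>\<^sub>F k in sequentially. 0 < stop_nat Z2 \<nu> c (e (nk k)) (\<omega> k) \<and> 0 < Z2 (real (stop_nat Z2 \<nu> c (e (nk k)) (\<omega> k))) (\<omega> k)"
      using that(1) by (simp add: stops_near_def)
    then show ?thesis
      by eventually_elim (use coverage_iff[of \<nu> cu cl] that(2) in \<open>simp add: C_def c_def\<close>)
  qed
  have ub: "\<forall>\<^sub>F n in sequentially. measure M (C n) < 1 - \<delta> + d" if d: "d > 0" for d
  proof -
    have B: "{cl..cu} \<in> sets borel" by simp
    have "\<forall>\<^sub>F n in sequentially. measure M (C n) < measure N {\<omega> \<in> space N. limit_variable Y1 Y2 c \<omega> \<in> {cl..cu}} + d"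
    proof (rule eventually_prob_less_of_stopping[OF Ainv nu early c0 pos' cont' e Cm limit_variable_vimage[OF B] _ d])
      fix \<omega>' nk \<omega> assume H: "\<omega>' \<in> space N" "\<And>k. \<omega> k \<in> C (nk k)" "stops_near \<nu> c \<omega>' (\<lambda>k. e (nk k)) \<omega>"
      have "\<forall>\<^sub>F k in sequentially. terminal_statistic Z1 Z2 \<mu> \<nu> c (e (nk k)) (\<omega> k) \<in> {cl..cu}"
        using near[OF H(3)] H(2) by (simp add: C_def)
      then have "limit_variable Y1 Y2 c \<omega>' \<in> {cl..cu}"
        using H(3) unfolding stops_near_def
        by (intro Lim_in_closed_set[of "{cl..cu}" _ sequentially]) auto
      with H(1) show "\<omega>' \<in> {\<omega> \<in> space N. limit_variable Y1 Y2 c \<omega> \<in> {cl..cu}}" by simp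
    qed
    then show ?thesis unfolding prob_limit_variable[OF B] W[symmetric] in_W .
  qed
  have lb: "\<forall>\<^sub>F n in sequentially. measure M (space M - C n) < \<delta> + d" if d: "d > 0" for d
  proof -
    \<comment> \<open>The complement of the interval is enlarged to a closed set so that limits stay
      inside; the endpoints add no mass because F is continuous there.\<close>
    let ?B = "{..cl} \<union> {cu..}"
    have B: "?B \<in> sets borel" by simp
    have "\<forall>\<^sub>F n in sequentially. measure M (space M - C n) < measure N {\<omega> \<in> space N. limit_variable Y1 Y2 c \<omega> \<in> ?B} + d"
    proof (rule eventually_prob_less_of_stopping[OF Ainv nu early c0 pos' cont' e sets.compl_sets[OF Cm] limit_variable_vimage[OF B] _ d])
      fix \<omega>' nk \<omega> assume H: "\<omega>' \<in> space N" "\<And>k. \<omega> k \<in> space M - C (nk k)" "stops_near \<nu> c \<omega>' (\<lambda>k. e (nk k)) \<omega>"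
      have "\<forall>\<^sub>F k in sequentially. \<omega> k \<in> C (nk k) \<longleftrightarrow> terminal_statistic Z1 Z2 \<mu> \<nu> c (e (nk k)) (\<omega> k) \<in> {cl..cu}"
        using H(2) by (intro near[OF H(3)]) blast
      then have "\<forall>\<^sub>F k in sequentially. terminal_statistic Z1 Z2 \<mu> \<nu> c (e (nk k)) (\<omega> k) \<in> ?B"
        by eventually_elim (use H(2) in auto)
      then have "limit_variable Y1 Y2 c \<omega>' \<in> ?B"
        using H(3) unfolding stops_near_def
        by (intro Lim_in_closed_set[of ?B _ sequentially]) auto
      with H(1) show "\<omega>' \<in> {\<omega> \<in> space N. limit_variable Y1 Y2 c \<omega> \<in> ?B}" by simp
    qed
    then show ?thesis unfolding prob_limit_variable[OF B] W[symmetric] out_W .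
  qed
  show "(\<lambda>n. measure M {\<omega> \<in> space M. \<mu> \<in> confidence_interval Z1 Z2 \<nu> cl cu (e n) \<omega>}) \<longlonglongrightarrow> 1 - \<delta>"
    unfolding C_def[symmetric]
  proof (rule order_tendstoI)
    fix b assume "1 - \<delta> < b"
    then show "\<forall>\<^sub>F n in sequentially. measure M (C n) < b"
      using ub[of "b - (1 - \<delta>)"] by simp
  next
    fix b assume "b < 1 - \<delta>"
    then have "\<forall>\<^sub>F n in sequentially. measure M (space M - C n) < \<delta> + (1 - \<delta> - b)"
      by (intro lb) simp
    then show "\<forall>\<^sub>F n in sequentially. b < measure M (C n)"
      by eventually_elim (use Z.prob_compl[OF Cm] in simp)
  qed
qed simp

end

theorem theorem3p2:
  fixes M :: "'a measure" and N :: "'b measure"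
    and Z1 Z2 :: "real \<Rightarrow> 'a \<Rightarrow> real" and Y1 Y2 :: "real \<Rightarrow> 'b \<Rightarrow> real"
    and L Ainv :: "real \<Rightarrow> real" and \<mu> h \<nu> :: real
  assumes lim: "functional_limit M N Z1 Z2 \<mu> h L Y1 Y2"
    and Ainv: "asymptotic_inverse (\<lambda>x. x powr (1 - h) * L x) Ainv"
    and nu: "0 < \<nu>" "\<nu> < 1 / (1 - h)"
    and early: "no_early_stopping M Z2 (\<lambda>\<epsilon>. Ainv (1 / \<epsilon>)) \<nu>"
    and Phi_pos: "AE \<omega> in N. Phi 1 (\<lambda>t. Y2 t \<omega>) 1 > 0"
  shows "(\<forall>c>0. (AE \<omega> in N. isCont (Phi c (\<lambda>t. Y2 t \<omega>)) 1) \<longrightarrow>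
            converges_in_distribution M (terminal_statistic Z1 Z2 \<mu> \<nu> c) N (limit_variable Y1 Y2 c)) \<and>
         (\<forall>c>0. \<forall>c'>0. same_distribution N (limit_variable Y1 Y2 c) (limit_variable Y1 Y2 c')) \<and>
         (\<forall>\<delta>\<in>{0<..<1}.
            (let F = cdf (distr N borel (limit_variable Y1 Y2 1));
                 cl = quantile F (\<delta> / 2);
                 cu = quantile F (1 - \<delta> / 2)
             in cl < cu \<and> isCont F cl \<and> isCont F cu \<and>
                (AE \<omega> in N. isCont (Phi (cu - cl) (\<lambda>t. Y2 t \<omega>)) 1) \<longrightarrow>
                ((\<lambda>\<epsilon>. measure M {\<omega> \<in> space M. \<mu> \<in> confidence_interval Z1 Z2 \<nu> cl cu \<epsilon> \<omega>})
                   \<longlongrightarrow> 1 - \<delta>) (at_right 0)))"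
proof -
  interpret functional_limit M N Z1 Z2 \<mu> h L Y1 Y2 by (rule lim)
  \<comment> \<open>Positivity is assumed for c = 1 only; scaling extends it to every c > 0, in
    particular to cu - cl.\<close>
  note pos = Phi_pos_scale[OF Phi_pos]
  show ?thesis
  proof (intro conjI allI impI ballI)
    fix c :: real assume c: "c > 0" and cont: "AE \<omega> in N. isCont (Phi c (\<lambda>t. Y2 t \<omega>)) 1"
    show "converges_in_distribution M (terminal_statistic Z1 Z2 \<mu> \<nu> c) N (limit_variable Y1 Y2 c)"
      by (rule terminal_statistic_converges[OF Ainv nu early c pos[OF c] cont])
  next
    fix c c' :: real assume "c > 0" "c' > 0"
    then show "same_distribution N (limit_variable Y1 Y2 c) (limit_variable Y1 Y2 c')"
      unfolding same_distribution_def
      by (intro conjI limit_variable_measurable limit_variable_law)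
  next
    fix \<delta> :: real assume \<delta>: "\<delta> \<in> {0<..<1}"
    define F where "F = cdf (distr N borel (limit_variable Y1 Y2 1))"
    define cl where "cl = quantile F (\<delta> / 2)"
    define cu where "cu = quantile F (1 - \<delta> / 2)"
    have "((\<lambda>\<epsilon>. measure M {\<omega> \<in> space M. \<mu> \<in> confidence_interval Z1 Z2 \<nu> cl cu \<epsilon> \<omega>}) \<longlongrightarrow> 1 - \<delta>) (at_right 0)"
      if H: "cl < cu" "isCont F cl" "isCont F cu" "AE \<omega> in N. isCont (Phi (cu - cl) (\<lambda>t. Y2 t \<omega>)) 1"
    proof (rule coverage_converges[OF Ainv nu early H(1) _ H(4) H(2,3)[unfolded F_def]])
      show "AE \<omega> in N. Phi (cu - cl) (\<lambda>t. Y2 t \<omega>) 1 > 0" using H(1) by (intro pos) simp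
      note q = cdf_quantile[OF real_distribution_limit_variable, of _ 1, folded F_def]
      show "cdf (distr N borel (limit_variable Y1 Y2 1)) cl = \<delta> / 2"
        using q[of "\<delta> / 2"] H(2) \<delta> by (simp add: cl_def F_def)
      show "cdf (distr N borel (limit_variable Y1 Y2 1)) cu = 1 - \<delta> / 2"
        using q[of "1 - \<delta> / 2"] H(3) \<delta> by (simp add: cu_def F_def)
    qed
    then show "let F = cdf (distr N borel (limit_variable Y1 Y2 1));
            cl = quantile F (\<delta> / 2); cu = quantile F (1 - \<delta> / 2)
         in cl < cu \<and> isCont F cl \<and> isCont F cu \<and>
            (AE \<omega> in N. isCont (Phi (cu - cl) (\<lambda>t. Y2 t \<omega>)) 1) \<longrightarrow>
            ((\<lambda>\<epsilon>. measure M {\<omega> \<in> space M. \<mu> \<in> confidence_interval Z1 Z2 \<nu> cl cu \<epsilon> \<omega>})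
               \<longlongrightarrow> 1 - \<delta>) (at_right 0)"
      unfolding Let_def F_def[symmetric] cl_def[symmetric] cu_def[symmetric] by blast
  qed
qed

end
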